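(* Up to isomorphism, the only two-ended, connected, locally finite, vertex-transitive graphs that have a unique hamiltonian circle are: (1) the square of the two-way-infinite path, i.e. the graph with vertex set $\mathbb{Z}$ in which $i$ and $j$ are adjacent iff $|i-j|\in\{1,2\}$; and (2) the two-way-infinite ladder, i.e. the graph with vertex set $\{x_i\}_{i\in\mathbb{Z}}\cup\{y_i\}_{i\in\mathbb{Z}}$ whose edges are $x_i x_{i+1}$, $y_i y_{i+1}$ and $x_i y_i$ for all $i\in\mathbb{Z}$.
   Context: A graph is vertex-transitive if its automorphism group acts transitively on its vertices. For a connected locally finite graph $X$, the number of ends of $X$ is the smallest $k\in\mathbb{N}\cup\{\infty\}$ such that for every finite set $K\subseteq V(X)$, the graph $X\smallsetminus K$ has at most $k$ infinite connected components. The Freudenthal compactification $|X|$ is obtained from $X$, viewed as a 1-dimensional simplicial complex, by adding one point for each end. A hamiltonian circle in $X$ is a subspace of $|X|$ homeomorphic to the circle $S^1$ that contains all vertices of $X$; its intersection with $X$ is a spanning 2-regular subgraph (2-factor), and a hamiltonian circle is identified with this 2-factor. (Equivalently, when $X$ has exactly two ends $\pm\infty$, a 2-factor is a hamiltonian circle iff it is the vertex-disjoint union of two two-way-infinite paths each of which converges to $-\infty$ in one direction and to $+\infty$ in the other.) *)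

theory Defs
  imports "HOL-Analysis.Analysis" "HOL-Library.Extended_Nat"
begin

record 'a ugraph =
  verts :: "'a set"
  edges :: "'a set set"

definition simple_graph :: "'a ugraph \<Rightarrow> bool" where
  "simple_graph G \<longleftrightarrow>
     (\<forall>e\<in>edges G. \<exists>u\<in>verts G. \<exists>v\<in>verts G. u \<noteq> v \<and> e = {u, v})"

definition locally_finite :: "'a ugraph \<Rightarrow> bool" where
  "locally_finite G \<longleftrightarrow> (\<forall>v\<in>verts G. finite {u. {v, u} \<in> edges G})"

definition graph_iso :: "('a \<Rightarrow> 'b) \<Rightarrow> 'a ugraph \<Rightarrow> 'b ugraph \<Rightarrow> bool" where
  "graph_iso f G H \<longleftrightarrow> bij_betw f (verts G) (verts H) \<and>
     (\<forall>u\<in>verts G. \<forall>v\<in>verts G. {u, v} \<in> edges G \<longleftrightarrow> {f u, f v} \<in> edges H)"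

definition isomorphic :: "'a ugraph \<Rightarrow> 'b ugraph \<Rightarrow> bool" where
  "isomorphic G H \<longleftrightarrow> (\<exists>f. graph_iso f G H)"

definition vertex_transitive :: "'a ugraph \<Rightarrow> bool" where
  "vertex_transitive G \<longleftrightarrow>
     (\<forall>u\<in>verts G. \<forall>v\<in>verts G. \<exists>f. graph_iso f G G \<and> f u = v)"

definition delete_verts :: "'a ugraph \<Rightarrow> 'a set \<Rightarrow> 'a ugraph" where
  "delete_verts G K = \<lparr>verts = verts G - K, edges = {e \<in> edges G. e \<inter> K = {}}\<rparr>"

definition component_of :: "'a ugraph \<Rightarrow> 'a \<Rightarrow> 'a set" where
  "component_of G v = {w. (v, w) \<in> {(x, y). {x, y} \<in> edges G}\<^sup>*}"

definition components :: "'a ugraph \<Rightarrow> 'a set set" where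
  "components G = component_of G ` verts G"

definition connected_graph :: "'a ugraph \<Rightarrow> bool" where
  "connected_graph G \<longleftrightarrow> (\<exists>C. components G = {C})"

definition infinite_components :: "'a ugraph \<Rightarrow> 'a set \<Rightarrow> 'a set set" where
  "infinite_components G K = {C \<in> components (delete_verts G K). infinite C}"

definition at_most :: "'b set \<Rightarrow> enat \<Rightarrow> bool" where
  "at_most A k \<longleftrightarrow> (case k of enat n \<Rightarrow> finite A \<and> card A \<le> n | \<infinity> \<Rightarrow> True)"

definition number_of_ends :: "'a ugraph \<Rightarrow> enat" where
  "number_of_ends G =
     (LEAST k. \<forall>K. finite K \<and> K \<subseteq> verts G \<longrightarrow> at_most (infinite_components G K) k)"

text \<open>
  The points of the 1-dimensional simplicial complex of a graph are given by their barycentric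
  coordinates: nonnegative functions on the vertices that have sum 1 and whose support is a
  simplex, i.e. a single vertex or an edge. The topology is the weak one: a set is open iff its
  trace on every closed edge is.
\<close>

definition complex_points :: "'a ugraph \<Rightarrow> ('a \<Rightarrow> real) set" where
  "complex_points G = {p. (\<forall>x. 0 \<le> p x) \<and>
     {x. p x \<noteq> 0} \<in> (\<lambda>v. {v}) ` verts G \<union> edges G \<and> (\<Sum>x | p x \<noteq> 0. p x) = 1}"

definition vertex_point :: "'a \<Rightarrow> 'a \<Rightarrow> real" where
  "vertex_point v = (\<lambda>x. if x = v then 1 else 0)"

definition edge_point :: "'a \<Rightarrow> 'a \<Rightarrow> real \<Rightarrow> 'a \<Rightarrow> real" where
  "edge_point u v t = (\<lambda>x. (1 - t) * vertex_point u x + t * vertex_point v x)"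

definition complex_topology :: "'a ugraph \<Rightarrow> ('a \<Rightarrow> real) topology" where
  "complex_topology G = topology (\<lambda>U. U \<subseteq> complex_points G \<and>
     (\<forall>u v. {u, v} \<in> edges G \<longrightarrow>
        openin (top_of_set {0..1}) {t \<in> {0..1}. edge_point u v t \<in> U}))"

lemma openin_complex_topology:
  "openin (complex_topology G) U \<longleftrightarrow> U \<subseteq> complex_points G \<and>
     (\<forall>u v. {u, v} \<in> edges G \<longrightarrow>
        openin (top_of_set {0..1}) {t \<in> {0..1}. edge_point u v t \<in> U})"
proof -
  let ?T = "\<lambda>U u v. {t \<in> {0..1}. edge_point u v t \<in> U}"
  have int: "?T (S \<inter> S') u v = ?T S u v \<inter> ?T S' u v" for S S' u v
    by auto
  have un: "?T (\<Union>\<K>) u v = (\<Union>S\<in>\<K>. ?T S u v)" for \<K> u v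
    by auto
  have "istopology (\<lambda>U. U \<subseteq> complex_points G \<and>
     (\<forall>u v. {u, v} \<in> edges G \<longrightarrow> openin (top_of_set {0..1}) (?T U u v)))"
    unfolding istopology_def
  proof (intro conjI allI impI)
    fix S S' u v
    assume "S \<subseteq> complex_points G \<and>
       (\<forall>u v. {u, v} \<in> edges G \<longrightarrow> openin (top_of_set {0..1}) (?T S u v))"
      and "S' \<subseteq> complex_points G \<and>
       (\<forall>u v. {u, v} \<in> edges G \<longrightarrow> openin (top_of_set {0..1}) (?T S' u v))"
      and "{u, v} \<in> edges G"
    then show "openin (top_of_set {0..1}) (?T (S \<inter> S') u v)"
      unfolding int by (intro openin_Int) simp_all
  next
    fix \<K> u v
    assume "\<forall>S\<in>\<K>. S \<subseteq> complex_points G \<and>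
       (\<forall>u v. {u, v} \<in> edges G \<longrightarrow> openin (top_of_set {0..1}) (?T S u v))"
      and "{u, v} \<in> edges G"
    then show "openin (top_of_set {0..1}) (?T (\<Union>\<K>) u v)"
      unfolding un by (intro openin_Union) auto
  qed auto
  then show ?thesis
    unfolding complex_topology_def by (simp only: topology_inverse')
qed

text \<open>
  An end chooses, compatibly, an infinite component of \<open>G - K\<close> for every finite set \<open>K\<close> of
  vertices: the ends form the inverse limit of the sets of infinite components. (For a locally
  finite graph these correspond to the equivalence classes of rays.)
\<close>

definition ends :: "'a ugraph \<Rightarrow> ('a set \<Rightarrow> 'a set) set" where
  "ends G = {\<omega> \<in> (\<Pi>\<^sub>E K\<in>{K. finite K \<and> K \<subseteq> verts G}. infinite_components G K).
     \<forall>K L. finite L \<and> L \<subseteq> verts G \<and> K \<subseteq> L \<longrightarrow> \<omega> L \<subseteq> \<omega> K}"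

datatype 'a fpoint = Pt "'a \<Rightarrow> real" | End "'a set \<Rightarrow> 'a set"

text \<open>
  The basic open neighbourhood of an end \<open>\<omega>\<close> determined by a finite set \<open>K\<close> of vertices: the
  points of the topological component of the complex minus \<open>K\<close> that contains \<open>\<omega> K\<close> (it consists
  of \<open>\<omega> K\<close>, all edges inside \<open>\<omega> K\<close>, and the edges between \<open>\<omega> K\<close> and \<open>K\<close> without their endpoint in
  \<open>K\<close>), together with all ends that live in that component.
\<close>

definition end_nbhd :: "'a ugraph \<Rightarrow> 'a set \<Rightarrow> ('a set \<Rightarrow> 'a set) \<Rightarrow> 'a fpoint set" where
  "end_nbhd G K \<omega> = Pt ` {p \<in> complex_points G. \<exists>x\<in>\<omega> K. p x \<noteq> 0} \<union>
     End ` {\<omega>' \<in> ends G. \<omega>' K = \<omega> K}"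

definition freudenthal :: "'a ugraph \<Rightarrow> 'a fpoint topology" where
  "freudenthal G = topology_generated_by
     ({Pt ` U | U. openin (complex_topology G) U} \<union>
      {end_nbhd G K \<omega> | K \<omega>. finite K \<and> K \<subseteq> verts G \<and> \<omega> \<in> ends G})"

definition hamiltonian_circle :: "'a ugraph \<Rightarrow> 'a fpoint set \<Rightarrow> bool" where
  "hamiltonian_circle G C \<longleftrightarrow> C \<subseteq> topspace (freudenthal G) \<and>
     subtopology (freudenthal G) C homeomorphic_space top_of_set (sphere (0::complex) 1) \<and>
     (\<forall>v\<in>verts G. Pt (vertex_point v) \<in> C)"

lemma topspace_complex_topology:
  assumes "simple_graph G"
  shows "topspace (complex_topology G) = complex_points G"
proof (rule antisym)
  show "topspace (complex_topology G) \<subseteq> complex_points G"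
    using openin_topspace[of "complex_topology G"] unfolding openin_complex_topology ..
  have "edge_point u v t \<in> complex_points G"
    if e: "{u, v} \<in> edges G" and t: "t \<in> {0..1}" for u v t
  proof -
    obtain a b where "a \<in> verts G" "b \<in> verts G" "a \<noteq> b" "{u, v} = {a, b}"
      using assms e unfolding simple_graph_def by metis
    then have uv: "u \<in> verts G" "v \<in> verts G" "u \<noteq> v"
      by (auto simp: doubleton_eq_iff)
    consider "t = 0" | "t = 1" | "0 < t" "t < 1" using t by force
    then show ?thesis
    proof cases
      case 3
      then have supp: "{x. edge_point u v t x \<noteq> 0} = {u, v}"
        using uv by (auto simp: edge_point_def vertex_point_def)
      moreover have "0 \<le> edge_point u v t x" for x
        using 3 by (simp add: edge_point_def vertex_point_def)
      moreover have "(\<Sum>x\<in>{u, v}. edge_point u v t x) = 1"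
        using uv by (simp add: edge_point_def vertex_point_def)
      ultimately show ?thesis
        using e by (simp add: complex_points_def)
    qed (use uv in \<open>auto simp: complex_points_def edge_point_def vertex_point_def\<close>)
  qed
  then have "{t \<in> {0..1}. edge_point u v t \<in> complex_points G} = {0..1}"
    if "{u, v} \<in> edges G" for u v
    using that by blast
  then have "openin (complex_topology G) (complex_points G)"
    by (simp add: openin_complex_topology)
  then show "complex_points G \<subseteq> topspace (complex_topology G)"
    by (rule openin_subset)
qed

lemma topspace_freudenthal:
  fixes G :: "'a ugraph"
  assumes "simple_graph G"
  shows "topspace (freudenthal G) = Pt ` complex_points G \<union> End ` ends G"
proof (intro equalityI subsetI)
  fix x
  assume "x \<in> topspace (freudenthal G)"
  then consider U where "openin (complex_topology G) U" "x \<in> Pt ` U"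
    | K \<omega> where "x \<in> end_nbhd G K \<omega>"
    unfolding freudenthal_def topology_generated_by_topspace by blast
  then show "x \<in> Pt ` complex_points G \<union> End ` ends G"
  proof cases
    case 1
    then show ?thesis using openin_complex_topology[of G U] by blast
  next
    case 2
    then show ?thesis unfolding end_nbhd_def by blast
  qed
next
  fix x
  assume "x \<in> Pt ` complex_points G \<union> End ` ends G"
  then consider "x \<in> Pt ` complex_points G" | \<omega> where "\<omega> \<in> ends G" "x = End \<omega>"
    by blast
  then show "x \<in> topspace (freudenthal G)"
  proof cases
    case 1
    moreover have "openin (complex_topology G) (complex_points G)"
      using openin_topspace[of "complex_topology G"]
      by (simp only: topspace_complex_topology[OF assms])
    ultimately show ?thesis
      unfolding freudenthal_def topology_generated_by_topspace by blast
  next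
    case 2
    then have "x \<in> end_nbhd G {} \<omega>"
      by (simp add: end_nbhd_def)
    moreover have "finite ({} :: 'a set)" "{} \<subseteq> verts G" by simp_all
    ultimately show ?thesis
      using 2(1) unfolding freudenthal_def topology_generated_by_topspace by blast
  qed
qed

definition path_square :: "int ugraph" where
  "path_square = \<lparr>verts = UNIV, edges = {{i, j} | i j. \<bar>i - j\<bar> \<in> {1, 2}}\<rparr>"

text \<open>The vertex \<open>x\<^sub>i\<close> of the ladder is \<open>Inl i\<close> and the vertex \<open>y\<^sub>i\<close> is \<open>Inr i\<close>.\<close>

definition ladder :: "(int + int) ugraph" where
  "ladder = \<lparr>verts = UNIV,
     edges = range (\<lambda>i. {Inl i, Inl (i + 1)}) \<union> range (\<lambda>i. {Inr i, Inr (i + 1)}) \<union>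
       range (\<lambda>i. {Inl i, Inr i})\<rparr>"

end

theory Submission
  imports Defs
begin

text \<open>
  In a two-ended graph a Hamiltonian circle is a pair of disjoint two-way infinite rays covering all
  vertices, both leading from one end to the other: the traces of the circle on the edges form a
  2-factor (a circle contains no triod and is not disconnected by a point), and removing the two ends
  from the circle leaves exactly two arcs. Conversely every such pair of rays closes up to a circle.

  If the circle is unique, then the automorphisms preserve the pair of rays and act on it by affine
  maps, which leaves few parameters: either a translation by one step exists, or the automorphisms
  act as an infinite dihedral group together with an exchange of the rays. In every case other than
  the square of the path and the ladder, the chords allow to reroute the two rays into another pair.
  Conversely, in the two exceptional graphs the narrow cuts force both rays.
\<close>

section \<open>Rerouting two rays\<close>

text \<open>The combinatorics is kept apart from the topology. Once the rays are labelled by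
  \<open>bool \<times> int\<close>, uniqueness of the circle becomes \<open>rigid\<close>, a
  property of a relation on labels, and every forbidden chord pattern is refuted by one explicit
  bijection \<open>\<Phi>\<close>. The affine parameters are limited by finite degree, by the
  finiteness of the set of edges across a cut, and by a consequence of both: the positions of the
  two ends of a rung differ by only finitely many values. This forces an automorphism to have the
  same direction on both rays and a translation to move both by the same amount; a translation by
  two always exists. The delicate case is the dihedral one, where a rung of offset \<open>d\<close>
  need recur only at every second position. Relabelling the ray \<open>True\<close> by
  \<open>d + 1\<close> turns these rungs into twisted chords with \<open>N = 2 * d + 2\<close>,
  which is where the exceptional values 4 and 6 come from. On the topological side, two-endedness is
  expressed by one set \<open>A\<close> of vertices that separates the ends; every fact about one
  end then gives the one about the other end by passing to the complement.\<close>

definition standard_edge :: "bool \<times> int \<Rightarrow> bool \<times> int \<Rightarrow> bool" where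
  "standard_edge u v \<longleftrightarrow> fst u = fst v \<and> \<bar>snd u - snd v\<bar> = 1"

text \<open>The pair \<open>(s, i)\<close> stands for the \<open>i\<close>-th vertex of the ray \<open>s\<close> of a given circle, and \<open>\<Phi>\<close> lists
  the vertices of another pair of rays; the bound on \<open>\<Phi>\<close> makes both of its rays run from one end
  to the other. A graph is rigid if every such pair has the same edges as the given one.\<close>

definition two_rays :: "(bool \<times> int \<Rightarrow> bool \<times> int \<Rightarrow> bool) \<Rightarrow> (bool \<times> int \<Rightarrow> bool \<times> int) \<Rightarrow> bool" where
  "two_rays H \<Phi> \<longleftrightarrow> bij \<Phi> \<and> (\<forall>s i. H (\<Phi> (s, i)) (\<Phi> (s, i + 1))) \<and>
     (\<exists>\<sigma>\<in>{1, -1}. \<exists>B. \<forall>s i. \<bar>snd (\<Phi> (s, i)) - \<sigma> * i\<bar> \<le> B)"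

definition rigid :: "(bool \<times> int \<Rightarrow> bool \<times> int \<Rightarrow> bool) \<Rightarrow> bool" where
  "rigid H \<longleftrightarrow> (\<forall>u v. H u v \<longrightarrow> H v u) \<and> (\<forall>s i. H (s, i) (s, i + 1)) \<and>
     (\<forall>\<Phi>. two_rays H \<Phi> \<longrightarrow> (\<forall>s i. standard_edge (\<Phi> (s, i)) (\<Phi> (s, i + 1))))"

lemma rigidD:
  assumes "rigid H"
  shows "H u v \<Longrightarrow> H v u" "H (s, i) (s, i + 1)" "H (s, i) (s, i - 1)"
    "two_rays H \<Phi> \<Longrightarrow> standard_edge (\<Phi> (s, i)) (\<Phi> (s, i + 1))"
proof -
  show "H (s, i) (s, i - 1)"
    using assms unfolding rigid_def by (metis diff_add_cancel)
qed (use assms in \<open>unfold rigid_def, blast+\<close>)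

lemma rigid_step: "rigid H \<Longrightarrow> \<bar>i - j\<bar> = 1 \<Longrightarrow> H (s, i) (s, j)"
proof -
  assume "rigid H" "\<bar>i - j\<bar> = 1"
  moreover from this have "j = i + 1 \<or> j = i - 1" by linarith
  ultimately show ?thesis using rigidD(2,3) by blast
qed

lemma rigid_not_two_rays:
  assumes "rigid H" "two_rays H \<Phi>"
  shows "fst (\<Phi> (s, i)) = fst (\<Phi> (s, i + 1))" "\<bar>snd (\<Phi> (s, i)) - snd (\<Phi> (s, i + 1))\<bar> = 1"
  using rigidD(4)[OF assms] by (auto simp: standard_edge_def)

lemma two_raysI:
  assumes "\<And>v. \<Psi> (\<Phi> v) = v" "\<And>v. \<Phi> (\<Psi> v) = v" "\<And>s i. H (\<Phi> (s, i)) (\<Phi> (s, i + 1))"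
    "\<sigma> \<in> {1, -1}" "\<And>s i. \<bar>snd (\<Phi> (s, i)) - \<sigma> * i\<bar> \<le> B"
  shows "two_rays H \<Phi>"
proof -
  have "bij \<Phi>" using assms(1,2) by (metis bijI')
  then show ?thesis unfolding two_rays_def using assms(3-5) by blast
qed

text \<open>The map \<open>\<psi>\<close> carries ray pairs of the relabelled graph to ray pairs of
  \<open>H\<close>, and it preserves and reflects the edges of the given rays, so rigidity
  transfers. This gives the freedom to normalise positions and directions.\<close>

lemma rigid_relabel:
  assumes H: "rigid H" and bij: "bij \<psi>" and step: "\<And>s i. standard_edge (\<psi> (s, i)) (\<psi> (s, i + 1))"
    and \<epsilon>: "\<epsilon> \<in> {1, -1}" and B: "\<And>s i. \<bar>snd (\<psi> (s, i)) - \<epsilon> * i\<bar> \<le> B"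
    and inv: "\<And>u v. standard_edge (\<psi> u) (\<psi> v) \<Longrightarrow> standard_edge u v"
  shows "rigid (\<lambda>u v. H (\<psi> u) (\<psi> v))"
  unfolding rigid_def
proof (intro conjI allI impI)
  fix s and i :: int
  show "H (\<psi> (s, i)) (\<psi> (s, i + 1))"
    using step[of s i] rigid_step[OF H, of "snd (\<psi> (s, i))" "snd (\<psi> (s, i + 1))" "fst (\<psi> (s, i))"]
    unfolding standard_edge_def by (cases "\<psi> (s, i)"; cases "\<psi> (s, i + 1)") simp
next
  fix \<Phi> s i assume "two_rays (\<lambda>u v. H (\<psi> u) (\<psi> v)) \<Phi>"
  then obtain \<sigma> B' where \<Phi>: "bij \<Phi>" "\<And>s i. H (\<psi> (\<Phi> (s, i))) (\<psi> (\<Phi> (s, i + 1)))"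
    "\<sigma> \<in> {1, -1}" "\<And>s i. \<bar>snd (\<Phi> (s, i)) - \<sigma> * i\<bar> \<le> B'"
    unfolding two_rays_def by blast
  have "\<bar>snd (\<psi> (\<Phi> (s, i))) - (\<epsilon> * \<sigma>) * i\<bar> \<le> B + B'" for s i
    using B[of "fst (\<Phi> (s, i))" "snd (\<Phi> (s, i))"] \<Phi>(3) \<Phi>(4)[of s i] \<epsilon> by auto
  moreover have "\<epsilon> * \<sigma> \<in> {1, -1}" using \<epsilon> \<Phi>(3) by auto
  moreover have "bij (\<psi> \<circ> \<Phi>)" using bij \<Phi>(1) by (rule bij_comp[rotated])
  ultimately have "two_rays H (\<psi> \<circ> \<Phi>)"
    unfolding two_rays_def using \<Phi>(2) by (metis comp_apply)
  from rigidD(4)[OF H this, of s i] show "standard_edge (\<Phi> (s, i)) (\<Phi> (s, i + 1))"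
    by (simp add: inv)
qed (use rigidD(1)[OF H] in blast)

text \<open>Reversing the segment from \<open>a + 1\<close> to \<open>a + k\<close> keeps its inner
  edges and replaces the two edges that leave it by the two chords.\<close>

lemma rigid_no_parallel_chords:
  assumes H: "rigid H" and k: "k \<ge> 2"
    and e: "H (z, a) (z, a + k)" "H (z, a + 1) (z, a + k + 1)"
  shows False
proof -
  define \<Phi> where "\<Phi> = (\<lambda>(s, i). (s, if s = z \<and> a + 1 \<le> i \<and> i \<le> a + k then 2 * a + k + 1 - i else i))"
  have inv: "\<Phi> (\<Phi> v) = v" for v by (cases v) (auto simp: \<Phi>_def)
  have "two_rays H \<Phi>"
  proof (rule two_raysI[where \<Psi> = \<Phi>, OF inv inv])
    show "H (\<Phi> (s, i)) (\<Phi> (s, i + 1))" for s i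
    proof -
      consider "s \<noteq> z \<or> i < a \<or> i > a + k" | "s = z" "i = a" | "s = z" "i = a + k"
        | "s = z" "a < i" "i < a + k" by linarith
      then show ?thesis
        by cases (use k e rigid_step[OF H] in \<open>auto simp: \<Phi>_def algebra_simps\<close>)
    qed
    show "\<bar>snd (\<Phi> (s, i)) - 1 * i\<bar> \<le> k" for s i using k by (auto simp: \<Phi>_def)
  qed simp
  from rigid_not_two_rays(2)[OF H this, of z a] show False using k by (auto simp: \<Phi>_def)
qed

text \<open>Along the two crossing rungs the rays can exchange their continuations beyond
  \<open>a\<close> and \<open>b\<close>.\<close>

lemma rigid_no_crossing:
  assumes H: "rigid H" and e: "H (False, a) (True, b + 1)" "H (False, a + 1) (True, b)"
  shows False
proof -
  define \<Phi> where "\<Phi> = (\<lambda>(s, i). if s then (if i \<le> b then (True, i) else (False, i - b + a))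
     else (if i \<le> a then (False, i) else (True, i - a + b)))"
  have inv: "\<Phi> (\<Phi> v) = v" for v by (cases v) (auto simp: \<Phi>_def)
  have "two_rays H \<Phi>"
  proof (rule two_raysI[where \<Psi> = \<Phi>, OF inv inv])
    show "H (\<Phi> (s, i)) (\<Phi> (s, i + 1))" for s i
    proof -
      consider "s" "i < b" | "s" "i = b" | "s" "i > b" | "\<not> s" "i < a" | "\<not> s" "i = a" | "\<not> s" "i > a"
        by linarith
      then show ?thesis
        by cases (use e rigidD(1)[OF H e(2)] rigid_step[OF H] in \<open>auto simp: \<Phi>_def add.commute\<close>)
    qed
    show "\<bar>snd (\<Phi> (s, i)) - 1 * i\<bar> \<le> \<bar>a - b\<bar>" for s i by (auto simp: \<Phi>_def)
  qed simp
  from rigid_not_two_rays(1)[OF H this, of False a] show False by (auto simp: \<Phi>_def)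
qed

text \<open>One ray steps from \<open>(False, 0)\<close> over to \<open>(True, m)\<close> and
  straight back to \<open>(False, m)\<close>, skipping the positions strictly between 0 and
  \<open>m\<close>. The other ray leaves \<open>True\<close> at \<open>m - 1\<close>, collects the
  skipped vertices in descending order and returns at \<open>m + 1\<close>. There is something to
  collect because \<open>m \<ge> 2\<close>.\<close>

lemma rigid_no_distant_offsets:
  assumes H: "rigid H" and m: "m \<ge> 2"
    and e: "\<And>i. H (False, i) (True, i)" "\<And>i. H (False, i) (True, i + m)"
  shows False
proof -
  define \<Phi> where "\<Phi> = (\<lambda>(s, i).
     if s then (if i \<le> m - 1 then (True, i) else if i \<le> 2 * m - 2 then (False, 2 * m - 1 - i) else (True, i - m + 2))
     else (if i \<le> 0 then (False, i) else if i = 1 then (True, m) else (False, m + i - 2)))"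
  define \<Psi> where "\<Psi> = (\<lambda>(s, j).
     if s then (if j \<le> m - 1 then (True, j) else if j = m then (False, 1) else (True, j + m - 2))
     else (if j \<le> 0 then (False, j) else if j \<le> m - 1 then (True, 2 * m - 1 - j) else (False, j - m + 2)))"
  have "two_rays H \<Phi>"
  proof (rule two_raysI[where \<Psi> = \<Psi>])
    show "\<Psi> (\<Phi> v) = v" for v by (cases v) (use m in \<open>auto simp: \<Phi>_def \<Psi>_def\<close>)
    show "\<Phi> (\<Psi> v) = v" for v by (cases v) (use m in \<open>auto simp: \<Phi>_def \<Psi>_def\<close>)
    show "H (\<Phi> (s, i)) (\<Phi> (s, i + 1))" for s i
    proof -
      note s = rigid_step[OF H]
      have e': "H (True, i) (False, i)" "H (True, i + m) (False, i)" for i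
        using e rigidD(1)[OF H] by blast+
      have last: "H (False, m * 2 - (1 + i)) (True, 1 + m)" if "i + 2 = m * 2"
      proof -
        have "i = m * 2 - 2" using that by linarith
        then show ?thesis using e(2)[of 1] by (simp add: add.commute)
      qed
      consider "s" "i < m - 1" | "s" "i = m - 1" | "s" "m - 1 < i" "i < 2 * m - 2" | "s" "i = 2 * m - 2"
        | "s" "i > 2 * m - 2" | "\<not> s" "i < 0" | "\<not> s" "i = 0" | "\<not> s" "i = 1" | "\<not> s" "i > 1"
        by linarith
      then show ?thesis
        by cases (use m e[of 0] e'(1)[of m] e'(1)[of "m - 1"] e(2)[of 1] s last in \<open>auto simp: \<Phi>_def algebra_simps\<close>)
    qed
    show "\<bar>snd (\<Phi> (s, i)) - 1 * i\<bar> \<le> 2 * m" for s i using m by (auto simp: \<Phi>_def)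
  qed simp
  from rigid_not_two_rays(1)[OF H this, of False 0] show False by (auto simp: \<Phi>_def)
qed

lemma mod_div_shift:
  fixes r N b :: int
  assumes "0 \<le> r" "r < N"
  shows "(r + N * b) mod N = r" "(r + N * b) div N = b"
  using assms by auto

lemma mod_div_succ:
  fixes i N :: int
  assumes "N > 1"
  shows "(i + 1) mod N = (if i mod N = N - 1 then 0 else i mod N + 1)"
    "(i + 1) div N = (if i mod N = N - 1 then i div N + 1 else i div N)"
proof -
  have i: "i = i mod N + N * (i div N)" by simp
  have r: "0 \<le> i mod N" "i mod N < N" using assms by simp_all
  show "(i + 1) mod N = (if i mod N = N - 1 then 0 else i mod N + 1)"
  proof (cases "i mod N = N - 1")
    case True
    then have "i + 1 = 0 + N * (i div N + 1)" using i unfolding distrib_left by linarith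
    then show ?thesis using mod_div_shift(1)[of 0 N] assms True by (metis less_trans order_refl zero_less_one)
  next
    case False
    then have "i + 1 = (i mod N + 1) + N * (i div N)" using i by linarith
    then show ?thesis using mod_div_shift(1)[of "i mod N + 1" N] r False by (smt (verit))
  qed
  show "(i + 1) div N = (if i mod N = N - 1 then i div N + 1 else i div N)"
  proof (cases "i mod N = N - 1")
    case True
    then have "i + 1 = 0 + N * (i div N + 1)" using i unfolding distrib_left by linarith
    then show ?thesis using mod_div_shift(2)[of 0 N] assms True by (metis less_trans order_refl zero_less_one)
  next
    case False
    then have "i + 1 = (i mod N + 1) + N * (i div N)" using i by linarith
    then show ?thesis using mod_div_shift(2)[of "i mod N + 1" N] r False by (smt (verit))
  qed
qed

text \<open>Cut the ray before every position congruent to \<open>0\<close> or \<open>2\<close> modulo \<open>k + 1\<close>; the chords join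
  the pieces to a single ray that runs through the blocks downwards.\<close>

lemma rigid_no_odd_chords:
  assumes H: "rigid H" and k: "k \<ge> 3" "odd k"
    and e: "\<And>i. even i \<Longrightarrow> H (False, i) (False, i + k)"
  shows False
proof -
  \<comment> \<open>A chord of length \<open>N - 1\<close> joins residue 0 of a block to the last
    residue of the same block, and residue 2 to residue 1 of the next block. Since \<open>N\<close>
    is even, both kinds start at even positions.\<close>
  define N where "N = k + 1"
  have N: "N \<ge> 4" "even N" using k by (auto simp: N_def)
  have e: "H (False, i + N - 1) (False, i)" if "even i" for i
    using e[OF that] rigidD(1)[OF H] by (simp add: N_def algebra_simps)
  \<comment> \<open>In the list, residues 0 and 1 of block \<open>n\<close> are taken from block
    \<open>- n\<close>, the others from the block below it; the chord between residue 1 and residue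
    2 makes this change.\<close>
  define \<beta> :: "int \<Rightarrow> int" where "\<beta> = (\<lambda>r. if r < 2 then 0 else -1)"
  \<comment> \<open>The ray \<open>True\<close> keeps its vertices but is listed backwards, because
    both rays must have the same direction \<open>\<sigma> = -1\<close>.\<close>
  define \<Phi> where "\<Phi> = (\<lambda>(s, i). (s, if s then - i else i mod N + N * (\<beta> (i mod N) - i div N)))"
  have r: "0 \<le> i mod N" "i mod N < N" for i using N by simp_all
  have idiv: "i mod N + N * (i div N) = i" for i by simp
  have inv: "\<Phi> (\<Phi> v) = v" for v
  proof (cases v)
    case (Pair s i)
    show ?thesis
      using mod_div_shift[OF r] idiv by (cases s) (simp_all add: \<Phi>_def Pair)
  qed
  have "two_rays H \<Phi>"
  proof (rule two_raysI[where \<Psi> = \<Phi>, OF inv inv])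
    show "H (\<Phi> (s, i)) (\<Phi> (s, i + 1))" for s i
    proof (cases s)
      case True
      then show ?thesis using rigid_step[OF H] by (simp add: \<Phi>_def)
    next
      case False
      let ?n = "i div N"
      consider "i mod N = N - 1" | "i mod N = 1" | "i mod N \<noteq> N - 1" "i mod N \<noteq> 1" by blast
      then show ?thesis
      proof cases
        case 1
        then have "\<Phi> (s, i) = (False, N * (- 1 - ?n) + N - 1)" "\<Phi> (s, i + 1) = (False, N * (- 1 - ?n))"
          using False N mod_div_succ[of N i] by (simp_all add: \<Phi>_def \<beta>_def algebra_simps)
        then show ?thesis using e[of "N * (- 1 - ?n)"] N by simp
      next
        case 2
        then have "\<Phi> (s, i) = (False, 1 + N * (- ?n))" "\<Phi> (s, i + 1) = (False, 2 + N * (- 1 - ?n))"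
          using False N mod_div_succ[of N i] by (simp_all add: \<Phi>_def \<beta>_def)
        then show ?thesis using e[of "2 + N * (- 1 - ?n)"] N by (simp add: algebra_simps)
      next
        case 3
        then have "\<beta> (i mod N + 1) = \<beta> (i mod N)" by (auto simp: \<beta>_def)
        then show ?thesis using 3 False N mod_div_succ[of N i] by (simp add: \<Phi>_def rigid_step[OF H])
      qed
    qed
    show "\<bar>snd (\<Phi> (s, i)) - (- 1) * i\<bar> \<le> 3 * N" for s i
    proof -
      have "N * (\<beta> (i mod N) - i div N) + i - i mod N \<in> {0, - N}"
        using idiv[of i] by (auto simp: \<beta>_def algebra_simps)
      then show ?thesis using r[of i] N by (cases s; simp add: \<Phi>_def; smt (verit))
    qed
  qed simp
  from rigid_not_two_rays(2)[OF H this, of False 1] show False using N by (auto simp: \<Phi>_def \<beta>_def)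
qed

text \<open>Cut both rays before every position congruent to \<open>0\<close>, \<open>2\<close>, \<open>4\<close> or \<open>6\<close> modulo \<open>N\<close>; the
  chords join the pieces to two rays that use the four kinds of blocks cyclically, with the
  sides alternating. For \<open>N = 4\<close> and \<open>N = 6\<close> there is no room for this and other rays are used.\<close>

lemma rigid_no_twisted_chords_large:
  assumes H: "rigid H" and N: "N \<ge> 8" "even N"
    and e: "\<And>i. even i \<Longrightarrow> H (False, i) (True, i - 1)" "\<And>i. even i \<Longrightarrow> H (True, i) (False, i + N - 1)"
  shows False
proof -
  \<comment> \<open>The four kinds of pieces have residues 0-1, 2-3, 4-5 and 6 up to
    \<open>N - 1\<close>; \<open>z\<close> marks the second and the fourth, where the ray is on the
    opposite side.\<close>
  define z where "z = (\<lambda>r::int. \<not> (r < 2 \<or> 4 \<le> r \<and> r < 6))"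
  \<comment> \<open>Going from side \<open>False\<close> to side \<open>True\<close> uses a chord of
    span \<open>N - 1\<close>, which drops one block; going back uses a rung to the next position.
    One cycle has two drops and one carry from residue \<open>N - 1\<close> to 0, so it descends by
    one block.\<close>
  define \<beta> :: "bool \<Rightarrow> int \<Rightarrow> int" where
    "\<beta> = (\<lambda>s r. if s then (if r < 4 then 0 else -1) else (if r < 2 then 0 else if r < 6 then -1 else -2))"
  define \<Phi> where "\<Phi> = (\<lambda>(s, i). (s \<noteq> z (i mod N), i mod N + N * (\<beta> s (i mod N) - i div N)))"
  define \<Psi> where "\<Psi> = (\<lambda>(s, j). (s \<noteq> z (j mod N), j mod N + N * (\<beta> (s \<noteq> z (j mod N)) (j mod N) - j div N)))"
  have r: "0 \<le> i mod N" "i mod N < N" for i using N by simp_all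
  have idiv: "i mod N + N * (i div N) = i" for i by simp
  have inv: "\<Psi> (\<Phi> v) = v" "\<Phi> (\<Psi> v) = v" for v
  proof -
    obtain s i where v: "v = (s, i)" by (cases v)
    show "\<Psi> (\<Phi> v) = v" "\<Phi> (\<Psi> v) = v"
      using mod_div_shift[OF r] idiv
      by (cases s; cases "z (i mod N)"; simp add: \<Phi>_def \<Psi>_def v)+
  qed
  have "two_rays H \<Phi>"
  proof (rule two_raysI[where \<Psi> = \<Psi>, OF inv])
    show "H (\<Phi> (s, i)) (\<Phi> (s, i + 1))" for s i
    proof -
      have down: "H (True, j - 1) (False, j)" "H (False, j + N - 1) (True, j)" if "even j" for j
        using e[OF that] rigidD(1)[OF H] by blast+
      define n r where "n = i div N" and "r = i mod N"
      define c where "c = (if r = N - 1 then 0 else r + 1)"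
      define b where "b = \<beta> s c - (if r = N - 1 then n + 1 else n)"
      have nxt: "\<Phi> (s, i + 1) = (s \<noteq> z c, c + N * b)"
        using N mod_div_succ[of N i] by (simp add: \<Phi>_def c_def b_def n_def r_def)
      have cur: "\<Phi> (s, i) = (s \<noteq> z r, r + N * (\<beta> s r - n))"
        by (simp add: \<Phi>_def n_def r_def)
      consider "r = N - 1 \<or> r = 1 \<or> r = 3 \<or> r = 5" | "r \<noteq> N - 1" "r \<noteq> 1" "r \<noteq> 3" "r \<noteq> 5" by blast
      then show ?thesis
      proof cases
        case 1
        then have c: "even (c + N * b)" using N by (auto simp: c_def)
        have "\<Phi> (s, i) = (if s \<noteq> z c then (False, c + N * b + N - 1) else (True, c + N * b - 1))"
          using 1 N unfolding c_def b_def cur by (auto simp: z_def \<beta>_def algebra_simps)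
        then show ?thesis unfolding nxt using down[OF c] by auto
      next
        case 2
        have "\<beta> s c = \<beta> s r" "z c = z r" using 2 by (auto simp: \<beta>_def z_def c_def)
        then show ?thesis unfolding nxt using 2 by (simp add: b_def c_def cur rigid_step[OF H])
      qed
    qed
    show "\<bar>snd (\<Phi> (s, i)) - (- 1) * i\<bar> \<le> 5 * N" for s i
    proof -
      have "N * (\<beta> s (i mod N) - i div N) + i - i mod N \<in> {0, - N, - 2 * N}"
        using idiv[of i] by (auto simp: \<beta>_def algebra_simps)
      then show ?thesis using r[of i] N by (cases s; simp add: \<Phi>_def; smt (verit))
    qed
  qed simp
  from rigid_not_two_rays(1)[OF H this, of False 1] show False using N by (auto simp: \<Phi>_def z_def)
qed

text \<open>A scheme of period four: down one edge on side \<open>False\<close>, by a rung to the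
  preceding position on side \<open>True\<close>, up one edge there, and back to
  \<open>False\<close> by a chord of span five. The second ray is the translate of the first by
  two.\<close>

lemma rigid_no_twisted_chords_6:
  assumes H: "rigid H"
    and e: "\<And>i. even i \<Longrightarrow> H (False, i) (True, i - 1)" "\<And>i. even i \<Longrightarrow> H (True, i) (False, i + 5)"
  shows False
proof -
  define z where "z = (\<lambda>i::int. i mod 4 \<ge> 2)"
  define \<delta> :: "int \<Rightarrow> int" where "\<delta> = (\<lambda>i. if i mod 4 = 0 then 1 else if i mod 4 = 1 then - 1 else if i mod 4 = 2 then - 3 else - 3)"
  define \<Phi> where "\<Phi> = (\<lambda>(s, i). (z i, i + (if s then 2 else 0) + \<delta> i))"
  \<comment> \<open>Each vertex has one candidate index on the ray \<open>False\<close>. If the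
    residue of this index belongs to the wrong side, the vertex lies on the translated ray, where
    its index is smaller by two.\<close>
  define \<Psi> where "\<Psi> = (\<lambda>(s, j). let i = (if s then j + 3 else if even j then j + 1 else j - 1)
     in (z i \<noteq> s, if z i \<noteq> s then i - 2 else i))"
  have m4: "i mod 4 = 0 \<or> i mod 4 = 1 \<or> i mod 4 = 2 \<or> i mod 4 = 3" for i :: int by presburger
  have "two_rays H \<Phi>"
  proof (rule two_raysI[where \<Psi> = \<Psi>])
    have \<Phi>r: "\<Phi> (s, 4 * n) = (False, 4 * n + 1 + (if s then 2 else 0))"
      "\<Phi> (s, 4 * n + 1) = (False, 4 * n + (if s then 2 else 0))"
      "\<Phi> (s, 4 * n + 2) = (True, 4 * n - 1 + (if s then 2 else 0))"
      "\<Phi> (s, 4 * n + 3) = (True, 4 * n + (if s then 2 else 0))" for s n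
      by (simp_all add: \<Phi>_def z_def \<delta>_def)
    have \<Phi>s: "\<Phi> (True, 4 * n) = (False, 4 * n + 3)" "\<Phi> (False, 4 * n) = (False, 4 * n + 1)"
      "\<Phi> (True, 4 * n + 1) = (False, 4 * n + 2)" "\<Phi> (False, 4 * n + 1) = (False, 4 * n)"
      "\<Phi> (True, 4 * n + 2) = (True, 4 * n + 1)" "\<Phi> (False, 4 * n + 2) = (True, 4 * n - 1)"
      "\<Phi> (True, 4 * n + 3) = (True, 4 * n + 2)" "\<Phi> (False, 4 * n + 3) = (True, 4 * n)" for n
      using \<Phi>r[of True n] \<Phi>r[of False n] by simp_all
    have \<Psi>r: "\<Psi> (False, 4 * n + 1) = (False, 4 * n)" "\<Psi> (False, 4 * n + 3) = (True, 4 * n)"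
      "\<Psi> (False, 4 * n) = (False, 4 * n + 1)" "\<Psi> (False, 4 * n + 2) = (True, 4 * n + 1)"
      "\<Psi> (True, 4 * n - 1) = (False, 4 * n + 2)" "\<Psi> (True, 4 * n + 1) = (True, 4 * n + 2)"
      "\<Psi> (True, 4 * n) = (False, 4 * n + 3)" "\<Psi> (True, 4 * n + 2) = (True, 4 * n + 3)" for n
      by (simp_all add: \<Psi>_def z_def Let_def)
    show "\<Psi> (\<Phi> v) = v" for v
    proof (cases v)
      case (Pair s i)
      obtain n where "i = 4 * n \<or> i = 4 * n + 1 \<or> i = 4 * n + 2 \<or> i = 4 * n + 3"
        by (metis m4 div_mult_mod_eq add.right_neutral mult.commute)
      then show ?thesis
        unfolding Pair by (cases s; elim disjE; hypsubst; simp only: \<Phi>s \<Psi>r)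
    qed
    show "\<Phi> (\<Psi> v) = v" for v
    proof (cases v)
      case (Pair s i)
      have "\<exists>n. i = 4 * n - 1 \<or> i = 4 * n \<or> i = 4 * n + 1 \<or> i = 4 * n + 2"
        "\<exists>n. i = 4 * n \<or> i = 4 * n + 1 \<or> i = 4 * n + 2 \<or> i = 4 * n + 3" by presburger+
      then show ?thesis
        unfolding Pair
        by (cases s) (simp only: simp_thms, elim exE disjE; hypsubst; simp only: \<Phi>s \<Psi>r)+
    qed
    show "H (\<Phi> (s, i)) (\<Phi> (s, i + 1))" for s i
    proof -
      define c :: int where "c = (if s then 2 else 0)"
      have c: "even c" by (simp add: c_def)
      have \<Phi>: "\<Phi> (s, i) = (z i, i + c + \<delta> i)" for i by (simp add: \<Phi>_def c_def)
      have "i mod 4 = 0 \<and> (i + 1) mod 4 = 1 \<or> i mod 4 = 1 \<and> (i + 1) mod 4 = 2 \<or>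
          i mod 4 = 2 \<and> (i + 1) mod 4 = 3 \<or> i mod 4 = 3 \<and> (i + 1) mod 4 = 0" by presburger
      then consider "i mod 4 = 0" "(i + 1) mod 4 = 1" | "i mod 4 = 1" "(i + 1) mod 4 = 2"
        | "i mod 4 = 2" "(i + 1) mod 4 = 3" | "i mod 4 = 3" "(i + 1) mod 4 = 0" by blast
      then show ?thesis
      proof cases
        case 2
        then have "even (i - 1 + c)" using c by presburger
        then show ?thesis unfolding \<Phi> using 2 e(1)[of "i - 1 + c"] by (simp add: z_def \<delta>_def algebra_simps)
      next
        case 4
        then have "even (i - 3 + c)" using c by presburger
        then show ?thesis unfolding \<Phi> using 4 e(2)[of "i - 3 + c"] by (simp add: z_def \<delta>_def algebra_simps)
      qed (simp_all add: \<Phi> z_def \<delta>_def rigid_step[OF H])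
    qed
    show "\<bar>snd (\<Phi> (s, i)) - 1 * i\<bar> \<le> 10" for s i by (auto simp: \<Phi>_def \<delta>_def)
  qed simp
  from rigid_not_two_rays(1)[OF H this, of False 1] show False by (auto simp: \<Phi>_def z_def)
qed

section \<open>Affine automorphisms of two labelled rays\<close>

lemma shift_int_mult:
  fixes P :: "int \<Rightarrow> int \<Rightarrow> bool"
  assumes "\<And>i j. P (i + a) (j + b) = P i j"
  shows "P (i + a * k) (j + b * k) = P i j"
proof (induction k rule: int_induct[where k = 0])
  case (step1 k)
  then show ?case using assms[of "i + a * k" "j + b * k"] by (simp add: algebra_simps)
next
  case (step2 k)
  then show ?case using assms[of "i + a * (k - 1)" "j + b * (k - 1)"] by (simp add: algebra_simps)
qed simp

lemma rigid_affine:
  assumes "rigid H" "\<epsilon> \<in> {1, -1}"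
  shows "rigid (\<lambda>u v. H (fst u, \<epsilon> * snd u + c (fst u)) (fst v, \<epsilon> * snd v + c (fst v)))"
proof (rule rigid_relabel[where \<psi> = "\<lambda>v. (fst v, \<epsilon> * snd v + c (fst v))", OF assms(1) _ _ assms(2)])
  show "bij (\<lambda>v. (fst v, \<epsilon> * snd v + c (fst v)))"
    by (rule o_bij[where g = "\<lambda>v. (fst v, \<epsilon> * (snd v - c (fst v)))"])
      (use assms(2) in \<open>auto simp: algebra_simps\<close>)
  show "\<bar>snd (fst (s, i), \<epsilon> * snd (s, i) + c (fst (s, i))) - \<epsilon> * i\<bar> \<le> \<bar>c True\<bar> + \<bar>c False\<bar>" for s i
    by (cases s) simp_all
qed (use assms(2) in \<open>auto simp: standard_edge_def\<close>)

lemma rigid_shift_True: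
  assumes "rigid H"
  shows "rigid (\<lambda>u v. H (fst u, snd u + (if fst u then c else 0)) (fst v, snd v + (if fst v then c else 0)))"
  using rigid_affine[OF assms, of 1 "\<lambda>s. if s then c else 0"] by simp

text \<open>Shifting the labels of the ray \<open>True\<close> by \<open>d\<close> normalises the
  smaller offset to 0.\<close>

lemma rigid_offsets_close:
  assumes H: "rigid H" and "\<And>i. H (False, i) (True, i + d)" "\<And>i. H (False, i) (True, i + d')"
  shows "d' < d + 2"
proof (rule ccontr)
  assume "\<not> d' < d + 2"
  moreover have "i + (d' - d) + d = i + d'" for i by simp
  ultimately show False
    using rigid_no_distant_offsets[OF rigid_shift_True[OF H, of d], of "d' - d"] assms(2,3)
    by (simp del: add_diff_eq diff_add_eq)
qed

text \<open>The rung recurs at all even positions of \<open>False\<close>, and its images under the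
  exchange start at the positions of \<open>True\<close> with the parity of \<open>p\<close>. As
  \<open>d\<close> has the other parity, shifting \<open>True\<close> by \<open>d + 1\<close> makes
  both families start at even positions, and they become twisted chords with
  \<open>N = 2 * d + 2\<close>.\<close>

lemma rigid_no_alternating_offset_pos:
  assumes H: "rigid H" and sh2: "\<And>s i s' j. H (s, i + 2) (s', j + 2) = H (s, i) (s', j)"
    and swap: "\<And>s i s' j. H (\<not> s, i + p) (\<not> s', j + p) = H (s, i) (s', j)"
    and d: "d > 0" "even d \<noteq> even p"
  shows "\<not> H (False, 0) (True, d)"
proof
  assume e: "H (False, 0) (True, d)"
  have sh: "H (s, i + 2 * k) (s', j + 2 * k) = H (s, i) (s', j)" for s i s' j k
    using shift_int_mult[of "\<lambda>i j. H (s, i) (s', j)" 2 2 i k j, OF sh2] by simp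
  have e1: "H (False, i) (True, i + d)" if "even i" for i
    using that e sh[of False 0 "i div 2" True d] by (simp add: add.commute)
  have e2: "H (True, i) (False, i + d)" if "even i = even p" for i
    using e1[of "i - p"] swap[of False "i - p" True "i - p + d"] that by simp
  define H' where "H' = (\<lambda>u v. H (fst u, snd u + (if fst u then d + 1 else 0)) (fst v, snd v + (if fst v then d + 1 else 0)))"
  have R: "rigid H'" unfolding H'_def by (rule rigid_shift_True[OF H])
  have f1: "H' (False, i) (True, i - 1)" if "even i" for i
    using e1[OF that] by (simp add: H'_def)
  have f2: "H' (True, i) (False, i + (2 * d + 2) - 1)" if "even i" for i
    using e2[of "i + (d + 1)"] that d by (simp add: H'_def algebra_simps)
  \<comment> \<open>The first two values are \<open>N = 4\<close> and \<open>N = 6\<close>; for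
    \<open>N = 4\<close> two of the chords already cross.\<close>
  consider "d = 1" | "d = 2" | "d \<ge> 3" using d by linarith
  then show False
  proof cases
    case 1
    then show False
      using rigid_no_crossing[OF R, of 0 "-2"] f1[of 0] rigidD(1)[OF R f2[of "-2"]] by simp
  next
    case 2
    then show False using rigid_no_twisted_chords_6[OF R f1] f2 by (simp add: add.commute)
  next
    case 3
    then show False using rigid_no_twisted_chords_large[OF R _ _ f1 f2] by simp
  qed
qed

text \<open>The symmetries are the translation by two, the reflection at one half and an exchange of
  the rays. A chord of even length is parallel to a translate of its mirror image, one of odd length
  recurs at every second position; both are excluded. Rungs are reduced to offset 0 according to the
  parities of \<open>d\<close> and \<open>p\<close>.\<close>

lemma rigid_dihedral_ladder:
  assumes H: "rigid H" and irr: "\<And>v. \<not> H v v"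
    and cross: "H (False, a) (True, b)"
    and sh2: "\<And>s i s' j. H (s, i + 2) (s', j + 2) = H (s, i) (s', j)"
    and refl: "\<And>s i s' j. H (s, 1 - i) (s', 1 - j) = H (s, i) (s', j)"
    and swap: "\<And>s i s' j. H (\<not> s, i + p) (\<not> s', j + p) = H (s, i) (s', j)"
  shows "H (False, i) (True, j) \<longleftrightarrow> j = i" "H (s, i) (s, j) \<longleftrightarrow> \<bar>i - j\<bar> = 1"
proof -
  have sh: "H (s, i + 2 * k) (s', j + 2 * k) = H (s, i) (s', j)" for s i s' j k
    using shift_int_mult[of "\<lambda>i j. H (s, i) (s', j)" 2 2 i k j, OF sh2] by simp
  have sym: "H u v \<longleftrightarrow> H v u" for u v using rigidD(1)[OF H] by blast
  have no_chord: "\<not> H (False, i) (False, i + k)" if "k \<ge> 2" for i k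
  proof
    assume c: "H (False, i) (False, i + k)"
    show False
    proof (cases "even k")
      case True
      have "H (False, 1 - i) (False, 1 - (i + k))" using c refl by blast
      from iffD1[OF sym this] have "H (False, 1 - i - k + 2 * (i + k div 2)) (False, 1 - i + 2 * (i + k div 2))"
        unfolding sh by (simp add: algebra_simps)
      then have "H (False, i + 1) (False, i + k + 1)" using True by (simp add: algebra_simps)
      with rigid_no_parallel_chords[OF H that c] show False by simp
    next
      case False
      define H' where "H' = (\<lambda>u v. H (fst u, 1 * snd u + i) (fst v, 1 * snd v + i))"
      have R: "rigid H'" unfolding H'_def using rigid_affine[OF H, of 1 "\<lambda>_. i"] by simp
      have "H' (False, l) (False, l + k)" if "even l" for l
        using sh[of False i "l div 2" False "i + k"] c that by (simp add: H'_def algebra_simps)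
      then show False using rigid_no_odd_chords[OF R _ False] that False by (cases "k = 2") auto
    qed
  qed
  have chord: "\<bar>i - j\<bar> = 1" if "H (False, i) (False, j)" for i j
  proof -
    consider "i = j" | "\<bar>i - j\<bar> = 1" | "j \<ge> i + 2" | "i \<ge> j + 2" by linarith
    then show ?thesis
    proof cases
      case 3 then show ?thesis using no_chord[of "j - i" i] that by simp
    next
      case 4 then show ?thesis using no_chord[of "i - j" j] that sym by simp
    qed (use irr that in auto)
  qed
  show "H (s, i) (s, j) \<longleftrightarrow> \<bar>i - j\<bar> = 1"
  proof
    assume "H (s, i) (s, j)"
    then show "\<bar>i - j\<bar> = 1"
      using chord[of i j] swap[of s i s j] chord[of "i + p" "j + p"] by (cases s) auto
  qed (rule rigid_step[OF H])
  have zero: "d = 0" if "H (False, 0) (True, d)" for d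
  proof (cases "even d = even p")
    case True
    have 0: "H (False, i) (True, i + d)" if "even i" for i
      using that \<open>H (False, 0) (True, d)\<close> sh[of False 0 "i div 2" True d] by (simp add: add.commute)
    have 1: "H (False, i) (True, i - d)" if "odd i" for i
      using refl[of False i True "i - d"] 0[of "1 - i"] that by (simp add: algebra_simps)
    have 2: "H (False, i) (True, i - d)" if "even i" for i
      using 0[of "i - d - p"] swap[of False "i - d - p" True "i - p"] sym[of "(True, i - d)" "(False, i)"] that True by simp
    have 3: "H (False, i) (True, i + d)" if "odd i" for i
      using 1[of "i + d - p"] swap[of False "i + d - p" True "i - p"] sym[of "(True, i + d)" "(False, i)"] that True by simp
    \<comment> \<open>Reflection and exchange together provide both offsets \<open>d\<close> and
      \<open>- d\<close> at every position, and these can differ by at most one.\<close>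
    show ?thesis
    proof -
      have pm: "H (False, i) (True, i + d)" "H (False, i) (True, i + - d)" for i
        using 0[of i] 1[of i] 2[of i] 3[of i] by (cases "even i"; simp)+
      have "d < - d + 2" "- d < d + 2"
        using rigid_offsets_close[OF H pm(2) pm(1)] rigid_offsets_close[OF H pm(1) pm(2)] by simp_all
      then show ?thesis by simp
    qed
  next
    case False
    \<comment> \<open>Negating all positions turns a negative offset into a positive one and
      replaces \<open>p\<close> by \<open>- p\<close>, which keeps its parity.\<close>
    define H' where "H' = (\<lambda>u v. H (fst u, (- 1) * snd u + 0) (fst v, (- 1) * snd v + 0))"
    have R: "rigid H'" unfolding H'_def using rigid_affine[OF H, of "-1" "\<lambda>_. 0"] by simp
    have sh2': "H' (s, i + 2) (s', j + 2) = H' (s, i) (s', j)" for s i s' j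
      using sh2[of s "- i - 2" s' "- j - 2"] by (simp add: H'_def)
    have swap': "H' (\<not> s, i + (- p)) (\<not> s', j + (- p)) = H' (s, i) (s', j)" for s i s' j
      using swap[of s "- i" s' "- j"] by (simp add: H'_def)
    have "\<not> d > 0" using rigid_no_alternating_offset_pos[OF H sh2 swap _ False] that by blast
    moreover have "\<not> - d > 0"
    proof
      assume "- d > 0"
      from rigid_no_alternating_offset_pos[OF R sh2' swap' this] show False
        using that False by (simp add: H'_def)
    qed
    ultimately show ?thesis by simp
  qed
  have even: "H (False, i) (True, j) \<longleftrightarrow> H (False, 0) (True, j - i)" if "even i" for i j
    using sh[of False 0 "i div 2" True "j - i"] that by simp
  \<comment> \<open>The reflection changes the parity of the position and the sign of the
    offset.\<close>
  have odd: "H (False, i) (True, j) \<longleftrightarrow> H (False, 0) (True, i - j)" if "odd i" for i j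
    using refl[of False i True j] even[of "1 - i" "1 - j"] that by simp
  have "H (False, 0) (True, 0)"
  proof (cases "even a")
    case True
    then have "H (False, 0) (True, b - a)" using cross even by blast
    then show ?thesis using zero by fastforce
  next
    case False
    then have "H (False, 0) (True, a - b)" using cross odd by blast
    then show ?thesis using zero by fastforce
  qed
  then show "H (False, i) (True, j) \<longleftrightarrow> j = i"
    using even[of i j] odd[of i j] zero[of "j - i"] zero[of "i - j"] by (cases "even i") auto
qed

text \<open>\<open>z\<close> tells whether the rays are exchanged. The signs and displacements on
  the two rays are independent parameters, because their agreement has to be derived from
  finiteness.\<close>

definition affine_automorphism ::
    "(bool \<times> int \<Rightarrow> bool \<times> int \<Rightarrow> bool) \<Rightarrow> bool \<Rightarrow> int \<Rightarrow> int \<Rightarrow> int \<Rightarrow> int \<Rightarrow> bool" where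
  "affine_automorphism H z \<epsilon> a \<delta> b \<longleftrightarrow> \<epsilon> \<in> {1, -1} \<and> \<delta> \<in> {1, -1} \<and>
     (\<exists>\<alpha>. (\<forall>u v. H (\<alpha> u) (\<alpha> v) = H u v) \<and>
       (\<forall>i. \<alpha> (False, i) = (z, \<epsilon> * i + a)) \<and> (\<forall>i. \<alpha> (True, i) = (\<not> z, \<delta> * i + b)))"

lemma affine_automorphism_comp:
  assumes "affine_automorphism H z \<epsilon> a \<delta> b" "affine_automorphism H z' \<epsilon>' a' \<delta>' b'"
  shows "affine_automorphism H (z \<noteq> z')
    (if z' then \<delta> * \<epsilon>' else \<epsilon> * \<epsilon>') (if z' then \<delta> * a' + b else \<epsilon> * a' + a)
    (if z' then \<epsilon> * \<delta>' else \<delta> * \<delta>') (if z' then \<epsilon> * b' + a else \<delta> * b' + b)"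
proof -
  obtain \<alpha> where \<alpha>: "\<And>u v. H (\<alpha> u) (\<alpha> v) = H u v" "\<And>i. \<alpha> (False, i) = (z, \<epsilon> * i + a)"
    "\<And>i. \<alpha> (True, i) = (\<not> z, \<delta> * i + b)"
    using assms(1) unfolding affine_automorphism_def by blast
  obtain \<beta> where \<beta>: "\<And>u v. H (\<beta> u) (\<beta> v) = H u v" "\<And>i. \<beta> (False, i) = (z', \<epsilon>' * i + a')"
    "\<And>i. \<beta> (True, i) = (\<not> z', \<delta>' * i + b')"
    using assms(2) unfolding affine_automorphism_def by blast
  have "\<forall>u v. H ((\<alpha> \<circ> \<beta>) u) ((\<alpha> \<circ> \<beta>) v) = H u v" using \<alpha>(1) \<beta>(1) by simp
  moreover have "\<epsilon> \<in> {1, -1}" "\<delta> \<in> {1, -1}" "\<epsilon>' \<in> {1, -1}" "\<delta>' \<in> {1, -1}"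
    using assms unfolding affine_automorphism_def by blast+
  ultimately show ?thesis
    unfolding affine_automorphism_def
    by (intro conjI exI[of _ "\<alpha> \<circ> \<beta>"]) (auto simp: \<alpha>(2,3) \<beta>(2,3) algebra_simps)
qed

lemma affine_automorphismD:
  assumes "affine_automorphism H z \<epsilon> a \<delta> b"
  shows "H (z, \<epsilon> * i + a) (z, \<epsilon> * j + a) = H (False, i) (False, j)"
    "H (z, \<epsilon> * i + a) (\<not> z, \<delta> * j + b) = H (False, i) (True, j)"
    "H (\<not> z, \<delta> * i + b) (\<not> z, \<delta> * j + b) = H (True, i) (True, j)"
    "H (\<not> z, \<delta> * i + b) (z, \<epsilon> * j + a) = H (True, i) (False, j)"
    "\<epsilon> \<in> {1, -1}" "\<delta> \<in> {1, -1}"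
  using assms unfolding affine_automorphism_def by (metis+)

lemma infinite_progression:
  fixes a m :: int
  assumes "m \<noteq> 0"
  shows "infinite ((\<lambda>k::int. (s::bool, a + m * k)) ` UNIV)"
  using assms by (auto simp: inj_def infinite_UNIV_int dest!: finite_imageD)

text \<open>What remains of the graph after labelling. \<open>boundary\<close> is the trace of
  two-endedness: only finitely many edges pass from the lower halves of the rays to the upper ones.
  \<open>transitive\<close> prescribes the image of the origin of \<open>False\<close> only.\<close>

locale two_line_graph =
  fixes H :: "bool \<times> int \<Rightarrow> bool \<times> int \<Rightarrow> bool" and a b :: int
  assumes rig: "rigid H" and irr: "\<not> H v v"
    and loc_fin: "finite {v. H u v}"
    and boundary: "finite {(u, v). H u v \<and> snd u \<le> 0 \<and> 0 < snd v}"
    and cross: "H (False, a) (True, b)"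
    and transitive: "\<exists>\<epsilon> \<delta> b. affine_automorphism H z \<epsilon> i \<delta> b"
begin

lemma sym: "H u v \<longleftrightarrow> H v u"
  using rigidD(1)[OF rig] by blast

lemma no_progression:
  assumes "\<And>k::int. H u (s, c + m * k)" shows "m = 0"
proof (rule ccontr)
  assume "m \<noteq> 0"
  moreover have "(\<lambda>k. (s, c + m * k)) ` UNIV \<subseteq> {v. H u v}" using assms by blast
  ultimately show False using infinite_progression finite_subset loc_fin by metis
qed

text \<open>Take automorphisms sending the origin of \<open>False\<close> to 1 and to 2. If the
  first is a translation, its square is used; if the second is one, it is used itself; if both are
  reflections, their composite is the translation by one. The effect on \<open>True\<close> is then
  pinned down by finiteness.\<close>

lemma translation_2: "affine_automorphism H False 1 2 1 2"
proof -
  obtain \<epsilon> m where t: "affine_automorphism H False 1 2 \<epsilon> m"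
  proof -
    obtain \<epsilon> \<delta> m where 1: "affine_automorphism H False \<epsilon> 1 \<delta> m" using transitive by blast
    obtain \<epsilon>' \<delta>' m' where 2: "affine_automorphism H False \<epsilon>' 2 \<delta>' m'" using transitive by blast
    consider "\<epsilon> = 1" | "\<epsilon>' = 1" | "\<epsilon> = -1" "\<epsilon>' = -1"
      using affine_automorphismD(5)[OF 1] affine_automorphismD(5)[OF 2] by auto
    then show thesis
    proof cases
      case 1
      then show thesis using that affine_automorphism_comp[OF \<open>affine_automorphism H False \<epsilon> 1 \<delta> m\<close> \<open>affine_automorphism H False \<epsilon> 1 \<delta> m\<close>]
        by simp
    next
      case 2
      then show thesis using that \<open>affine_automorphism H False \<epsilon>' 2 \<delta>' m'\<close> by blast
    next
      case 3
      from affine_automorphism_comp[OF 2 1] obtain \<mu> n where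
        t: "affine_automorphism H False 1 1 \<mu> n" using 3 by auto
      from affine_automorphism_comp[OF t t] show thesis using that by simp
    qed
  qed
  \<comment> \<open>If \<open>True\<close> were reflected, the square would fix \<open>True\<close>
    pointwise and move \<open>False\<close> by four, so a vertex of \<open>True\<close> would have
    infinitely many neighbours.\<close>
  have "\<epsilon> = 1"
  proof (rule ccontr)
    assume "\<epsilon> \<noteq> 1"
    then have "affine_automorphism H False 1 4 1 0"
      using affine_automorphism_comp[OF t t] affine_automorphismD(6)[OF t] by auto
    from affine_automorphismD(2)[OF this]
    have "H (False, i + 4) (True, j + 0) = H (False, i) (True, j)" for i j by simp
    from shift_int_mult[of "\<lambda>i j. H (False, i) (True, j)", OF this]
    have sh4: "H (False, i + 4 * k) (True, j + 0 * k) = H (False, i) (True, j)" for i j k .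
    have "H (False, a + 4 * k) (True, b)" for k using cross sh4[of a k b] by simp
    from no_progression[OF rigidD(1)[OF rig this]] show False by simp
  qed
  from affine_automorphismD(2)[OF t] this
  have "H (False, i + 2) (True, j + m) = H (False, i) (True, j)" for i j by simp
  note sh = shift_int_mult[of "\<lambda>i j. H (False, i) (True, j)", OF this]
  \<comment> \<open>An automorphism exchanging the rays turns the displacements 2 and
    \<open>m\<close> into \<open>m\<close> and 2 up to sign. Rungs respect both ratios only if
    \<open>m * m = 4\<close>.\<close>
  obtain \<mu> \<delta> c where s: "affine_automorphism H True \<mu> 0 \<delta> c" using transitive by blast
  have 1: "H (False, \<delta> * (b + m * k) + c + 2 * l) (True, \<mu> * (a + 2 * k) + m * l)" for k l
  proof -
    have "H (False, a + 2 * k) (True, b + m * k)" using sh[of a k b] cross by blast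
    with affine_automorphismD(2)[OF s, of "a + 2 * k" "b + m * k"]
    have "H (True, \<mu> * (a + 2 * k)) (False, \<delta> * (b + m * k) + c)" by simp
    from rigidD(1)[OF rig this] show ?thesis
      using sh[of "\<delta> * (b + m * k) + c" l "\<mu> * (a + 2 * k)"] by blast
  qed
  \<comment> \<open>The multiples \<open>k\<close> and \<open>l\<close> are chosen so that the
    position on \<open>False\<close> stays fixed; the positions on \<open>True\<close> then form a
    progression inside one neighbourhood.\<close>
  have "H (False, \<delta> * b + c) (True, \<mu> * a + (4 * \<mu> - \<delta> * m * m) * j)" for j
    using 1[of "2 * j" "- \<delta> * m * j"] by (simp add: algebra_simps)
  from no_progression[OF this] have "4 * \<mu> = \<delta> * (m * m)" by simp
  moreover have "\<mu> \<in> {1, -1}" "\<delta> \<in> {1, -1}" using affine_automorphismD(5,6)[OF s] by blast+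
  moreover define q where "q = m * m"
  moreover have "q \<ge> 0" by (simp add: q_def)
  ultimately have "m * m = 2 * 2" unfolding q_def[symmetric] by auto
  then have "m = 2 \<or> m = -2" using square_eq_iff by blast
  \<comment> \<open>If the rays moved in opposite directions, the translates of a single rung would
    include infinitely many edges across the boundary.\<close>
  moreover have "m \<noteq> -2"
  proof
    assume m: "m = -2"
    define f where "f = (\<lambda>k. ((True, b - 2 * (int k + \<bar>a\<bar> + \<bar>b\<bar> + 1)), (False, a + 2 * (int k + \<bar>a\<bar> + \<bar>b\<bar> + 1))))"
    have "inj f" by (auto simp: f_def inj_def)
    moreover have "range f \<subseteq> {(u, v). H u v \<and> snd u \<le> 0 \<and> 0 < snd v}"
    proof -
      have "H (True, b - 2 * k) (False, a + 2 * k)" for k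
        using rigidD(1)[OF rig, of "(False, a + 2 * k)" "(True, b - 2 * k)"] sh[of a k b] cross m by simp
      from this[of "int k + \<bar>a\<bar> + \<bar>b\<bar> + 1" for k] show ?thesis by (auto simp: f_def)
    qed
    ultimately have "finite (range f)" using boundary finite_subset by blast
    with \<open>inj f\<close> show False using finite_imageD infinite_UNIV_nat by blast
  qed
  ultimately show ?thesis using t \<open>\<epsilon> = 1\<close> by simp
qed

lemma shift_2: "H (s, i + 2 * k) (s', j + 2 * k) = H (s, i) (s', j)"
proof -
  have "H (s, i + 2) (s', j + 2) = H (s, i) (s', j)" for i j
    using affine_automorphismD(1-4)[OF translation_2] by (cases s; cases s') simp_all
  from shift_int_mult[of "\<lambda>i j. H (s, i) (s', j)", OF this] show ?thesis by simp
qed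

definition offsets :: "int set" where
  "offsets = {d. \<exists>i. H (False, i) (True, i + d)}"

text \<open>By the translation by two, every offset already occurs at position 0 or 1 of
  \<open>False\<close>, where the degree is finite.\<close>

lemma finite_offsets: "finite offsets"
proof -
  have "offsets \<subseteq> (\<lambda>v. snd v) ` {v. H (False, 0) v} \<union> (\<lambda>v. snd v - 1) ` {v. H (False, 1) v}"
  proof
    fix d assume "d \<in> offsets"
    then obtain i where "H (False, i) (True, i + d)" by (auto simp: offsets_def)
    with shift_2[of False i "- (i div 2)" True "i + d"]
    have "H (False, i mod 2) (True, i mod 2 + d)" by (simp add: minus_div_mult_eq_mod [symmetric] algebra_simps)
    moreover have "i mod 2 = 0 \<or> i mod 2 = 1" by presburger
    ultimately have "H (False, 0) (True, d) \<or> H (False, 1) (True, d + 1)" by (auto simp: add.commute)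
    then show "d \<in> (\<lambda>v. snd v) ` {v. H (False, 0) v} \<union> (\<lambda>v. snd v - 1) ` {v. H (False, 1) v}"
      by (force simp: image_iff)
  qed
  then show ?thesis using loc_fin by (meson finite_UnI finite_imageI finite_subset)
qed

lemma offset_cross: "b - a \<in> offsets"
  using cross unfolding offsets_def by (intro CollectI exI[of _ a]) simp

lemma offset_bound: obtains B where "\<And>i j. H (False, i) (True, j) \<Longrightarrow> \<bar>j - i\<bar> \<le> B"
proof -
  have "\<bar>j - i\<bar> \<le> Max (abs ` offsets)" if "H (False, i) (True, j)" for i j
  proof -
    have "j - i \<in> offsets" using that unfolding offsets_def by (intro CollectI exI[of _ i]) simp
    then show ?thesis using finite_offsets by simp
  qed
  then show thesis by (rule that)
qed

text \<open>With opposite directions the two ends of the image of a far-out rung would be further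
  apart than any offset allows.\<close>

lemma same_direction:
  assumes "affine_automorphism H z \<epsilon> c \<delta> d"
  shows "\<epsilon> = \<delta>"
proof (rule ccontr)
  assume ne: "\<epsilon> \<noteq> \<delta>"
  obtain B where B: "\<And>i j. H (False, i) (True, j) \<Longrightarrow> \<bar>j - i\<bar> \<le> B" using offset_bound by blast
  have "H (False, a + 2 * k) (True, b + 2 * k)" for k using cross shift_2 by simp
  then have "H (z, \<epsilon> * (a + 2 * k) + c) (\<not> z, \<delta> * (b + 2 * k) + d)" for k
    using affine_automorphismD(2)[OF assms] by simp
  then have "\<bar>(\<epsilon> * (a + 2 * k) + c) - (\<delta> * (b + 2 * k) + d)\<bar> \<le> B" for k
    using B[of "\<epsilon> * (a + 2 * k) + c" "\<delta> * (b + 2 * k) + d"]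
      B[of "\<delta> * (b + 2 * k) + d" "\<epsilon> * (a + 2 * k) + c"]
      rigidD(1)[OF rig, of "(z, \<epsilon> * (a + 2 * k) + c)" "(\<not> z, \<delta> * (b + 2 * k) + d)"]
    by (cases z) (simp_all add: abs_minus_commute)
  note this[of "\<bar>a\<bar> + \<bar>b\<bar> + \<bar>c\<bar> + \<bar>d\<bar> + \<bar>B\<bar> + 1"] this[of 0]
  then show False using ne affine_automorphismD(5,6)[OF assms] by auto
qed

text \<open>Adding \<open>d - c\<close> maps the nonempty finite set of offsets into itself. Its
  maximum shows that \<open>d - c\<close> is not positive, its minimum that it is not
  negative.\<close>

lemma same_translation:
  assumes "affine_automorphism H False 1 c \<delta> d"
  shows "d = c"
proof -
  have "\<delta> = 1" using same_direction[OF assms] by simp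
  have step: "x + (d - c) \<in> offsets" if "x \<in> offsets" for x
  proof -
    from that obtain i where "H (False, i) (True, i + x)" by (auto simp: offsets_def)
    then have "H (False, i + c) (True, i + x + d)"
      using affine_automorphismD(2)[OF assms, of i "i + x"] \<open>\<delta> = 1\<close> by simp
    then show ?thesis
      unfolding offsets_def by (intro CollectI exI[of _ "i + c"]) (simp add: algebra_simps)
  qed
  have "Max offsets + (d - c) \<in> offsets" "Min offsets + (d - c) \<in> offsets"
    using step Max_in Min_in finite_offsets offset_cross by blast+
  from Max_ge[OF finite_offsets this(1)] Min_le[OF finite_offsets this(2)]
  show ?thesis by simp
qed

text \<open>Under the unit translation every chord comes with a parallel one, and every offset
  occurs at all positions; hence no long chords exist and the offsets are one value or two
  consecutive ones.\<close>

lemma translation_ladder_or_square: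
  assumes t: "\<And>s i s' j. H (s, i + 1) (s', j + 1) = H (s, i) (s', j)"
  shows "\<exists>d. (\<forall>i j. H (False, i) (True, j) \<longleftrightarrow> j = i + d) \<or>
      (\<forall>i j. H (False, i) (True, j) \<longleftrightarrow> j = i + d \<or> j = i + d + 1)"
    "H (s, i) (s, j) \<longleftrightarrow> \<bar>i - j\<bar> = 1"
proof -
  have sh: "H (s, i + k) (s', j + k) = H (s, i) (s', j)" for s i s' j k
    using shift_int_mult[of "\<lambda>i j. H (s, i) (s', j)" 1 1 i k j, OF t] by simp
  have chord: "\<not> H (s, i) (s, i + k)" if "k \<ge> 2" for s i k
  proof
    assume "H (s, i) (s, i + k)"
    with sh[of s i 1 s "i + k"] rigid_no_parallel_chords[OF rig that, of s i] show False by simp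
  qed
  show "H (s, i) (s, j) \<longleftrightarrow> \<bar>i - j\<bar> = 1"
  proof
    assume h: "H (s, i) (s, j)"
    consider "i = j" | "\<bar>i - j\<bar> = 1" | "j \<ge> i + 2" | "i \<ge> j + 2" by linarith
    then show "\<bar>i - j\<bar> = 1"
    proof cases
      case 3 then show ?thesis using chord[of "j - i" s i] h by simp
    next
      case 4 then show ?thesis using chord[of "i - j" s j] rigidD(1)[OF rig h] by simp
    qed (use irr h in auto)
  qed (rule rigid_step[OF rig])
  have off: "H (False, i) (True, j) \<longleftrightarrow> j - i \<in> offsets" for i j
  proof
    assume "H (False, i) (True, j)"
    then show "j - i \<in> offsets" unfolding offsets_def by (intro CollectI exI[of _ i]) simp
  next
    assume "j - i \<in> offsets"
    then obtain l where "H (False, l) (True, l + (j - i))" by (auto simp: offsets_def)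
    with sh[of False l "i - l" True "l + (j - i)"] show "H (False, i) (True, j)" by simp
  qed
  define d where "d = Min offsets"
  have d: "d \<in> offsets" "\<And>d'. d' \<in> offsets \<Longrightarrow> d \<le> d'"
    unfolding d_def by (rule Min_in[OF finite_offsets], use offset_cross in blast, rule Min_le[OF finite_offsets])
  have close: "d' = d \<or> d' = d + 1" if "d' \<in> offsets" for d'
  proof -
    have "H (False, i) (True, i + d)" "H (False, i) (True, i + d')" for i using off d(1) that by simp_all
    from rigid_offsets_close[OF rig this] d(2)[OF that] show ?thesis by linarith
  qed
  show "\<exists>d. (\<forall>i j. H (False, i) (True, j) \<longleftrightarrow> j = i + d) \<or>
      (\<forall>i j. H (False, i) (True, j) \<longleftrightarrow> j = i + d \<or> j = i + d + 1)"
  proof (cases "d + 1 \<in> offsets")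
    case True
    then have "offsets = {d, d + 1}" using d(1) close by (intro equalityI subsetI) auto
    then have "j - i \<in> offsets \<longleftrightarrow> j = i + d \<or> j = i + d + 1" for i j by (simp only: insert_iff empty_iff) presburger
    then show ?thesis unfolding off by blast
  next
    case False
    then have "offsets = {d}" using d(1) close by (intro equalityI subsetI) auto
    then have "j - i \<in> offsets \<longleftrightarrow> j = i + d" for i j by (simp only: insert_iff empty_iff) presburger
    then show ?thesis unfolding off by blast
  qed
qed

lemma odd_translation:
  assumes "affine_automorphism H False 1 c \<delta> d" "odd c"
  shows "H (s, i + 1) (s', j + 1) = H (s, i) (s', j)"
proof -
  have "\<delta> = 1" "d = c" using same_direction[OF assms(1)] same_translation[OF assms(1)] by simp_all
  then have "H (s, i + c) (s', j + c) = H (s, i) (s', j)"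
    using affine_automorphismD(1-4)[OF assms(1)] by (cases s; cases s') simp_all
  moreover have "i + c = i + 1 + 2 * (c div 2)" for i using assms(2) by presburger
  ultimately show ?thesis using shift_2 by metis
qed

text \<open>Without an odd translation, the automorphism taking the origin to its neighbour is a
  reflection, and composing it with one that interchanges the two rays fixes all parameters.\<close>

lemma dihedral_ladder:
  assumes no_odd: "\<And>c \<delta> d. affine_automorphism H False 1 c \<delta> d \<Longrightarrow> even c"
  shows "\<exists>d. \<forall>i j. H (False, i) (True, j) \<longleftrightarrow> j = i + d"
    "H (s, i) (s, j) \<longleftrightarrow> \<bar>i - j\<bar> = 1"
proof -
  obtain \<epsilon> \<delta> c where "affine_automorphism H False \<epsilon> 1 \<delta> c" using transitive by blast
  moreover from this no_odd[of 1 \<delta> c] have "\<epsilon> = -1" using affine_automorphismD(5) by fastforce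
  ultimately have rho: "affine_automorphism H False (-1) 1 (-1) c" using same_direction by metis
  obtain \<mu> s0 \<nu> r0 where s0: "affine_automorphism H True \<mu> s0 \<nu> r0" using transitive by blast
  \<comment> \<open>An exchange of the rays that preserves directions: a reversing one is corrected
    by composing it with the reflection \<open>rho\<close>.\<close>
  obtain s' r where sig: "affine_automorphism H True 1 s' 1 r"
  proof (cases "\<mu> = 1")
    case True
    then show thesis using that s0 same_direction[OF s0] by metis
  next
    case False
    then have "\<mu> = -1" "\<nu> = -1" using affine_automorphismD(5)[OF s0] same_direction[OF s0] by auto
    then show thesis using that affine_automorphism_comp[OF s0 rho] by simp
  qed
  from affine_automorphism_comp[OF sig sig]
  have "affine_automorphism H False 1 (s' + r) 1 (s' + r)" by (simp add: add.commute)
  then have ev: "even (s' + r)" by (rule no_odd)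
  \<comment> \<open>This composite of \<open>rho\<close> and \<open>sig\<close> reverses directions
    and exchanges the rays, so its square is a translation of each ray. Both must have the same
    length, which determines \<open>c\<close>.\<close>
  have "affine_automorphism H True (-1) (c - s') (-1) (1 - r)"
    using affine_automorphism_comp[OF rho sig] by simp
  from affine_automorphism_comp[OF this this]
  have "affine_automorphism H False 1 (s' - c + (1 - r)) 1 (r - 1 + (c - s'))" by simp
  from same_translation[OF this] have c: "c = 1 + s' - r" by simp
  \<comment> \<open>Relabelling \<open>True\<close> by \<open>u\<close> moves the centre of the
    reflection to one half on both rays and turns the exchange into a uniform shift by
    \<open>r + u\<close>.\<close>
  define u where "u = (s' - r) div 2"
  have u: "s' = r + 2 * u" unfolding u_def using ev by presburger
  define H' where "H' = (\<lambda>u' v. H (fst u', snd u' + (if fst u' then u else 0)) (fst v, snd v + (if fst v then u else 0)))"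
  have R: "rigid H'" unfolding H'_def by (rule rigid_shift_True[OF rig])
  have irr': "\<not> H' v v" for v by (simp add: H'_def irr)
  have cross': "H' (False, a) (True, b - u)" using cross by (simp add: H'_def)
  have sh2': "H' (s, i + 2) (s', j + 2) = H' (s, i) (s', j)" for s i s' j
    using shift_2[of s "i + (if s then u else 0)" 1 s' "j + (if s' then u else 0)"]
    by (simp add: H'_def algebra_simps)
  have refl': "H' (s, 1 - i) (s', 1 - j) = H' (s, i) (s', j)" for s i s' j
    using affine_automorphismD(1)[OF rho, of i j] affine_automorphismD(2)[OF rho, of i "j + u"]
      affine_automorphismD(3)[OF rho, of "i + u" "j + u"] affine_automorphismD(4)[OF rho, of "i + u" j] c u
    by (cases s; cases s') (simp_all add: H'_def algebra_simps)
  have swap': "H' (\<not> s, i + (r + u)) (\<not> s', j + (r + u)) = H' (s, i) (s', j)" for s i s' j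
    using affine_automorphismD(1)[OF sig, of i j] affine_automorphismD(2)[OF sig, of i "j + u"]
      affine_automorphismD(3)[OF sig, of "i + u" "j + u"] affine_automorphismD(4)[OF sig, of "i + u" j] u
    by (cases s; cases s') (simp_all add: H'_def algebra_simps)
  note L = rigid_dihedral_ladder[OF R irr' cross' sh2' refl' swap']
  have "H (False, i) (True, j) \<longleftrightarrow> j = i + u" for i j
    using L(1)[of i "j - u"] by (auto simp: H'_def)
  then show "\<exists>d. \<forall>i j. H (False, i) (True, j) \<longleftrightarrow> j = i + d" by blast
  show "H (s, i) (s, j) \<longleftrightarrow> \<bar>i - j\<bar> = 1"
    using L(2)[of s "i - (if s then u else 0)" "j - (if s then u else 0)"] by (simp add: H'_def)
qed

theorem ladder_or_square:
  shows "\<exists>d. (\<forall>i j. H (False, i) (True, j) \<longleftrightarrow> j = i + d) \<or>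
      (\<forall>i j. H (False, i) (True, j) \<longleftrightarrow> j = i + d \<or> j = i + d + 1)"
    "H (s, i) (s, j) \<longleftrightarrow> \<bar>i - j\<bar> = 1"
proof -
  have "(\<exists>d. (\<forall>i j. H (False, i) (True, j) \<longleftrightarrow> j = i + d) \<or>
      (\<forall>i j. H (False, i) (True, j) \<longleftrightarrow> j = i + d \<or> j = i + d + 1)) \<and>
      (\<forall>s i j. H (s, i) (s, j) \<longleftrightarrow> \<bar>i - j\<bar> = 1)"
  proof (cases "\<exists>c \<delta> d. affine_automorphism H False 1 c \<delta> d \<and> odd c")
    case True
    then obtain c \<delta> d where "affine_automorphism H False 1 c \<delta> d" "odd c" by blast
    note t = odd_translation[OF this]
    show ?thesis
      by (intro conjI allI translation_ladder_or_square[OF t])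
  next
    case False
    then have no_odd: "even c" if "affine_automorphism H False 1 c \<delta> d" for c \<delta> d using that by blast
    have "\<exists>d. \<forall>i j. H (False, i) (True, j) \<longleftrightarrow> j = i + d" by (rule dihedral_ladder(1)) (rule no_odd)
    moreover have "\<forall>s i j. H (s, i) (s, j) \<longleftrightarrow> \<bar>i - j\<bar> = 1"
      by (intro allI, rule dihedral_ladder(2)) (rule no_odd)
    ultimately show ?thesis by blast
  qed
  then show "\<exists>d. (\<forall>i j. H (False, i) (True, j) \<longleftrightarrow> j = i + d) \<or>
      (\<forall>i j. H (False, i) (True, j) \<longleftrightarrow> j = i + d \<or> j = i + d + 1)"
    "H (s, i) (s, j) \<longleftrightarrow> \<bar>i - j\<bar> = 1" by blast+
qed

end

section \<open>Two-ended graphs\<close>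

lemma edge_verts:
  assumes "simple_graph G" "{u, v} \<in> edges G"
  shows "u \<in> verts G" "v \<in> verts G" "u \<noteq> v"
proof -
  obtain a b where "a \<in> verts G" "b \<in> verts G" "a \<noteq> b" "{u, v} = {a, b}"
    using assms unfolding simple_graph_def by blast
  then show "u \<in> verts G" "v \<in> verts G" "u \<noteq> v" by (auto simp: doubleton_eq_iff)
qed

lemma edges_delete [simp]:
  "{u, v} \<in> edges (delete_verts G K) \<longleftrightarrow> {u, v} \<in> edges G \<and> u \<notin> K \<and> v \<notin> K"
  by (auto simp: delete_verts_def)

lemma verts_delete [simp]: "verts (delete_verts G K) = verts G - K"
  by (simp add: delete_verts_def)

lemma simple_graph_delete: "simple_graph G \<Longrightarrow> simple_graph (delete_verts G K)"
  unfolding simple_graph_def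
proof
  fix e assume "\<forall>e\<in>edges G. \<exists>u\<in>verts G. \<exists>v\<in>verts G. u \<noteq> v \<and> e = {u, v}"
    and e: "e \<in> edges (delete_verts G K)"
  then obtain u v where "u \<in> verts G" "v \<in> verts G" "u \<noteq> v" "e = {u, v}"
    by (auto simp: delete_verts_def)
  moreover from this e have "u \<notin> K" "v \<notin> K" by auto
  ultimately show "\<exists>u\<in>verts (delete_verts G K). \<exists>v\<in>verts (delete_verts G K). u \<noteq> v \<and> e = {u, v}"
    by (metis DiffI verts_delete)
qed

lemma component_of_refl [simp]: "v \<in> component_of G v"
  by (simp add: component_of_def)

lemma component_of_step: "w \<in> component_of G v \<Longrightarrow> {w, x} \<in> edges G \<Longrightarrow> x \<in> component_of G v"
  unfolding component_of_def by (auto intro: rtrancl_into_rtrancl)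

lemma component_of_subset:
  assumes "v \<in> S" "\<And>x y. x \<in> S \<Longrightarrow> {x, y} \<in> edges G \<Longrightarrow> y \<in> S"
  shows "component_of G v \<subseteq> S"
proof
  fix w assume "w \<in> component_of G v"
  then have "(v, w) \<in> {(x, y). {x, y} \<in> edges G}\<^sup>*" by (simp add: component_of_def)
  then show "w \<in> S" by induction (use assms in auto)
qed

lemma component_of_sym: "w \<in> component_of G v \<longleftrightarrow> v \<in> component_of G w"
proof -
  have "sym {(x, y). {x, y} \<in> edges G}" by (auto simp: sym_def insert_commute)
  then show ?thesis using sym_rtrancl unfolding component_of_def sym_def by blast
qed

lemma component_of_eq:
  assumes "w \<in> component_of G v" shows "component_of G w = component_of G v"
proof
  show "component_of G w \<subseteq> component_of G v"
    by (rule component_of_subset[OF assms]) (rule component_of_step)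
  show "component_of G v \<subseteq> component_of G w"
    by (rule component_of_subset[OF iffD1[OF component_of_sym assms]]) (rule component_of_step)
qed

lemma component_of_mono:
  "K \<subseteq> L \<Longrightarrow> component_of (delete_verts G L) v \<subseteq> component_of (delete_verts G K) v"
proof (rule component_of_subset)
  fix x y assume KL: "K \<subseteq> L" and "x \<in> component_of (delete_verts G K) v" "{x, y} \<in> edges (delete_verts G L)"
  then show "y \<in> component_of (delete_verts G K) v"
    using component_of_step[of x "delete_verts G K" v y] KL by auto
qed simp

lemma component_of_verts: "simple_graph G \<Longrightarrow> v \<in> verts G \<Longrightarrow> component_of G v \<subseteq> verts G"
  by (rule component_of_subset) (auto dest: edge_verts)

lemma components_disjoint: "C \<in> components G \<Longrightarrow> D \<in> components G \<Longrightarrow> C \<inter> D \<noteq> {} \<Longrightarrow> C = D"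
proof -
  assume "C \<in> components G" "D \<in> components G" "C \<inter> D \<noteq> {}"
  then obtain v w x where "C = component_of G v" "D = component_of G w" "x \<in> C" "x \<in> D"
    unfolding components_def by blast
  then show "C = D" using component_of_eq[of x G v] component_of_eq[of x G w] by simp
qed

lemma connected_graph_component:
  "connected_graph G \<Longrightarrow> v \<in> verts G \<Longrightarrow> w \<in> verts G \<Longrightarrow> w \<in> component_of G v"
proof -
  assume "connected_graph G" and v: "v \<in> verts G" "w \<in> verts G"
  then obtain C where "component_of G ` verts G = {C}" unfolding connected_graph_def components_def by blast
  then have "component_of G v = component_of G w" using v by blast
  then show ?thesis by simp
qed

text \<open>By connectedness every component of \<open>G - K\<close> contains a neighbour of
  \<open>K\<close>, and there are finitely many such neighbours.\<close>

lemma finite_components_delete: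
  assumes "simple_graph G" "connected_graph G" "locally_finite G" "finite K" "K \<subseteq> verts G"
  shows "finite (components (delete_verts G K))"
proof (cases "K = {}")
  case True
  then have "delete_verts G K = G" by (simp add: delete_verts_def)
  then show ?thesis using assms(2) unfolding connected_graph_def by fastforce
next
  case False
  then obtain k where k: "k \<in> K" by blast
  define N where "N = (\<Union>v\<in>K. {u. {v, u} \<in> edges G})"
  have "finite N" using assms(3-5) unfolding N_def locally_finite_def by blast
  moreover have "components (delete_verts G K) \<subseteq> component_of (delete_verts G K) ` N"
  proof
    fix C assume "C \<in> components (delete_verts G K)"
    then obtain v where v: "v \<in> verts G - K" and C: "C = component_of (delete_verts G K) v"
      by (auto simp: components_def)
    have "C \<inter> N \<noteq> {}"
    proof
      assume N: "C \<inter> N = {}"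
      have "component_of (delete_verts G K) v \<subseteq> verts G - K"
        using component_of_verts[OF simple_graph_delete[OF assms(1)], of v K] v by simp
      moreover have "y \<in> C" if "x \<in> C" "{x, y} \<in> edges G" for x y
      proof -
        have "{y, x} \<in> edges G" using that(2) by (simp add: insert_commute)
        then have "y \<notin> K" using N that(1) unfolding N_def by blast
        moreover have "x \<notin> K" using \<open>component_of (delete_verts G K) v \<subseteq> verts G - K\<close> that(1) C by blast
        ultimately show ?thesis using that component_of_step[of x "delete_verts G K" v y] C by simp
      qed
      ultimately have "component_of G v \<subseteq> C" by (intro component_of_subset) (simp_all add: C)
      then have "k \<in> C" using connected_graph_component[OF assms(2), of v k] v k assms(5) by blast
      with \<open>component_of (delete_verts G K) v \<subseteq> verts G - K\<close> k show False by (auto simp: C)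
    qed
    then obtain x where "x \<in> C" "x \<in> N" by blast
    then show "C \<in> component_of (delete_verts G K) ` N"
      unfolding C using component_of_eq[of x "delete_verts G K" v] by blast
  qed
  ultimately show ?thesis using finite_surj by blast
qed

section \<open>Sides of a graph and its two ends\<close>

definition boundary :: "'a ugraph \<Rightarrow> 'a set \<Rightarrow> 'a set" where
  "boundary G A = {v \<in> verts G. \<exists>u. {u, v} \<in> edges G \<and> (u \<in> A) \<noteq> (v \<in> A)}"

text \<open>Both ends of an edge between \<open>B\<close> and its complement belong to the boundary,
  so no such edge survives the deletion of \<open>K\<close>.\<close>

lemma boundary_component:
  assumes G: "simple_graph G" and b: "boundary G B \<subseteq> K" and v: "v \<in> verts G - K"
  shows "component_of (delete_verts G K) v \<subseteq> (if v \<in> B then B else verts G - B)"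
proof (rule component_of_subset)
  show "v \<in> (if v \<in> B then B else verts G - B)" using v by simp
  fix x y
  assume x: "x \<in> (if v \<in> B then B else verts G - B)" and "{x, y} \<in> edges (delete_verts G K)"
  then have e: "{x, y} \<in> edges G" "y \<notin> K" by simp_all
  then have "y \<notin> boundary G B" "y \<in> verts G" using b edge_verts[OF G] by blast+
  with e(1) have "x \<in> B \<longleftrightarrow> y \<in> B" unfolding boundary_def by blast
  with x \<open>y \<in> verts G\<close> show "y \<in> (if v \<in> B then B else verts G - B)" by (auto split: if_splits)
qed

text \<open>Two-endedness with a distinguished end: \<open>A\<close> is the side of that end, and
  after deleting any finite set a single component contains almost all of \<open>A\<close>, and
  likewise for the complement. The conditions are symmetric, so \<open>complement\<close> transfers
  every fact to the other end.\<close>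

locale two_sided_graph =
  fixes G :: "'a ugraph" and A :: "'a set"
  assumes simple: "simple_graph G" and locfin: "locally_finite G"
    and side: "A \<subseteq> verts G" "infinite A" "infinite (verts G - A)" "finite (boundary G A)"
    and tails: "\<And>K. finite K \<Longrightarrow> K \<subseteq> verts G \<Longrightarrow> \<exists>C\<in>components (delete_verts G K). finite (A - C)"
      "\<And>K. finite K \<Longrightarrow> K \<subseteq> verts G \<Longrightarrow> \<exists>C\<in>components (delete_verts G K). finite (verts G - A - C)"
begin

lemma double_complement: "verts G - (verts G - A) = A"
  using side(1) by blast

lemma boundary_complement: "boundary G (verts G - A) = boundary G A"
  unfolding boundary_def using edge_verts[OF simple] by blast

lemma complement: "two_sided_graph G (verts G - A)"
  by unfold_locales
    (use simple locfin side tails in \<open>simp_all add: double_complement boundary_complement\<close>)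

end

text \<open>The set \<open>tail G A K\<close> is the component of \<open>G - K\<close> that contains almost all of \<open>A\<close>.\<close>

definition tail :: "'a ugraph \<Rightarrow> 'a set \<Rightarrow> 'a set \<Rightarrow> 'a set" where
  "tail G A K = {v \<in> verts G - K. finite (A - component_of (delete_verts G K) v)}"

definition finite_verts :: "'a ugraph \<Rightarrow> 'a set set" where
  "finite_verts G = {K. finite K \<and> K \<subseteq> verts G}"

context two_sided_graph
begin

text \<open>Two cofinite parts of the infinite set \<open>A\<close> intersect, so two components
  that both contain almost all of \<open>A\<close> coincide.\<close>

lemma tail_unique:
  assumes K: "K \<in> finite_verts G" and "C \<in> components (delete_verts G K)" "finite (A - C)"
  shows "C = tail G A K"
proof -
  obtain v where v: "v \<in> verts G - K" "C = component_of (delete_verts G K) v"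
    using assms(2) by (auto simp: components_def)
  have sub: "C \<subseteq> verts G - K"
    using component_of_verts[OF simple_graph_delete[OF simple], of v K] v by simp
  have "w \<in> C" if "w \<in> tail G A K" for w
  proof -
    let ?D = "component_of (delete_verts G K) w"
    have D: "finite (A - ?D)" "?D \<in> components (delete_verts G K)"
      using that by (auto simp: tail_def components_def)
    have "A \<subseteq> (A - C) \<union> (A - ?D) \<union> (C \<inter> ?D)" by blast
    then have "C \<inter> ?D \<noteq> {}"
      using assms(3) D(1) side(2) by (metis finite_UnI finite_subset sup_bot.right_neutral)
    then have "C = ?D" using components_disjoint assms(2) D(2) by metis
    then show ?thesis by simp
  qed
  moreover have "w \<in> tail G A K" if "w \<in> C" for w
    using that sub assms(3) component_of_eq[of w "delete_verts G K" v] v by (auto simp: tail_def)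
  ultimately show ?thesis by blast
qed

lemma tail_component: "K \<in> finite_verts G \<Longrightarrow> tail G A K \<in> components (delete_verts G K)"
  and tail_finite: "K \<in> finite_verts G \<Longrightarrow> finite (A - tail G A K)"
  using tails(1) tail_unique unfolding finite_verts_def by (metis mem_Collect_eq)+

lemma tail_infinite: "K \<in> finite_verts G \<Longrightarrow> infinite (tail G A K)"
  using tail_finite side(2) by (metis finite_Diff2)

lemma tail_verts: "tail G A K \<subseteq> verts G - K"
  by (auto simp: tail_def)

lemma tail_mono:
  assumes "K \<in> finite_verts G" "L \<in> finite_verts G" "K \<subseteq> L"
  shows "tail G A L \<subseteq> tail G A K"
proof
  fix v assume "v \<in> tail G A L"
  moreover have "A - component_of (delete_verts G K) v \<subseteq> A - component_of (delete_verts G L) v"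
    using component_of_mono[OF assms(3), of G v] by blast
  ultimately show "v \<in> tail G A K"
    using assms(3) finite_subset by (auto simp: tail_def)
qed

lemma tail_side:
  assumes K: "K \<in> finite_verts G" and "boundary G A \<subseteq> K"
  shows "tail G A K \<subseteq> A"
proof
  fix v assume v: "v \<in> tail G A K"
  show "v \<in> A"
  proof (rule ccontr)
    assume "v \<notin> A"
    then have "component_of (delete_verts G K) v \<subseteq> verts G - A"
      using boundary_component[OF simple assms(2), of v] v by (auto simp: tail_def)
    then have "A - component_of (delete_verts G K) v = A" by blast
    then show False using v side(2) by (simp add: tail_def)
  qed
qed

lemma tails_complement:
  "K \<in> finite_verts G \<Longrightarrow> tail G (verts G - A) K \<in> components (delete_verts G K)"
  "K \<in> finite_verts G \<Longrightarrow> finite (verts G - A - tail G (verts G - A) K)"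
  "K \<in> finite_verts G \<Longrightarrow> infinite (tail G (verts G - A) K)"
  using two_sided_graph.tail_component[OF complement] two_sided_graph.tail_finite[OF complement]
    two_sided_graph.tail_infinite[OF complement] by blast+

text \<open>An infinite component has infinitely many vertices in \<open>A\<close> or in the
  complement, and therefore meets the corresponding tail.\<close>

lemma infinite_components_tails:
  assumes K: "K \<in> finite_verts G"
  shows "infinite_components G K = {tail G A K, tail G (verts G - A) K}"
proof (intro equalityI subsetI)
  fix C assume "C \<in> infinite_components G K"
  then have C: "C \<in> components (delete_verts G K)" "infinite C" by (auto simp: infinite_components_def)
  then obtain v where "v \<in> verts G - K" "C = component_of (delete_verts G K) v"
    by (auto simp: components_def)
  then have "C \<subseteq> verts G"
    using component_of_verts[OF simple_graph_delete[OF simple], of v K] by auto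
  then have "C \<subseteq> (A - tail G A K) \<union> (verts G - A - tail G (verts G - A) K) \<union> (C \<inter> tail G A K) \<union> (C \<inter> tail G (verts G - A) K)"
    by blast
  moreover have "finite (A - tail G A K)" "finite (verts G - A - tail G (verts G - A) K)"
    using tail_finite[OF K] tails_complement(2)[OF K] by simp_all
  ultimately have "infinite (C \<inter> tail G A K) \<or> infinite (C \<inter> tail G (verts G - A) K)"
    using C(2) finite_subset by (meson finite_UnI)
  then have "C \<inter> tail G A K \<noteq> {} \<or> C \<inter> tail G (verts G - A) K \<noteq> {}" by auto
  then show "C \<in> {tail G A K, tail G (verts G - A) K}"
    using components_disjoint[OF C(1)] tail_component[OF K] tails_complement(1)[OF K] by blast
qed (use tail_component[OF K] tails_complement[OF K] tail_infinite[OF K] in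
    \<open>auto simp: infinite_components_def\<close>)

lemma boundary_finite_verts: "boundary G A \<in> finite_verts G"
  using side(4) by (auto simp: finite_verts_def boundary_def)

lemma Un_boundary: "K \<in> finite_verts G \<Longrightarrow> K \<union> boundary G A \<in> finite_verts G"
  using boundary_finite_verts by (auto simp: finite_verts_def)

lemma tails_disjoint:
  assumes "K \<in> finite_verts G" "boundary G A \<subseteq> K"
  shows "tail G A K \<inter> tail G (verts G - A) K = {}"
  using tail_side[OF assms] two_sided_graph.tail_side[OF complement assms(1)] assms(2)
  by (auto simp: boundary_complement)

lemma tail_nonempty: "K \<in> finite_verts G \<Longrightarrow> tail G A K \<noteq> {}"
  using tail_infinite by fastforce

lemma tails_ne:
  assumes "K \<in> finite_verts G" "boundary G A \<subseteq> K"
  shows "tail G A K \<noteq> tail G (verts G - A) K"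
  using tails_disjoint[OF assms] tail_nonempty[OF assms(1)] by blast

text \<open>The bound two is attained at \<open>boundary G A\<close>, whose deletion makes the two
  tails distinct.\<close>

lemma number_of_ends_2: "number_of_ends G = 2"
  unfolding number_of_ends_def
proof (rule Least_equality)
  show "\<forall>K. finite K \<and> K \<subseteq> verts G \<longrightarrow> at_most (infinite_components G K) 2"
  proof (intro allI impI)
    fix K assume "finite K \<and> K \<subseteq> verts G"
    then have "infinite_components G K = {tail G A K, tail G (verts G - A) K}"
      using infinite_components_tails by (simp add: finite_verts_def)
    then show "at_most (infinite_components G K) 2"
      by (simp add: at_most_def card_insert_if numeral_eq_enat)
  qed
next
  fix k assume k: "\<forall>K. finite K \<and> K \<subseteq> verts G \<longrightarrow> at_most (infinite_components G K) k"
  let ?K = "boundary G A"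
  have "at_most (infinite_components G ?K) k"
    using k boundary_finite_verts by (simp add: finite_verts_def)
  moreover have "card (infinite_components G ?K) = 2"
    using infinite_components_tails[OF boundary_finite_verts] tails_ne[OF boundary_finite_verts] by simp
  ultimately show "2 \<le> k"
    by (cases k) (auto simp: at_most_def numeral_eq_enat)
qed

text \<open>The restriction places the function in the extensional product from which ends are
  taken. The side is an argument, so that both ends can be named in one context.\<close>

definition end_of :: "'a set \<Rightarrow> 'a set \<Rightarrow> 'a set" where
  "end_of S = restrict (tail G S) (finite_verts G)"

lemma end_of_in_ends: "end_of A \<in> ends G"
proof -
  have "end_of A \<in> (\<Pi>\<^sub>E K\<in>finite_verts G. infinite_components G K)"
    unfolding end_of_def restrict_PiE_iff using infinite_components_tails by simp
  moreover have "end_of A L \<subseteq> end_of A K" if "L \<in> finite_verts G" "K \<subseteq> L" for K L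
  proof -
    have "K \<in> finite_verts G" using that finite_subset by (auto simp: finite_verts_def)
    then show ?thesis using that tail_mono by (simp add: end_of_def)
  qed
  ultimately show ?thesis unfolding ends_def finite_verts_def by blast
qed

text \<open>An end is determined by its choice at the boundary. For any other \<open>K\<close>, its
  value at the union of \<open>K\<close> and the boundary must lie in the chosen tail, and that
  fixes the component selected at \<open>K\<close>.\<close>

lemma ends_eq: "ends G = {end_of A, end_of (verts G - A)}"
proof (intro equalityI subsetI)
  fix \<omega> assume "\<omega> \<in> ends G"
  then have \<omega>: "\<omega> \<in> extensional (finite_verts G)"
    "\<And>K. K \<in> finite_verts G \<Longrightarrow> \<omega> K \<in> {tail G A K, tail G (verts G - A) K}"
    "\<And>K L. L \<in> finite_verts G \<Longrightarrow> K \<subseteq> L \<Longrightarrow> \<omega> L \<subseteq> \<omega> K"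
  proof -
    have "\<omega> \<in> (\<Pi>\<^sub>E K\<in>finite_verts G. infinite_components G K)"
      using \<open>\<omega> \<in> ends G\<close> unfolding ends_def finite_verts_def by blast
    then show "\<omega> \<in> extensional (finite_verts G)"
      "\<And>K. K \<in> finite_verts G \<Longrightarrow> \<omega> K \<in> {tail G A K, tail G (verts G - A) K}"
      using infinite_components_tails by (auto simp: PiE_iff)
    show "\<And>K L. L \<in> finite_verts G \<Longrightarrow> K \<subseteq> L \<Longrightarrow> \<omega> L \<subseteq> \<omega> K"
      using \<open>\<omega> \<in> ends G\<close> unfolding ends_def finite_verts_def by blast
  qed
  let ?B = "boundary G A"
  have key: "\<omega> = end_of S"
    if S: "S = A \<or> S = verts G - A" and b: "\<omega> ?B = tail G S ?B" for S
  proof (rule extensionalityI[OF \<omega>(1)])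
    fix K assume K: "K \<in> finite_verts G"
    interpret S: two_sided_graph G S using S complement two_sided_graph_axioms by blast
    have bS: "boundary G S = ?B" and SA: "{tail G A L, tail G (verts G - A) L} = {tail G S L, tail G (verts G - S) L}" for L
      using S by (auto simp: boundary_complement double_complement)
    let ?L = "K \<union> ?B"
    have L: "?L \<in> finite_verts G" using K by (rule Un_boundary)
    have "\<omega> ?L \<subseteq> tail G S ?B" using \<omega>(3)[OF L, of ?B] b by simp
    moreover have "tail G S ?B \<inter> tail G (verts G - S) ?L = {}"
      using S.tails_disjoint[of ?B] two_sided_graph.tail_mono[OF S.complement, of ?B ?L]
        boundary_finite_verts L bS by auto
    ultimately have "\<omega> ?L = tail G S ?L"
      using \<omega>(2)[OF L] SA[of ?L] two_sided_graph.tail_nonempty[OF S.complement L] by blast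
    then have sub: "tail G S ?L \<subseteq> \<omega> K" using \<omega>(3)[OF L, of K] by simp
    have "tail G S ?L \<subseteq> tail G S K" by (rule S.tail_mono) (use K L in auto)
    with sub have "\<omega> K \<inter> tail G S K \<noteq> {}" using S.tail_nonempty[OF L] by blast
    moreover have "\<omega> K \<in> components (delete_verts G K)"
      using \<omega>(2)[OF K] tail_component[OF K] tails_complement(1)[OF K] by auto
    ultimately have "\<omega> K = tail G S K" using components_disjoint S.tail_component[OF K] by blast
    then show "\<omega> K = end_of S K" using K by (simp add: end_of_def)
  qed (simp add: end_of_def)
  show "\<omega> \<in> {end_of A, end_of (verts G - A)}"
    using \<omega>(2)[OF boundary_finite_verts] key[of A] key[of "verts G - A"] by blast
next
  fix \<omega> assume "\<omega> \<in> {end_of A, end_of (verts G - A)}"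
  moreover have "end_of (verts G - A) \<in> ends G"
    using two_sided_graph.end_of_in_ends[OF complement]
    unfolding end_of_def two_sided_graph.end_of_def[OF complement] .
  ultimately show "\<omega> \<in> ends G" using end_of_in_ends by blast
qed

lemma end_of_apply [simp]: "K \<in> finite_verts G \<Longrightarrow> end_of S K = tail G S K"
  by (simp add: end_of_def)

lemma end_of_ne: "end_of A \<noteq> end_of (verts G - A)"
  using tails_ne[OF boundary_finite_verts] boundary_finite_verts
  by (metis end_of_apply order_refl)

end

text \<open>Some finite \<open>K0\<close> leaves exactly two infinite components, and one of them is
  taken as the side. Deleting further vertices leaves an infinite component inside each of the two;
  a third is impossible, so everything else is finite.\<close>

lemma two_ended_two_sided:
  assumes simple: "simple_graph G" and conn: "connected_graph G" and locfin: "locally_finite G"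
    and ends: "number_of_ends G = 2"
  shows "\<exists>A. two_sided_graph G A"
proof -
  let ?P = "\<lambda>k. \<forall>K. finite K \<and> K \<subseteq> verts G \<longrightarrow> at_most (infinite_components G K) k"
  have "?P \<infinity>" by (simp add: at_most_def)
  then have "?P (number_of_ends G)" unfolding number_of_ends_def by (rule LeastI)
  then have le2: "finite (infinite_components G K)" "card (infinite_components G K) \<le> 2"
    if "finite K" "K \<subseteq> verts G" for K
    using that unfolding ends numeral_eq_enat by (auto simp: at_most_def)
  have "\<not> ?P 1"
  proof -
    have "1 < number_of_ends G" unfolding ends numeral_eq_enat one_enat_def by simp
    then show ?thesis unfolding number_of_ends_def by (rule not_less_Least)
  qed
  then obtain K0 where K0: "finite K0" "K0 \<subseteq> verts G" "\<not> at_most (infinite_components G K0) 1" by blast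
  then have "card (infinite_components G K0) = 2"
    using le2[of K0] by (simp add: at_most_def one_enat_def)
  then obtain C1 C2 where C12: "infinite_components G K0 = {C1, C2}" "C1 \<noteq> C2" unfolding card_2_iff by blast
  then have C: "C1 \<in> components (delete_verts G K0)" "C2 \<in> components (delete_verts G K0)" "infinite C1" "infinite C2"
    by (auto simp: infinite_components_def)
  then have disj: "C1 \<inter> C2 = {}" using components_disjoint C12(2) by blast
  have comp_sub: "D \<subseteq> verts G - K" if "D \<in> components (delete_verts G K)" for D K
    using that component_of_verts[OF simple_graph_delete[OF simple], of _ K] by (auto simp: components_def)
  have comp_in: "component_of (delete_verts G (K \<union> K0)) v \<subseteq> D"
    if Dv: "D \<in> components (delete_verts G K0)" "v \<in> D" for D K v
  proof -
    obtain w where w: "D = component_of (delete_verts G K0) w" using Dv(1) by (auto simp: components_def)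
    then have "component_of (delete_verts G K0) v = D"
      using component_of_eq[of v "delete_verts G K0" w] Dv(2) by simp
    then show ?thesis using component_of_mono[of K0 "K \<union> K0" G v] by blast
  qed
  \<comment> \<open>Otherwise \<open>D\<close> would be covered by deleted vertices and finitely
    many finite components.\<close>
  have big: "\<exists>D'\<in>components (delete_verts G (K \<union> K0)). infinite D' \<and> D' \<subseteq> D"
    if D: "D \<in> components (delete_verts G K0)" "infinite D" and K: "finite K" "K \<subseteq> verts G" for D K
  proof (rule ccontr)
    let ?L = "K \<union> K0" and ?\<C> = "components (delete_verts G (K \<union> K0))"
    assume "\<not> ?thesis"
    then have "finite D'" if "D' \<in> ?\<C>" "D' \<subseteq> D" for D' using that by blast
    moreover have "finite ?\<C>"
      using finite_components_delete[OF simple conn locfin] K K0(1,2) by simp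
    ultimately have "finite (\<Union>{D' \<in> ?\<C>. D' \<subseteq> D})" by auto
    moreover have "D \<subseteq> ?L \<union> \<Union>{D' \<in> ?\<C>. D' \<subseteq> D}"
    proof
      fix v assume v: "v \<in> D"
      show "v \<in> ?L \<union> \<Union>{D' \<in> ?\<C>. D' \<subseteq> D}"
      proof (cases "v \<in> ?L")
        case False
        then have "component_of (delete_verts G ?L) v \<in> ?\<C>"
          using comp_sub[OF D(1)] v by (auto simp: components_def)
        moreover have "component_of (delete_verts G ?L) v \<subseteq> D" by (rule comp_in[OF D(1) v])
        ultimately show ?thesis using component_of_refl[of v "delete_verts G ?L"] by blast
      qed simp
    qed
    ultimately show False using D(2) K K0(1) by (meson finite_UnI finite_subset)
  qed
  have tails: "\<exists>C\<in>components (delete_verts G K). finite (verts G - E - C)"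
    if K: "finite K" "K \<subseteq> verts G" and DE: "D \<in> components (delete_verts G K0)" "infinite D"
      "E \<in> components (delete_verts G K0)" "infinite E" "D \<inter> E = {}" for D E K
  proof -
    let ?L = "K \<union> K0"
    obtain D' where D': "D' \<in> components (delete_verts G ?L)" "infinite D'" "D' \<subseteq> D"
      using big[OF DE(1,2) K] by blast
    obtain E' where E': "E' \<in> components (delete_verts G ?L)" "infinite E'" "E' \<subseteq> E"
      using big[OF DE(3,4) K] by blast
    have L: "finite ?L" "?L \<subseteq> verts G" using K K0 by auto
    have "{D', E'} \<subseteq> infinite_components G ?L" using D' E' by (simp add: infinite_components_def)
    moreover have "D' \<noteq> E'" 
    proof
      assume "D' = E'"
      then have "D' = {}" using D'(3) E'(3) DE(5) by blast
      then show False using D'(2) by simp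
    qed
    ultimately have inf: "infinite_components G ?L = {D', E'}"
      using le2[OF L] card_seteq[of "infinite_components G ?L" "{D', E'}"] by simp
    have fin: "finite D''" if "D'' \<in> components (delete_verts G ?L) - {D', E'}" for D''
      using that inf unfolding infinite_components_def by blast
    have "verts G - E - D' \<subseteq> ?L \<union> \<Union>(components (delete_verts G ?L) - {D', E'})"
    proof
      fix v assume v: "v \<in> verts G - E - D'"
      show "v \<in> ?L \<union> \<Union>(components (delete_verts G ?L) - {D', E'})"
      proof (cases "v \<in> ?L")
        case False
        then have "component_of (delete_verts G ?L) v \<in> components (delete_verts G ?L)"
          using v by (auto simp: components_def)
        moreover have "component_of (delete_verts G ?L) v \<noteq> D'" "component_of (delete_verts G ?L) v \<noteq> E'"
          using v E'(3) component_of_refl[of v "delete_verts G ?L"] by blast+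
        ultimately show ?thesis using component_of_refl[of v "delete_verts G ?L"] by blast
      qed simp
    qed
    moreover have "finite (\<Union>(components (delete_verts G ?L) - {D', E'}))"
      using finite_components_delete[OF simple conn locfin L] fin by auto
    ultimately have "finite (verts G - E - D')" using L(1) by (meson finite_UnI finite_subset)
    moreover obtain v where v: "v \<in> verts G - ?L" "D' = component_of (delete_verts G ?L) v"
      using D'(1) by (auto simp: components_def)
    then have "D' \<subseteq> component_of (delete_verts G K) v" using component_of_mono[of K ?L G v] by blast
    ultimately have "finite (verts G - E - component_of (delete_verts G K) v)"
      by (meson Diff_mono finite_subset order_refl)
    then show ?thesis using v(1) by (auto simp: components_def)
  qed
  have "two_sided_graph G C1"
  proof
    show "simple_graph G" "locally_finite G" "infinite C1" using simple locfin C by blast+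
    show C1: "C1 \<subseteq> verts G" using comp_sub[OF C(1)] by blast
    have "C2 \<subseteq> verts G - C1" using comp_sub[OF C(2)] disj by blast
    then show "infinite (verts G - C1)" using C(4) finite_subset by blast
    show "finite (boundary G C1)"
    proof (rule finite_subset)
      show "boundary G C1 \<subseteq> K0 \<union> (\<Union>v\<in>K0. {u. {v, u} \<in> edges G})"
      proof
        fix v assume "v \<in> boundary G C1"
        then obtain u where u: "v \<in> verts G" "{u, v} \<in> edges G" "(u \<in> C1) \<noteq> (v \<in> C1)"
          by (auto simp: boundary_def)
        have "u \<in> K0 \<or> v \<in> K0"
        proof (rule ccontr)
          assume "\<not> ?thesis"
          then have e: "{u, v} \<in> edges (delete_verts G K0)" "{v, u} \<in> edges (delete_verts G K0)"
            using u(2) by (simp_all add: insert_commute)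
          obtain w where w: "C1 = component_of (delete_verts G K0) w" using C(1) by (auto simp: components_def)
          show False using u(3) component_of_step[OF _ e(1), of w] component_of_step[OF _ e(2), of w] w by blast
        qed
        then show "v \<in> K0 \<union> (\<Union>v\<in>K0. {u. {v, u} \<in> edges G})" using u(2) by blast
      qed
      show "finite (K0 \<union> (\<Union>v\<in>K0. {u. {v, u} \<in> edges G}))"
        using K0(1,2) locfin unfolding locally_finite_def by blast
    qed
    fix K assume K: "finite K" "K \<subseteq> verts G"
    show "\<exists>C\<in>components (delete_verts G K). finite (verts G - C1 - C)"
      using tails[OF K C(2,4,1,3)] disj by blast
    \<comment> \<open>With the roles exchanged, almost all vertices outside \<open>C2\<close> lie in
      \<open>D\<close>, and \<open>C1\<close> is disjoint from \<open>C2\<close>.\<close>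
    obtain D where D: "D \<in> components (delete_verts G K)" "finite (verts G - C2 - D)"
      using tails[OF K C(1,3,2,4) disj] by blast
    have "C1 - D \<subseteq> verts G - C2 - D" using C1 disj by blast
    then show "\<exists>C\<in>components (delete_verts G K). finite (C1 - C)"
      using D finite_subset by blast
  qed
  then show ?thesis by blast
qed

section \<open>The circle formed by a pair of rays\<close>

lemma edge_point_simps:
  "edge_point u v 0 = vertex_point u" "edge_point u v 1 = vertex_point v"
  "u \<noteq> v \<Longrightarrow> edge_point u v t u = 1 - t" "u \<noteq> v \<Longrightarrow> edge_point u v t v = t"
  "x \<noteq> u \<Longrightarrow> x \<noteq> v \<Longrightarrow> edge_point u v t x = 0"
  by (auto simp: edge_point_def vertex_point_def)

lemma edge_point_swap: "edge_point v u t = edge_point u v (1 - t)"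
  by (auto simp: edge_point_def)

lemma vertex_point_eq_iff [simp]: "vertex_point u = vertex_point v \<longleftrightarrow> u = v"
  unfolding vertex_point_def by (metis zero_neq_one)

lemma vertex_point_in: "v \<in> verts G \<Longrightarrow> vertex_point v \<in> complex_points G"
  by (auto simp: complex_points_def vertex_point_def)

lemma edge_point_in:
  assumes G: "simple_graph G" "{u, v} \<in> edges G" and t: "t \<in> {0..1}"
  shows "edge_point u v t \<in> complex_points G"
proof -
  note uv = edge_verts[OF G]
  consider "t = 0" | "t = 1" | "0 < t" "t < 1" using t by force
  then show ?thesis
  proof cases
    case 3
    then have supp: "{x. edge_point u v t x \<noteq> 0} = {u, v}"
      using uv by (auto simp: edge_point_def vertex_point_def)
    moreover have "0 \<le> edge_point u v t x" for x
      using 3 by (simp add: edge_point_def vertex_point_def)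
    moreover have "(\<Sum>x\<in>{u, v}. edge_point u v t x) = 1"
      using uv by (simp add: edge_point_def vertex_point_def)
    ultimately show ?thesis
      using G(2) by (simp add: complex_points_def)
  qed (use uv vertex_point_in in \<open>auto simp: edge_point_simps\<close>)
qed

lemma complex_points_cases:
  assumes G: "simple_graph G" and p: "p \<in> complex_points G"
  obtains v where "v \<in> verts G" "p = vertex_point v"
    | u v t where "{u, v} \<in> edges G" "0 < t" "t < 1" "p = edge_point u v t"
proof -
  have nn: "0 \<le> p x" for x using p by (simp add: complex_points_def)
  have sum: "(\<Sum>x | p x \<noteq> 0. p x) = 1" using p by (simp add: complex_points_def)
  consider v where "v \<in> verts G" "{x. p x \<noteq> 0} = {v}" | e where "e \<in> edges G" "{x. p x \<noteq> 0} = e"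
    using p by (auto simp: complex_points_def)
  then show thesis
  proof cases
    case 1
    then have "p v = 1" using sum by simp
    moreover have "p x = 0" if "x \<noteq> v" for x using 1(2) that by blast
    ultimately have "p = vertex_point v" by (auto simp: vertex_point_def)
    then show thesis using that(1) 1(1) by blast
  next
    case 2
    then obtain u v where uv: "u \<noteq> v" "e = {u, v}" using G unfolding simple_graph_def by blast
    then have "p u + p v = 1" using sum 2(2) by simp
    moreover have "p u \<noteq> 0" "p v \<noteq> 0" using 2(2) uv by auto
    moreover have "p x = 0" if "x \<noteq> u" "x \<noteq> v" for x using 2(2) uv that by blast
    ultimately have "p = edge_point u v (p v)" "0 < p v" "p v < 1"
      using uv(1) nn[of u] nn[of v] by (auto simp: edge_point_def vertex_point_def)
    then show thesis using that(2) 2(1) uv(2) by blast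
  qed
qed

lemma complex_point_support:
  assumes G: "simple_graph G" and p: "p \<in> complex_points G" and "p x \<noteq> 0" "p y \<noteq> 0" "x \<noteq> y"
  shows "{x, y} \<in> edges G" "p = edge_point x y (p y)" "p x = 1 - p y"
proof -
  from G p show "{x, y} \<in> edges G" "p = edge_point x y (p y)" "p x = 1 - p y"
  proof (atomize (full), cases rule: complex_points_cases)
    case (1 v)
    then show "{x, y} \<in> edges G \<and> p = edge_point x y (p y) \<and> p x = 1 - p y"
      using assms(3-5) by (auto simp: vertex_point_def split: if_splits)
  next
    case (2 u v t)
    note uv = edge_verts[OF G 2(1)]
    have "x = u \<and> y = v \<or> x = v \<and> y = u"
      using assms(3-5) 2 by (auto simp: edge_point_def vertex_point_def split: if_splits)
    then show "{x, y} \<in> edges G \<and> p = edge_point x y (p y) \<and> p x = 1 - p y"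
    proof
      assume "x = u \<and> y = v" then show ?thesis using 2 uv by (simp add: edge_point_simps)
    next
      assume "x = v \<and> y = u" then show ?thesis using 2 uv
        by (simp add: edge_point_simps insert_commute edge_point_swap[of u v])
    qed
  qed
qed

lemma complex_points_verts: "simple_graph G \<Longrightarrow> p \<in> complex_points G \<Longrightarrow> p x \<noteq> 0 \<Longrightarrow> x \<in> verts G"
proof -
  assume "simple_graph G" "p \<in> complex_points G" and x: "p x \<noteq> 0"
  then consider v where "v \<in> verts G" "{x. p x \<noteq> 0} = {v}"
    | a b where "a \<in> verts G" "b \<in> verts G" "{x. p x \<noteq> 0} = {a, b}"
    unfolding complex_points_def simple_graph_def by auto
  moreover have "x \<in> {x. p x \<noteq> 0}" using x by simp
  ultimately show ?thesis by cases (simp_all only: insert_iff empty_iff, auto)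
qed

lemma complex_points_le_1:
  assumes G: "simple_graph G" and p: "p \<in> complex_points G"
  shows "0 \<le> p x" "p x \<le> 1"
  using assms by (auto elim!: complex_points_cases simp: edge_point_def vertex_point_def)

lemma continuous_edge_point [continuous_intros]: "continuous_on S (\<lambda>t. edge_point u v t x)"
  unfolding edge_point_def by (intro continuous_intros)

text \<open>In the weak topology this may be tested edge by edge, and there a coordinate is an
  affine function of the parameter.\<close>

lemma openin_complex_coordinate:
  assumes G: "simple_graph G" and W: "open W"
  shows "openin (complex_topology G) {p \<in> complex_points G. p x \<in> W}"
  unfolding openin_complex_topology
proof (intro conjI allI impI)
  fix u v assume e: "{u, v} \<in> edges G"
  have "{t \<in> {0..1}. edge_point u v t \<in> {p \<in> complex_points G. p x \<in> W}} =
      {0..1} \<inter> (\<lambda>t. edge_point u v t x) -` W"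
    using edge_point_in[OF G e] by auto
  then show "openin (top_of_set {0..1}) {t \<in> {0..1}. edge_point u v t \<in> {p \<in> complex_points G. p x \<in> W}}"
    using continuous_openin_preimage_gen[OF continuous_edge_point W] by simp
qed auto

lemma openin_complex_gt:
  assumes "simple_graph G"
  shows "openin (complex_topology G) {p \<in> complex_points G. p x > c}"
  using openin_complex_coordinate[OF assms, of "{c<..}" x] by simp

lemma openin_complex_lt:
  assumes "simple_graph G"
  shows "openin (complex_topology G) {p \<in> complex_points G. p x < c}"
  using openin_complex_coordinate[OF assms, of "{..<c}" x] by simp

text \<open>The set is the open star of \<open>S\<close>, a union of open stars of single
  vertices.\<close>

lemma openin_complex_meets:
  assumes "simple_graph G"
  shows "openin (complex_topology G) {p \<in> complex_points G. \<exists>x\<in>S. p x \<noteq> 0}"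
proof -
  have "openin (complex_topology G) (\<Union>x\<in>S. {p \<in> complex_points G. p x \<in> - {0}})"
    by (intro openin_Union) (use openin_complex_coordinate[OF assms, of "- {0}"] in blast)
  moreover have "(\<Union>x\<in>S. {p \<in> complex_points G. p x \<in> - {0}}) = {p \<in> complex_points G. \<exists>x\<in>S. p x \<noteq> 0}" by auto
  ultimately show ?thesis by simp
qed

lemma openin_Pt: "openin (complex_topology G) U \<Longrightarrow> openin (freudenthal G) (Pt ` U)"
  unfolding freudenthal_def by (rule topology_generated_by_Basis) blast

lemma openin_end_nbhd:
  "K \<in> finite_verts G \<Longrightarrow> \<omega> \<in> ends G \<Longrightarrow> openin (freudenthal G) (end_nbhd G K \<omega>)"
  unfolding freudenthal_def finite_verts_def by (rule topology_generated_by_Basis) blast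

text \<open>Continuity only has to be tested on the sets that generate the topology.\<close>

lemma continuous_map_into_freudenthal:
  assumes "\<And>U. openin (complex_topology G) U \<Longrightarrow> openin X {x \<in> topspace X. f x \<in> Pt ` U}"
    and "\<And>K \<omega>. K \<in> finite_verts G \<Longrightarrow> \<omega> \<in> ends G \<Longrightarrow> openin X {x \<in> topspace X. f x \<in> end_nbhd G K \<omega>}"
    and "\<And>x. x \<in> topspace X \<Longrightarrow> f x \<in> topspace (freudenthal G)"
  shows "continuous_map X (freudenthal G) f"
  unfolding freudenthal_def
proof (rule continuous_on_generated_topo)
  fix W assume "W \<in> {Pt ` U |U. openin (complex_topology G) U} \<union>
    {end_nbhd G K \<omega> |K \<omega>. finite K \<and> K \<subseteq> verts G \<and> \<omega> \<in> ends G}"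
  then have "openin X {x \<in> topspace X. f x \<in> W}" using assms(1,2) by (auto simp: finite_verts_def)
  moreover have "{x \<in> topspace X. f x \<in> W} = f -` W \<inter> topspace X" by auto
  ultimately show "openin X (f -` W \<inter> topspace X)" by simp
next
  show "f ` topspace X \<subseteq> \<Union> ({Pt ` U |U. openin (complex_topology G) U} \<union>
    {end_nbhd G K \<omega> |K \<omega>. finite K \<and> K \<subseteq> verts G \<and> \<omega> \<in> ends G})"
    using assms(3) unfolding freudenthal_def topology_generated_by_topspace by (rule image_subsetI)
qed

lemma Pt_in_image [simp]: "Pt p \<in> Pt ` U \<longleftrightarrow> p \<in> U"
  by auto

lemma Pt_in_end_nbhd: "Pt p \<in> end_nbhd G K \<omega> \<longleftrightarrow> p \<in> complex_points G \<and> (\<exists>x\<in>\<omega> K. p x \<noteq> 0)"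
  by (auto simp: end_nbhd_def)

lemma End_in_end_nbhd: "End \<omega>' \<in> end_nbhd G K \<omega> \<longleftrightarrow> \<omega>' \<in> ends G \<and> \<omega>' K = \<omega> K"
  by (auto simp: end_nbhd_def)

lemma continuous_map_Pt:
  assumes G: "simple_graph G"
  shows "continuous_map (complex_topology G) (freudenthal G) Pt"
proof (rule continuous_map_into_freudenthal)
  fix U assume "openin (complex_topology G) U"
  moreover from openin_subset[OF this] have "{x \<in> topspace (complex_topology G). Pt x \<in> Pt ` U} = U" by auto
  ultimately show "openin (complex_topology G) {x \<in> topspace (complex_topology G). Pt x \<in> Pt ` U}" by simp
next
  fix K \<omega>
  have "{x \<in> topspace (complex_topology G). Pt x \<in> end_nbhd G K \<omega>} = {p \<in> complex_points G. \<exists>x\<in>\<omega> K. p x \<noteq> 0}"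
    by (auto simp: Pt_in_end_nbhd topspace_complex_topology[OF G])
  then show "openin (complex_topology G) {x \<in> topspace (complex_topology G). Pt x \<in> end_nbhd G K \<omega>}"
    using openin_complex_meets[OF G] by simp
qed (auto simp: topspace_freudenthal[OF G] topspace_complex_topology[OF G])

lemma continuous_map_edge_point:
  assumes G: "simple_graph G" and e: "{u, v} \<in> edges G"
  shows "continuous_map (top_of_set {0..1}) (complex_topology G) (edge_point u v)"
  unfolding continuous_map_def
proof (intro conjI allI impI)
  show "edge_point u v \<in> topspace (top_of_set {0..1}) \<rightarrow> topspace (complex_topology G)"
    using edge_point_in[OF G e] by (simp add: topspace_complex_topology[OF G])
  fix U assume "openin (complex_topology G) U"
  then show "openin (top_of_set {0..1}) {x \<in> topspace (top_of_set {0..1}). edge_point u v x \<in> U}"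
    using e by (simp add: openin_complex_topology)
qed

text \<open>The walk \<open>p\<close> traversed at unit speed, being at the vertex
  \<open>p i\<close> at time \<open>i\<close>.\<close>

definition line_point :: "(int \<Rightarrow> 'a) \<Rightarrow> real \<Rightarrow> 'a \<Rightarrow> real" where
  "line_point p t = edge_point (p \<lfloor>t\<rfloor>) (p (\<lfloor>t\<rfloor> + 1)) (frac t)"

lemma line_point_on_interval:
  assumes "of_int n \<le> t" "t \<le> of_int n + 1"
  shows "line_point p t = edge_point (p n) (p (n + 1)) (t - of_int n)"
proof (cases "t = of_int n + 1")
  case True
  then have "\<lfloor>t\<rfloor> = n + 1" "frac t = 0" by (simp_all add: frac_def)
  then show ?thesis using True by (simp add: line_point_def edge_point_simps)
next
  case False
  then have "\<lfloor>t\<rfloor> = n" using assms by (simp add: floor_unique)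
  then show ?thesis by (simp add: line_point_def frac_def)
qed

lemma line_point_of_int [simp]: "line_point p (of_int n) = vertex_point (p n)"
  by (simp add: line_point_on_interval[of n] edge_point_simps)

lemma line_point_in:
  assumes "simple_graph G" "\<forall>i. {p i, p (i + 1)} \<in> edges G"
  shows "line_point p t \<in> complex_points G"
  unfolding line_point_def using assms frac_ge_0[of t] frac_lt_1[of t]
  by (intro edge_point_in) (auto intro: less_imp_le)

lemma line_point_floor_nonzero: "inj p \<Longrightarrow> line_point p t (p \<lfloor>t\<rfloor>) = 1 - frac t"
  unfolding line_point_def by (rule edge_point_simps(3)) (simp add: inj_eq)

lemma line_point_support: "line_point p t x \<noteq> 0 \<Longrightarrow> x = p \<lfloor>t\<rfloor> \<or> x = p (\<lfloor>t\<rfloor> + 1)"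
  unfolding line_point_def using edge_point_simps(5) by metis

lemma line_point_inj:
  assumes "inj p" "line_point p s = line_point p t"
  shows "s = t"
proof -
  have "line_point p t (p \<lfloor>s\<rfloor>) \<noteq> 0" "line_point p s (p \<lfloor>t\<rfloor>) \<noteq> 0"
    using line_point_floor_nonzero[OF assms(1), of s] line_point_floor_nonzero[OF assms(1), of t]
      assms(2) frac_lt_1[of s] frac_lt_1[of t] by simp_all
  from line_point_support[OF this(1)] line_point_support[OF this(2)] assms(1)
  have fl: "\<lfloor>s\<rfloor> = \<lfloor>t\<rfloor>" by (auto simp: inj_eq)
  then have "1 - frac s = 1 - frac t"
    using line_point_floor_nonzero[OF assms(1)] assms(2) by metis
  then show ?thesis using fl by (simp add: frac_def)
qed

text \<open>The unit intervals form a locally finite closed cover of the real line, and the pieces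
  agree at the integers.\<close>

lemma continuous_map_line_point:
  assumes G: "simple_graph G" and e: "\<forall>i. {p i, p (i + 1)} \<in> edges G"
  shows "continuous_map euclideanreal (complex_topology G) (line_point p)"
proof (rule pasting_lemma_locally_finite[where I = UNIV and T = "\<lambda>n. {of_int n..of_int n + 1}"
      and f = "\<lambda>n t. edge_point (p n) (p (n + 1)) (t - of_int n)"])
  fix x :: real
  have "{n. {of_int n..of_int n + 1} \<inter> {x - 1<..<x + 1} \<noteq> {}} \<subseteq> {\<lfloor>x\<rfloor> - 3..\<lfloor>x\<rfloor> + 3}"
  proof
    fix n :: int assume "n \<in> {n. {of_int n..of_int n + 1} \<inter> {x - 1<..<x + 1} \<noteq> {}}"
    then have "of_int n < x + 1" "x - 2 < of_int n" by auto
    then show "n \<in> {\<lfloor>x\<rfloor> - 3..\<lfloor>x\<rfloor> + 3}" by (simp add: floor_le_iff) linarith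
  qed
  then show "\<exists>V. openin euclideanreal V \<and> x \<in> V \<and> finite {i \<in> UNIV. {of_int i..of_int i + 1} \<inter> V \<noteq> {}}"
    using finite_subset by (intro exI[of _ "{x - 1<..<x + 1}"]) auto
next
  fix n :: int
  have "continuous_map (top_of_set {of_int n..of_int n + 1}) (top_of_set {0..1}) (\<lambda>t. t - real_of_int n)"
    by (simp add: continuous_map_in_subtopology image_subset_iff continuous_intros)
  from continuous_map_compose[OF this continuous_map_edge_point[OF G e[rule_format]]]
  show "continuous_map (top_of_set {of_int n..of_int n + 1}) (complex_topology G)
      (\<lambda>t. edge_point (p n) (p (n + 1)) (t - of_int n))" by (simp add: o_def)
next
  fix i j :: int and x :: real
  assume "x \<in> topspace euclideanreal \<inter> {of_int i..of_int i + 1} \<inter> {of_int j..of_int j + 1}"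
  then show "edge_point (p i) (p (i + 1)) (x - of_int i) = edge_point (p j) (p (j + 1)) (x - of_int j)"
    using line_point_on_interval[of i x p] line_point_on_interval[of j x p] by auto
next
  fix x :: real
  show "\<exists>j. j \<in> UNIV \<and> x \<in> {of_int j..of_int j + 1} \<and>
      line_point p x = edge_point (p j) (p (j + 1)) (x - of_int j)"
    using line_point_on_interval[of "\<lfloor>x\<rfloor>" x p] by (intro exI[of _ "\<lfloor>x\<rfloor>"]) (auto intro: less_imp_le)
qed auto

definition circle_of :: "'a ugraph \<Rightarrow> (int \<Rightarrow> 'a) \<Rightarrow> (int \<Rightarrow> 'a) \<Rightarrow> 'a fpoint set" where
  "circle_of G p q = Pt ` (range (line_point p) \<union> range (line_point q)) \<union> End ` ends G"

context two_sided_graph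
begin

lemma neighbours_finite_verts:
  assumes "K \<in> finite_verts G"
  shows "(\<Union>v\<in>K. {u. {v, u} \<in> edges G}) \<in> finite_verts G"
  using assms locfin edge_verts(2)[OF simple] unfolding finite_verts_def locally_finite_def by auto

lemma component_no_edge:
  assumes "C \<in> components (delete_verts G K)" "D \<in> components (delete_verts G K)"
    "x \<in> C" "y \<in> D" "{x, y} \<in> edges G"
  shows "C = D"
proof -
  have sub: "E \<subseteq> verts G - K" if "E \<in> components (delete_verts G K)" for E
    using that component_of_verts[OF simple_graph_delete[OF simple], of _ K] by (auto simp: components_def)
  obtain v where v: "C = component_of (delete_verts G K) v" using assms(1) by (auto simp: components_def)
  have "{x, y} \<in> edges (delete_verts G K)" using assms(3-5) sub[OF assms(1)] sub[OF assms(2)] by auto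
  then have "y \<in> C" using component_of_step[of x "delete_verts G K" v y] assms(3) v by simp
  then show ?thesis using components_disjoint[OF assms(1,2)] assms(4) by blast
qed

lemma end_component: "\<omega> \<in> ends G \<Longrightarrow> K \<in> finite_verts G \<Longrightarrow> \<omega> K \<in> components (delete_verts G K)"
  unfolding ends_def infinite_components_def finite_verts_def by auto

text \<open>Two points are separated by a coordinate in which they differ, two ends by a finite set
  at which they select different components, between which there is no edge.\<close>

lemma Hausdorff_freudenthal: "Hausdorff_space (freudenthal G)"
proof -
  let ?T = "freudenthal G"
  let ?S = "\<lambda>x y. \<exists>U V. openin ?T U \<and> openin ?T V \<and> x \<in> U \<and> y \<in> V \<and> disjnt U V"
  have sym: "?S x y \<Longrightarrow> ?S y x" for x y using disjnt_sym by metis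
  have less: "?S (Pt p) (Pt q)" if "p \<in> complex_points G" "q \<in> complex_points G" "p x < q x" for p q x
  proof -
    obtain c where "p x < c" "c < q x" using \<open>p x < q x\<close> dense by blast
    then show ?thesis using that openin_Pt[OF openin_complex_lt[OF simple, of x c]]
        openin_Pt[OF openin_complex_gt[OF simple, of c x]]
      by (intro exI[of _ "Pt ` {p \<in> complex_points G. p x < c}"]
          exI[of _ "Pt ` {p \<in> complex_points G. p x > c}"]) (auto simp: disjnt_def)
  qed
  have pe: "?S (Pt p) (End \<omega>)" if p: "p \<in> complex_points G" and \<omega>: "\<omega> \<in> ends G" for p \<omega>
  proof -
    obtain s where s: "s \<in> verts G" "p s \<noteq> 0"
      using complex_points_verts[OF simple p] p unfolding complex_points_def
      by (metis (mono_tags, lifting) Collect_empty_eq mem_Collect_eq sum.empty zero_neq_one)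
    \<comment> \<open>Once \<open>s\<close> and all its neighbours are deleted, no edge leads from
      \<open>s\<close> into the component selected by the end, so the open star of \<open>s\<close>
      misses the neighbourhood of the end.\<close>
    define K where "K = insert s (\<Union>v\<in>{s}. {u. {v, u} \<in> edges G})"
    have K: "K \<in> finite_verts G"
      using neighbours_finite_verts[of "{s}"] s by (auto simp: K_def finite_verts_def)
    have "disjnt (Pt ` {p \<in> complex_points G. \<exists>x\<in>{s}. p x \<noteq> 0}) (end_nbhd G K \<omega>)"
    proof -
      have False if r: "r \<in> complex_points G" "r s \<noteq> 0" "y \<in> \<omega> K" "r y \<noteq> 0" for r y
      proof -
        have "y \<notin> K"
          using end_component[OF \<omega> K] r(3) component_of_verts[OF simple_graph_delete[OF simple], of _ K]
          by (auto simp: components_def)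
        then have "y \<noteq> s" "{s, y} \<notin> edges G" by (auto simp: K_def)
        then show False using complex_point_support(1)[OF simple r(1,2,4)] by blast
      qed
      then show ?thesis by (auto simp: disjnt_def end_nbhd_def)
    qed
    then show ?thesis
      using openin_Pt[OF openin_complex_meets[OF simple, of "{s}"]] openin_end_nbhd[OF K \<omega>] p s \<omega>
      by (intro exI[of _ "Pt ` {p \<in> complex_points G. \<exists>x\<in>{s}. p x \<noteq> 0}"] exI[of _ "end_nbhd G K \<omega>"])
        (auto simp: End_in_end_nbhd)
  qed
  have ee: "?S (End \<omega>) (End \<omega>')" if \<omega>: "\<omega> \<in> ends G" "\<omega>' \<in> ends G" "\<omega> \<noteq> \<omega>'" for \<omega> \<omega>'
  proof -
    have "\<omega> \<in> extensional (finite_verts G)" "\<omega>' \<in> extensional (finite_verts G)"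
      using \<omega> unfolding ends_def finite_verts_def PiE_def by blast+
    then obtain K where K: "K \<in> finite_verts G" "\<omega> K \<noteq> \<omega>' K"
      using \<omega>(3) extensionalityI by blast
    note C = end_component[OF \<omega>(1) K(1)] end_component[OF \<omega>(2) K(1)]
    have "disjnt (end_nbhd G K \<omega>) (end_nbhd G K \<omega>')"
    proof -
      have False if r: "r \<in> complex_points G" "x \<in> \<omega> K" "r x \<noteq> 0" "y \<in> \<omega>' K" "r y \<noteq> 0" for r x y
      proof -
        have "x \<noteq> y" using components_disjoint[OF C] r K(2) by blast
        from complex_point_support(1)[OF simple r(1,3,5) this] component_no_edge[OF C r(2,4)] K(2)
        show False by blast
      qed
      then show ?thesis using K(2) by (auto simp: disjnt_def end_nbhd_def)
    qed
    then show ?thesis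
      using openin_end_nbhd[OF K(1) \<omega>(1)] openin_end_nbhd[OF K(1) \<omega>(2)] \<omega>
      by (intro exI[of _ "end_nbhd G K \<omega>"] exI[of _ "end_nbhd G K \<omega>'"]) (auto simp: End_in_end_nbhd)
  qed
  show ?thesis
    unfolding Hausdorff_space_def topspace_freudenthal[OF simple]
  proof (intro allI impI, elim conjE)
    fix x y assume xy: "x \<in> Pt ` complex_points G \<union> End ` ends G" "y \<in> Pt ` complex_points G \<union> End ` ends G" "x \<noteq> y"
    show "?S x y"
    proof (cases x; cases y)
      fix p q assume pq: "x = Pt p" "y = Pt q"
      then obtain z where "p z \<noteq> q z" using xy(3) by blast
      then consider "p z < q z" | "q z < p z" by linarith
      then show ?thesis using less[of p q z] sym[OF less[of q p z]] xy pq by cases auto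
    next
      fix p \<omega> assume "x = Pt p" "y = End \<omega>"
      then show ?thesis using pe[of p \<omega>] xy by auto
    next
      fix \<omega> p assume "x = End \<omega>" "y = Pt p"
      then show ?thesis using sym[OF pe[of p \<omega>]] xy by auto
    next
      fix \<omega> \<omega>' assume "x = End \<omega>" "y = End \<omega>'"
      then show ?thesis using ee[of \<omega> \<omega>'] xy by auto
    qed
  qed
qed

section \<open>Ray pairs and the parametrisation of their circle\<close>

definition leads :: "(int \<Rightarrow> 'a) \<Rightarrow> bool" where
  "leads p \<longleftrightarrow> (\<exists>N. \<forall>i\<ge>N. p i \<in> A) \<and> (\<exists>N. \<forall>i\<le>N. p i \<notin> A)"

definition ray_pair :: "(int \<Rightarrow> 'a) \<Rightarrow> (int \<Rightarrow> 'a) \<Rightarrow> bool" where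
  "ray_pair p q \<longleftrightarrow> inj p \<and> inj q \<and> range p \<inter> range q = {} \<and> range p \<union> range q = verts G \<and>
     (\<forall>i. {p i, p (i + 1)} \<in> edges G) \<and> (\<forall>i. {q i, q (i + 1)} \<in> edges G) \<and> leads p \<and> leads q"

text \<open>An injective ray meets the finite set \<open>A - tail G A K\<close> only finitely
  often.\<close>

lemma eventually_tail:
  fixes p :: "int \<Rightarrow> 'a"
  assumes "inj p" "K \<in> finite_verts G" "\<forall>i\<ge>N. p i \<in> A"
  shows "\<exists>M. \<forall>i\<ge>M. p i \<in> tail G A K"
proof -
  have "finite {i. p i \<in> A - tail G A K}"
    using finite_vimageI[OF tail_finite[OF assms(2)] assms(1)] by (simp add: vimage_def)
  then have "bdd_above {i. p i \<in> A - tail G A K}" by (rule bdd_above_finite)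
  then obtain B where B: "i \<le> B" if "p i \<in> A - tail G A K" for i unfolding bdd_above_def by blast
  have "p i \<in> tail G A K" if i: "i \<ge> max N (B + 1)" for i
  proof (rule ccontr)
    assume "p i \<notin> tail G A K"
    moreover have "p i \<in> A" using assms(3) i by simp
    ultimately have "i \<le> B" using B by blast
    then show False using i by simp
  qed
  then show ?thesis by blast
qed

lemma leads_tails:
  assumes "inj p" "leads p" "range p \<subseteq> verts G" "K \<in> finite_verts G"
  shows "\<exists>M. \<forall>i\<ge>M. p i \<in> tail G A K" "\<exists>M. \<forall>i\<le>M. p i \<in> tail G (verts G - A) K"
proof -
  show "\<exists>M. \<forall>i\<ge>M. p i \<in> tail G A K"
    using assms(2) eventually_tail[OF assms(1,4)] unfolding leads_def by blast
  obtain N where "\<forall>i\<le>N. p i \<notin> A" using assms(2) unfolding leads_def by blast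
  then have N: "\<forall>i\<ge>- N. (p \<circ> uminus) i \<in> verts G - A" using assms(3) by auto
  have "inj (p \<circ> uminus)" using assms(1) by (intro inj_compose) (auto simp: inj_def)
  from two_sided_graph.eventually_tail[OF complement this assms(4) N]
  obtain M where M: "\<forall>i\<ge>M. (p \<circ> uminus) i \<in> tail G (verts G - A) K" by blast
  have "p i \<in> tail G (verts G - A) K" if "i \<le> - M" for i using M[rule_format, of "- i"] that by simp
  then show "\<exists>M. \<forall>i\<le>M. p i \<in> tail G (verts G - A) K" by blast
qed

text \<open>The cotangent \<open>Re z / \<bar>Im z\<bar>\<close> maps each open half circle onto the
  real line and serves as the time, on \<open>p\<close> above the real axis and on \<open>q\<close>
  below it. It tends to plus and minus infinity at \<open>1\<close> and \<open>-1\<close>, which are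
  sent to the two ends.\<close>

definition circle_param :: "(int \<Rightarrow> 'a) \<Rightarrow> (int \<Rightarrow> 'a) \<Rightarrow> complex \<Rightarrow> 'a fpoint" where
  "circle_param p q z = (if Im z = 0 then End (end_of (if Re z > 0 then A else verts G - A))
     else Pt (line_point (if Im z > 0 then p else q) (Re z / \<bar>Im z\<bar>)))"

text \<open>The sign of \<open>s\<close> selects the upper or the lower half plane.\<close>

lemma open_param_preimage:
  assumes e: "\<forall>i. {p i, p (i + 1)} \<in> edges G" and U: "openin (complex_topology G) U" and s: "s \<noteq> 0"
  shows "open {z. s * Im z > 0 \<and> line_point p (Re z / \<bar>Im z\<bar>) \<in> U}"
proof -
  have "open {t. line_point p t \<in> U}"
    using openin_continuous_map_preimage[OF continuous_map_line_point[OF simple e] U] by simp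
  moreover have "open {z. s * Im z > 0}" by (intro open_Collect_less continuous_intros)
  moreover have "continuous_on {z. s * Im z > 0} (\<lambda>z. Re z / \<bar>Im z\<bar>)"
    by (intro continuous_intros) auto
  ultimately have "open ({z. s * Im z > 0} \<inter> (\<lambda>z. Re z / \<bar>Im z\<bar>) -` {t. line_point p t \<in> U})"
    by (intro continuous_open_preimage)
  moreover have "{z. s * Im z > 0} \<inter> (\<lambda>z. Re z / \<bar>Im z\<bar>) -` {t. line_point p t \<in> U} =
      {z. s * Im z > 0 \<and> line_point p (Re z / \<bar>Im z\<bar>) \<in> U}" by auto
  ultimately show ?thesis by simp
qed

text \<open>The vertex at the integer part of the time always has a positive coordinate, and far out
  it belongs to the tail.\<close>

lemma leads_line_point:
  assumes "inj p" "leads p" "range p \<subseteq> verts G" "K \<in> finite_verts G"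
  shows "\<exists>M>0. \<forall>t>M. \<exists>x\<in>tail G A K. line_point p t x \<noteq> 0"
    "\<exists>M>0. \<forall>t. t < - M \<longrightarrow> (\<exists>x\<in>tail G (verts G - A) K. line_point p t x \<noteq> 0)"
proof -
  obtain M N where M: "\<forall>i\<ge>M. p i \<in> tail G A K" and N: "\<forall>i\<le>N. p i \<in> tail G (verts G - A) K"
    using leads_tails[OF assms] by blast
  have nz: "line_point p t (p \<lfloor>t\<rfloor>) \<noteq> 0" for t
    using line_point_floor_nonzero[OF assms(1), of t] frac_lt_1[of t] by simp
  have "\<exists>x\<in>tail G A K. line_point p t x \<noteq> 0" if "t > \<bar>of_int M\<bar> + 1" for t
  proof -
    have "M \<le> \<lfloor>t\<rfloor>" using that by (simp add: le_floor_iff)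
    then show ?thesis using M nz[of t] by blast
  qed
  then show "\<exists>M>0. \<forall>t>M. \<exists>x\<in>tail G A K. line_point p t x \<noteq> 0"
    by (intro exI[of _ "\<bar>of_int M\<bar> + 1"]) auto
  have "\<exists>x\<in>tail G (verts G - A) K. line_point p t x \<noteq> 0" if "t < - (\<bar>of_int N\<bar> + 1)" for t
  proof -
    have "\<lfloor>t\<rfloor> \<le> N" using that by (simp add: floor_le_iff)
    then show ?thesis using N nz[of t] by blast
  qed
  then show "\<exists>M>0. \<forall>t. t < - M \<longrightarrow> (\<exists>x\<in>tail G (verts G - A) K. line_point p t x \<noteq> 0)"
    by (intro exI[of _ "\<bar>of_int N\<bar> + 1"]) auto
qed

lemma ray_pairD:
  assumes "ray_pair p q"
  shows "inj p" "inj q" "range p \<inter> range q = {}" "range p \<union> range q = verts G"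
    "range p \<subseteq> verts G" "range q \<subseteq> verts G"
    "\<forall>i. {p i, p (i + 1)} \<in> edges G" "\<forall>i. {q i, q (i + 1)} \<in> edges G" "leads p" "leads q"
  using assms unfolding ray_pair_def by auto

lemma ray_pair_swap: "ray_pair p q \<Longrightarrow> ray_pair q p"
  unfolding ray_pair_def by blast

lemma circle_param_in:
  assumes "ray_pair p q"
  shows "circle_param p q z \<in> topspace (freudenthal G)"
  using line_point_in[OF simple ray_pairD(7)[OF assms]] line_point_in[OF simple ray_pairD(8)[OF assms]]
  by (auto simp: circle_param_def topspace_freudenthal[OF simple] ends_eq)

lemma openin_param_Pt:
  assumes rp: "ray_pair p q" and U: "openin (complex_topology G) U"
  shows "open {z. Im z \<noteq> 0 \<and> circle_param p q z \<in> Pt ` U}"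
proof -
  have "Im z \<noteq> 0 \<and> circle_param p q z \<in> Pt ` U \<longleftrightarrow>
     z \<in> {z. 1 * Im z > 0 \<and> line_point p (Re z / \<bar>Im z\<bar>) \<in> U} \<union> {z. (- 1) * Im z > 0 \<and> line_point q (Re z / \<bar>Im z\<bar>) \<in> U}" for z
  proof (cases "Im z" "0 :: real" rule: linorder_cases)
    case less
    then have "circle_param p q z = Pt (line_point q (Re z / \<bar>Im z\<bar>))" by (simp add: circle_param_def)
    then show ?thesis using less by (simp del: abs_of_neg)
  next
    case greater
    then have "circle_param p q z = Pt (line_point p (Re z / \<bar>Im z\<bar>))" by (simp add: circle_param_def)
    then show ?thesis using greater by (simp del: abs_of_pos)
  qed simp
  then have eq: "{z. Im z \<noteq> 0 \<and> circle_param p q z \<in> Pt ` U} =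
     {z. 1 * Im z > 0 \<and> line_point p (Re z / \<bar>Im z\<bar>) \<in> U} \<union> {z. (- 1) * Im z > 0 \<and> line_point q (Re z / \<bar>Im z\<bar>) \<in> U}"
    by blast
  show ?thesis
    unfolding eq using ray_pairD(7,8)[OF rp] U by (intro open_Un open_param_preimage) simp_all
qed

lemma continuous_map_circle_param:
  assumes rp: "ray_pair p q"
  shows "continuous_map (top_of_set (sphere 0 1)) (freudenthal G) (circle_param p q)"
proof (rule continuous_map_into_freudenthal)
  fix U assume "openin (complex_topology G) U"
  from openin_param_Pt[OF rp this]
  have "openin (top_of_set (sphere 0 1)) (sphere 0 1 \<inter> {z. Im z \<noteq> 0 \<and> circle_param p q z \<in> Pt ` U})" by (rule openin_open_Int)
  moreover have "sphere 0 1 \<inter> {z. Im z \<noteq> 0 \<and> circle_param p q z \<in> Pt ` U} =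
      {z \<in> topspace (top_of_set (sphere 0 1)). circle_param p q z \<in> Pt ` U}"
    by (auto simp: circle_param_def)
  ultimately show "openin (top_of_set (sphere 0 1)) {z \<in> topspace (top_of_set (sphere 0 1)). circle_param p q z \<in> Pt ` U}"
    by simp
next
  fix K \<omega> assume K: "K \<in> finite_verts G" and \<omega>: "\<omega> \<in> ends G"
  let ?U = "{r \<in> complex_points G. \<exists>x\<in>\<omega> K. r x \<noteq> 0}"
  let ?m = "circle_param p q"
  note pD = leads_line_point[OF ray_pairD(1,9,5)[OF rp] K] and qD = leads_line_point[OF ray_pairD(2,10,6)[OF rp] K]
  obtain M1 M2 where M: "M1 > 0" "M2 > 0"
    "\<And>t. t > M1 \<Longrightarrow> \<exists>x\<in>tail G A K. line_point p t x \<noteq> 0" "\<And>t. t > M2 \<Longrightarrow> \<exists>x\<in>tail G A K. line_point q t x \<noteq> 0"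
    using pD(1) qD(1) by blast
  obtain N1 N2 where N: "N1 > 0" "N2 > 0"
    "\<And>t. t < - N1 \<Longrightarrow> \<exists>x\<in>tail G (verts G - A) K. line_point p t x \<noteq> 0"
    "\<And>t. t < - N2 \<Longrightarrow> \<exists>x\<in>tail G (verts G - A) K. line_point q t x \<noteq> 0"
    using pD(2) qD(2) by blast
  define M where "M = max (max M1 M2) (max N1 N2)"
  have M0: "M > 0" using \<open>M1 > 0\<close> by (simp add: M_def)
  define E1 where "E1 = (if tail G A K = \<omega> K then {z. Re z > M * \<bar>Im z\<bar>} else {})"
  define E2 where "E2 = (if tail G (verts G - A) K = \<omega> K then {z. - Re z > M * \<bar>Im z\<bar>} else {})"
  have "open E1" "open E2"
    unfolding E1_def E2_def by (auto intro!: open_Collect_less continuous_intros)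
  moreover have "open {z. Im z \<noteq> 0 \<and> ?m z \<in> Pt ` ?U}"
    by (rule openin_param_Pt[OF rp openin_complex_meets[OF simple]])
  ultimately have "openin (top_of_set (sphere 0 1)) (sphere 0 1 \<inter> ({z. Im z \<noteq> 0 \<and> ?m z \<in> Pt ` ?U} \<union> E1 \<union> E2))"
    by (intro openin_open_Int open_Un)
  moreover have "sphere 0 1 \<inter> ({z. Im z \<noteq> 0 \<and> ?m z \<in> Pt ` ?U} \<union> E1 \<union> E2) =
      {z \<in> topspace (top_of_set (sphere 0 1)). ?m z \<in> end_nbhd G K \<omega>}"
  proof -
    have "z \<in> {z. Im z \<noteq> 0 \<and> ?m z \<in> Pt ` ?U} \<union> E1 \<union> E2 \<longleftrightarrow> ?m z \<in> end_nbhd G K \<omega>" if z: "z \<in> sphere 0 1" for z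
    proof (cases "Im z = 0")
      case True
      with z have "Re z \<noteq> 0" by (auto simp: cmod_def)
      then show ?thesis
        using True K ends_eq by (auto simp: circle_param_def End_in_end_nbhd E1_def E2_def)
    next
      case False
      then obtain r where r: "?m z = Pt r" "r = line_point (if Im z > 0 then p else q) (Re z / \<bar>Im z\<bar>)"
        by (simp add: circle_param_def)
      then have rc: "r \<in> complex_points G"
        using line_point_in[OF simple ray_pairD(7)[OF rp]] line_point_in[OF simple ray_pairD(8)[OF rp]] by simp
      have "\<exists>x\<in>\<omega> K. r x \<noteq> 0" if "z \<in> E1 \<union> E2"
      proof (cases "z \<in> E1")
        case True
        then have "Re z / \<bar>Im z\<bar> > M" "tail G A K = \<omega> K"
          using False by (auto simp: E1_def field_simps split: if_splits)
        then show ?thesis using M(3,4) unfolding r(2) M_def by auto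
      next
        case E1: False
        then have "- (Re z / \<bar>Im z\<bar>) > M" "tail G (verts G - A) K = \<omega> K"
          using False that by (auto simp: E2_def field_simps split: if_splits)
        then show ?thesis using N(3,4) unfolding r(2) M_def by auto
      qed
      then show ?thesis using r(1) rc False by (auto simp: Pt_in_end_nbhd)
    qed
    then show ?thesis unfolding topspace_euclidean_subtopology by blast
  qed
  ultimately show "openin (top_of_set (sphere 0 1)) {z \<in> topspace (top_of_set (sphere 0 1)). ?m z \<in> end_nbhd G K \<omega>}"
    by simp
qed (rule circle_param_in[OF rp])

text \<open>The norm and the cotangent together determine \<open>\<bar>Im z\<bar>\<close>, and the
  sign condition then determines \<open>Im z\<close>.\<close>

lemma unit_complex_eqI:
  assumes "norm z = 1" "norm w = 1" "Im z * Im w > 0" "Re z / \<bar>Im z\<bar> = Re w / \<bar>Im w\<bar>"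
  shows "z = w"
proof -
  define h where "h = Re z / \<bar>Im z\<bar>"
  have nz: "Im z \<noteq> 0" "Im w \<noteq> 0" using assms(3) by auto
  have re: "Re z = h * \<bar>Im z\<bar>" "Re w = h * \<bar>Im w\<bar>" using nz unfolding h_def by (simp, simp add: assms(4))
  have "(Re z)\<^sup>2 + (Im z)\<^sup>2 = 1" "(Re w)\<^sup>2 + (Im w)\<^sup>2 = 1" using assms(1,2) by (simp_all add: cmod_def)
  then have "(Im z)\<^sup>2 * (h\<^sup>2 + 1) = (Im w)\<^sup>2 * (h\<^sup>2 + 1)"
    unfolding re by (simp add: power_mult_distrib algebra_simps)
  moreover have "h\<^sup>2 + 1 \<noteq> 0" by (metis add_eq_0_iff neg_le_0_iff_le not_one_le_zero zero_le_power2)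
  ultimately have "(Im z)\<^sup>2 = (Im w)\<^sup>2" by simp
  then have "Im z = Im w \<or> Im z = - Im w" by (simp add: power2_eq_iff)
  then have "Im z = Im w" using assms(3) by (auto simp: mult_less_0_iff not_less[symmetric] zero_less_mult_iff)
  then show ?thesis using re by (simp add: complex_eq_iff)
qed

lemma line_point_disjoint:
  assumes "inj p" "range p \<inter> range q = {}"
  shows "line_point p s \<noteq> line_point q t"
proof
  assume eq: "line_point p s = line_point q t"
  have "line_point p s (p \<lfloor>s\<rfloor>) \<noteq> 0"
    using line_point_floor_nonzero[OF assms(1), of s] frac_lt_1[of s] by simp
  then have "p \<lfloor>s\<rfloor> \<in> range q" unfolding eq using line_point_support by fast
  then show False using assms(2) by blast
qed

lemma inj_circle_param:
  assumes rp: "ray_pair p q"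
  shows "inj_on (circle_param p q) (sphere 0 1)"
proof (rule inj_onI)
  fix z w assume zw: "z \<in> sphere 0 1" "w \<in> sphere 0 1" and eq: "circle_param p q z = circle_param p q w"
  have n: "norm z = 1" "norm w = 1" using zw by simp_all
  show "z = w"
  proof (cases "Im z = 0")
    case True
    then have "Im w = 0" using eq by (auto simp: circle_param_def split: if_splits)
    moreover have "Re z = 1 \<or> Re z = -1" "Re w = 1 \<or> Re w = -1"
      using n True \<open>Im w = 0\<close> by (auto simp: cmod_def abs_if split: if_splits)
    ultimately show ?thesis
      using True eq end_of_ne by (auto simp: circle_param_def complex_eq_iff)
  next
    case False
    then have w: "Im w \<noteq> 0" using eq by (auto simp: circle_param_def split: if_splits)
    have le: "line_point (if Im z > 0 then p else q) (Re z / \<bar>Im z\<bar>) = line_point (if Im w > 0 then p else q) (Re w / \<bar>Im w\<bar>)"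
      using eq False w by (simp add: circle_param_def)
    have same: "Im z > 0 \<longleftrightarrow> Im w > 0"
      using le line_point_disjoint[OF ray_pairD(1,3)[OF rp], of "Re z / \<bar>Im z\<bar>" "Re w / \<bar>Im w\<bar>"]
        line_point_disjoint[OF ray_pairD(1,3)[OF rp], of "Re w / \<bar>Im w\<bar>" "Re z / \<bar>Im z\<bar>"]
      by (auto split: if_splits)
    then have "Re z / \<bar>Im z\<bar> = Re w / \<bar>Im w\<bar>"
      using le line_point_inj[OF ray_pairD(1)[OF rp], of "Re z / \<bar>Im z\<bar>" "Re w / \<bar>Im w\<bar>"]
        line_point_inj[OF ray_pairD(2)[OF rp], of "Re z / \<bar>Im z\<bar>" "Re w / \<bar>Im w\<bar>"]
      by (cases "Im z > 0") simp_all
    moreover have "Im z * Im w > 0" using same False w by (simp add: zero_less_mult_iff) linarith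
    ultimately show ?thesis using unit_complex_eqI n by blast
  qed
qed

lemma image_circle_param:
  assumes rp: "ray_pair p q"
  shows "circle_param p q ` sphere 0 1 = circle_of G p q"
proof (intro equalityI subsetI)
  fix x assume "x \<in> circle_param p q ` sphere 0 1"
  then show "x \<in> circle_of G p q"
    unfolding circle_param_def circle_of_def ends_eq by (auto split: if_split_asm)
next
  fix x assume "x \<in> circle_of G p q"
  then consider t where "x = Pt (line_point p t)" | t where "x = Pt (line_point q t)"
    | "x = End (end_of A)" | "x = End (end_of (verts G - A))"
    by (auto simp: circle_of_def ends_eq)
  then show "x \<in> circle_param p q ` sphere 0 1"
  proof cases
    case (1 t)
    \<comment> \<open>The preimage is the point \<open>(t, 1)\<close> normalised to length one; its
      cotangent is \<open>t\<close>.\<close>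
    define s where "s = sqrt (t\<^sup>2 + 1)"
    have "t\<^sup>2 + 1 > 0" by (simp add: add_nonneg_pos)
    then have s: "s > 0" "s\<^sup>2 = t\<^sup>2 + 1" "t\<^sup>2 + 1 \<noteq> 0" by (simp_all add: s_def less_imp_neq[symmetric])
    have "norm (Complex (t / s) (1 / s)) = 1"
      using s by (simp add: complex_norm power_divide flip: add_divide_distrib)
    moreover have "circle_param p q (Complex (t / s) (1 / s)) = x" using s 1 by (simp add: circle_param_def)
    ultimately show ?thesis by (metis image_eqI mem_sphere_0)
  next
    case (2 t)
    define s where "s = sqrt (t\<^sup>2 + 1)"
    have "t\<^sup>2 + 1 > 0" by (simp add: add_nonneg_pos)
    then have s: "s > 0" "s\<^sup>2 = t\<^sup>2 + 1" "t\<^sup>2 + 1 \<noteq> 0" by (simp_all add: s_def less_imp_neq[symmetric])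
    have "norm (Complex (t / s) (- 1 / s)) = 1"
      using s by (simp add: complex_norm power_divide flip: add_divide_distrib)
    moreover have "circle_param p q (Complex (t / s) (- 1 / s)) = x" using s 2 by (simp add: circle_param_def)
    ultimately show ?thesis by (metis image_eqI mem_sphere_0)
  next
    case 3
    then have "circle_param p q 1 = x" by (simp add: circle_param_def)
    then show ?thesis by (intro image_eqI[of _ _ 1]) auto
  next
    case 4
    then have "circle_param p q (- 1) = x" by (simp add: circle_param_def)
    then show ?thesis by (intro image_eqI[of _ _ "- 1"]) auto
  qed
qed

text \<open>The parametrisation is a continuous injection of a compact space into a Hausdorff space,
  hence a homeomorphism onto its image.\<close>

theorem hamiltonian_circle_of:
  assumes rp: "ray_pair p q"
  shows "hamiltonian_circle G (circle_of G p q)"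
  unfolding hamiltonian_circle_def
proof (intro conjI ballI)
  show sub: "circle_of G p q \<subseteq> topspace (freudenthal G)"
    unfolding image_circle_param[OF rp, symmetric] using circle_param_in[OF rp] by (rule image_subsetI)
  have "homeomorphic_map (top_of_set (sphere 0 1)) (subtopology (freudenthal G) (circle_of G p q)) (circle_param p q)"
  proof (rule continuous_imp_homeomorphic_map)
    show "continuous_map (top_of_set (sphere 0 1)) (subtopology (freudenthal G) (circle_of G p q)) (circle_param p q)"
    proof -
      have "circle_param p q \<in> sphere 0 1 \<rightarrow> circle_of G p q"
        unfolding image_circle_param[OF rp, symmetric] by blast
      then show ?thesis
        using continuous_map_circle_param[OF rp] by (simp add: continuous_map_in_subtopology)
    qed
    show "compact_space (top_of_set (sphere (0::complex) 1))"
      by (simp add: compact_space_subtopology compact_sphere)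
    show "Hausdorff_space (subtopology (freudenthal G) (circle_of G p q))"
      by (rule Hausdorff_space_subtopology[OF Hausdorff_freudenthal])
    show "circle_param p q ` topspace (top_of_set (sphere 0 1)) = topspace (subtopology (freudenthal G) (circle_of G p q))"
      using image_circle_param[OF rp] sub by (auto simp: topspace_subtopology)
    show "inj_on (circle_param p q) (topspace (top_of_set (sphere 0 1)))"
      using inj_circle_param[OF rp] by simp
  qed
  then show "subtopology (freudenthal G) (circle_of G p q) homeomorphic_space top_of_set (sphere (0::complex) 1)"
    using homeomorphic_map_imp_homeomorphic_space homeomorphic_space_sym by blast
next
  fix v assume "v \<in> verts G"
  then obtain i where "v = p i \<or> v = q i" using ray_pairD(4)[OF rp] by blast
  moreover have "vertex_point (r i) \<in> range (line_point r)" for r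
    using line_point_of_int[of r i] by (metis rangeI)
  ultimately have "vertex_point v \<in> range (line_point p) \<union> range (line_point q)" by auto
  then show "Pt (vertex_point v) \<in> circle_of G p q" by (simp add: circle_of_def)
qed

end

section \<open>Hamiltonian circles are formed by pairs of rays\<close>

lemma sphere_minus_point:
  assumes b: "norm (b::complex) = 1"
  shows "sphere 0 1 - {b} = (\<lambda>t. - b * cis t) ` {- pi<..<pi}"
proof (intro equalityI subsetI)
  fix z assume "z \<in> sphere 0 1 - {b}"
  then have z: "norm z = 1" "z \<noteq> b" by auto
  define w where "w = - z / b"
  have b0: "b \<noteq> 0" using b by auto
  have w: "norm w = 1" "w \<noteq> -1" using z b b0 by (auto simp: w_def norm_divide)
  have "w \<noteq> 0" using w(1) by auto
  then have "cis (Arg w) = w" using w(1) cis_Arg[of w] by (simp add: sgn_div_norm)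
  moreover from this have "Arg w \<noteq> pi" using w(2) by auto
  moreover have "z = - b * w" using b0 by (simp add: w_def)
  ultimately show "z \<in> (\<lambda>t. - b * cis t) ` {- pi<..<pi}"
    using Arg_bounded[of w] by (intro image_eqI[of _ _ "Arg w"]) auto
next
  fix z assume "z \<in> (\<lambda>t. - b * cis t) ` {- pi<..<pi}"
  then obtain t where "z = - b * cis t" "t \<in> {- pi<..<pi}" by (rule imageE)
  then have t: "z = - b * cis t" "- pi < t" "t < pi" by simp_all
  have "cis t \<noteq> -1"
  proof
    assume "cis t = -1"
    then have "Arg (-1) = t" using Arg_unique'[of 1 t "-1"] t by (simp add: rcis_def)
    moreover have "Arg (-1) = pi" using Arg_unique'[of 1 pi "-1"] by (simp add: rcis_def)
    ultimately show False using t(3) by simp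
  qed
  have "z \<noteq> b"
  proof
    assume "z = b"
    with t(1) have "b * (cis t + 1) = 0" by algebra
    moreover have "b \<noteq> 0" using b by auto
    ultimately show False using \<open>cis t \<noteq> -1\<close> by (simp add: eq_neg_iff_add_eq_0)
  qed
  then show "z \<in> sphere 0 1 - {b}" using t b by (simp add: norm_mult)
qed

text \<open>The factor moves \<open>b\<close> to \<open>-1\<close>, on the branch cut of
  \<open>Arg\<close>, so that \<open>Arg\<close> is continuous on the remaining circle.\<close>

definition sphere_coord :: "complex \<Rightarrow> complex \<Rightarrow> real" where
  "sphere_coord b z = Arg (- z / b)"

lemma sphere_coord:
  assumes "norm b = 1" "- pi < t" "t < pi"
  shows "sphere_coord b (- b * cis t) = t"
proof -
  have "- (- b * cis t) / b = cis t" using assms(1) by auto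
  then show ?thesis
    unfolding sphere_coord_def using Arg_unique'[of 1 t] assms by (simp add: rcis_def)
qed

lemma inj_on_sphere_coord: "norm b = 1 \<Longrightarrow> inj_on (sphere_coord b) (sphere 0 1 - {b})"
  unfolding sphere_minus_point
proof (rule inj_onI, elim imageE)
  fix z w s t
  assume "norm b = 1" "s \<in> {- pi<..<pi}" "t \<in> {- pi<..<pi}" "z = - b * cis s" "w = - b * cis t"
    "sphere_coord b z = sphere_coord b w"
  then show "z = w" using sphere_coord[of b s] sphere_coord[of b t] by (simp del: mult_minus_left)
qed

lemma continuous_on_sphere_coord:
  assumes b: "norm b = 1"
  shows "continuous_on (sphere 0 1 - {b}) (sphere_coord b)"
  unfolding sphere_coord_def
proof (rule continuous_on_compose2[where g = Arg and f = "\<lambda>z. - z / b", OF _ _ order_refl])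
  show "continuous_on (sphere 0 1 - {b}) (\<lambda>z. - z / b)" using b by (intro continuous_intros) auto
  show "continuous_on ((\<lambda>z. - z / b) ` (sphere 0 1 - {b})) Arg"
  proof (rule continuous_at_imp_continuous_on, rule ballI)
    fix w assume "w \<in> (\<lambda>z. - z / b) ` (sphere 0 1 - {b})"
    then obtain z where "w = - z / b" "z \<in> sphere 0 1 - {b}" by (rule imageE)
    then have z: "w = - z / b" "norm z = 1" "z \<noteq> b" by simp_all
    then have "norm w = 1" "w \<noteq> -1" using b by (auto simp: norm_divide)
    then have "w \<notin> \<real>\<^sub>\<le>\<^sub>0" by (auto elim!: nonpos_Reals_cases)
    then show "isCont Arg w" by (rule continuous_at_Arg)
  qed
qed

lemma connected_sphere_minus_point:
  assumes "norm (b::complex) = 1" shows "connected (sphere 0 1 - {b})"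
  unfolding sphere_minus_point[OF assms]
  by (intro connected_continuous_image continuous_intros) (simp_all add: is_interval_connected is_interval_oo continuous_on_cis)

text \<open>In the coordinate of the circle without \<open>b\<close>, removing \<open>c\<close>
  splits an open interval at an inner point.\<close>

lemma sphere_minus_two_points:
  assumes b: "norm (b::complex) = 1" and c: "norm c = 1" "c \<noteq> b"
  shows "\<not> connected (sphere 0 1 - {b, c})"
    "\<exists>S T. connected S \<and> connected T \<and> sphere 0 1 - {b, c} = S \<union> T"
proof -
  have "c \<in> (\<lambda>t. - b * cis t) ` {- pi<..<pi}"
    using c unfolding sphere_minus_point[OF b, symmetric] by simp
  then obtain t where t: "- pi < t" "t < pi" "c = - b * cis t" by auto
  let ?\<psi> = "\<lambda>t. - b * cis t"
  have inj: "inj_on ?\<psi> {- pi<..<pi}"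
    by (rule inj_on_inverseI[where g = "sphere_coord b"]) (use sphere_coord[OF b] in auto)
  have "sphere 0 1 - {b, c} = ?\<psi> ` {- pi<..<pi} - {?\<psi> t}"
    using sphere_minus_point[OF b] t(3) by blast
  also have "\<dots> = ?\<psi> ` ({- pi<..<pi} - {t})"
    using inj_on_image_set_diff[OF inj, of "{- pi<..<pi}" "{t}"] t by simp
  also have "{- pi<..<pi} - {t} = {- pi<..<t} \<union> {t<..<pi}" using t by auto
  finally have eq: "sphere 0 1 - {b, c} = ?\<psi> ` {- pi<..<t} \<union> ?\<psi> ` {t<..<pi}" by (simp add: image_Un)
  show "\<exists>S T. connected S \<and> connected T \<and> sphere 0 1 - {b, c} = S \<union> T"
    unfolding eq
    by (intro exI[of _ "?\<psi> ` {- pi<..<t}"] exI[of _ "?\<psi> ` {t<..<pi}"] conjI refl connected_continuous_image continuous_intros)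
      (simp_all add: is_interval_connected is_interval_oo continuous_on_cis)
  show "\<not> connected (sphere 0 1 - {b, c})"
  proof
    assume "connected (sphere 0 1 - {b, c})"
    then have "connected (sphere_coord b ` (sphere 0 1 - {b, c}))"
      by (rule connected_continuous_image[rotated])
        (rule continuous_on_subset[OF continuous_on_sphere_coord[OF b]], blast)
    moreover have "sphere_coord b ` (sphere 0 1 - {b, c}) = {- pi<..<t} \<union> {t<..<pi}"
      unfolding eq image_Un image_image using sphere_coord[OF b] t by (auto simp: image_iff)
    ultimately have conn: "connected ({- pi<..<t} \<union> {t<..<pi})" by simp
    obtain x y where "- pi < x" "x < t" "t < y" "y < pi" using dense t by metis
    then have "t \<in> {- pi<..<t} \<union> {t<..<pi}"
      using connectedD_interval[OF conn, of x y t] by auto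
    then show False by simp
  qed
qed

text \<open>These are the topological properties of a circle on which the analysis of
  \<open>C\<close> rests. Connectedness after one puncture bounds degrees from below, the injection
  into the line bounds them from above; the two facts on pairs of points, applied to the ends, show
  that there are exactly two lines.\<close>

lemma circle_space_facts:
  assumes hom: "subtopology T C homeomorphic_space top_of_set (sphere (0::complex) 1)" and C: "C \<subseteq> topspace T"
  shows "a \<in> C \<Longrightarrow> connectedin T (C - {a})"
    "a \<in> C \<Longrightarrow> \<exists>\<phi>. continuous_map (subtopology T (C - {a})) euclideanreal \<phi> \<and> inj_on \<phi> (C - {a})"
    "a \<in> C \<Longrightarrow> b \<in> C \<Longrightarrow> a \<noteq> b \<Longrightarrow> \<not> connectedin T (C - {a, b})"
    "a \<in> C \<Longrightarrow> b \<in> C \<Longrightarrow> a \<noteq> b \<Longrightarrow>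
      \<exists>D E. connectedin T D \<and> connectedin T E \<and> C - {a, b} = D \<union> E"
    "compactin T C" "connectedin T C"
proof -
  obtain f where f: "homeomorphic_map (subtopology T C) (top_of_set (sphere (0::complex) 1)) f"
    using hom homeomorphic_space by blast
  have top: "topspace (subtopology T C) = C" using C by auto
  have inj: "inj_on f C" and im: "f ` C = sphere 0 1"
    using f top unfolding homeomorphic_eq_everything_map by auto
  have conn: "connectedin T U \<longleftrightarrow> connected (f ` U)" if "U \<subseteq> C" for U
  proof -
    have "f ` U \<subseteq> sphere 0 1" "U \<subseteq> topspace T" using that im C by blast+
    then show ?thesis
      using homeomorphic_map_connectedness[OF f, of U] that top
      by (simp add: connectedin_subtopology connectedin_iff_connected)
  qed
  have norm: "norm (f x) = 1" if "x \<in> C" for x using im that by auto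
  have im1: "f ` (C - {a}) = sphere 0 1 - {f a}" if "a \<in> C" for a
    using inj_on_image_set_diff[OF inj, of C "{a}"] im that by auto
  have im2: "f ` (C - {a, b}) = sphere 0 1 - {f a, f b}" if "a \<in> C" "b \<in> C" for a b
    using inj_on_image_set_diff[OF inj, of C "{a, b}"] im that by auto
  show "connectedin T (C - {a})" if "a \<in> C"
    using conn[of "C - {a}"] im1[OF that] connected_sphere_minus_point[OF norm[OF that]] by auto
  show "connectedin T C" using conn[of C] im connected_sphere[of "0::complex" 1] by simp
  show "\<exists>\<phi>. continuous_map (subtopology T (C - {a})) euclideanreal \<phi> \<and> inj_on \<phi> (C - {a})" if "a \<in> C"
  proof (intro exI[of _ "sphere_coord (f a) \<circ> f"] conjI)
    have "continuous_map (subtopology T C) (top_of_set (sphere 0 1)) f"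
      using f homeomorphic_imp_continuous_map by blast
    then have "continuous_map (subtopology T (C - {a})) euclidean f"
      using continuous_map_from_subtopology_mono[of T C euclidean f "C - {a}"] continuous_map_in_subtopology by blast
    then have "continuous_map (subtopology T (C - {a})) (top_of_set (sphere 0 1 - {f a})) f"
      using im1[OF that] C by (auto simp: continuous_map_in_subtopology)
    then show "continuous_map (subtopology T (C - {a})) euclideanreal (sphere_coord (f a) \<circ> f)"
      using continuous_on_sphere_coord[OF norm[OF that]]
      by (intro continuous_map_compose[of _ "top_of_set (sphere 0 1 - {f a})"]) auto
    show "inj_on (sphere_coord (f a) \<circ> f) (C - {a})"
      by (rule comp_inj_on) (use inj inj_on_sphere_coord[OF norm[OF that]] im1[OF that] in \<open>auto intro: inj_on_subset\<close>)
  qed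
  show "\<not> connectedin T (C - {a, b})" if "a \<in> C" "b \<in> C" "a \<noteq> b"
    using conn[of "C - {a, b}"] im2[OF that(1,2)] sphere_minus_two_points(1)[OF norm[OF that(1)] norm[OF that(2)]] that inj
    by (auto simp: inj_on_eq_iff)
  show "\<exists>D E. connectedin T D \<and> connectedin T E \<and> C - {a, b} = D \<union> E" if ab: "a \<in> C" "b \<in> C" "a \<noteq> b"
  proof -
    have "f b \<noteq> f a" using ab inj by (auto simp: inj_on_eq_iff)
    from sphere_minus_two_points(2)[OF norm[OF ab(1)] norm[OF ab(2)] this]
    obtain S R where SR: "connected S" "connected R" "f ` (C - {a, b}) = S \<union> R" unfolding im2[OF ab(1,2)] by blast
    let ?D = "{x \<in> C - {a, b}. f x \<in> S}" and ?E = "{x \<in> C - {a, b}. f x \<in> R}"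
    have "f ` {x \<in> C - {a, b}. f x \<in> S'} = S'" if "S' \<subseteq> f ` (C - {a, b})" for S'
      using that by (auto simp: image_iff)
    then have "f ` ?D = S" "f ` ?E = R" using SR(3) by simp_all
    then have "connectedin T ?D" "connectedin T ?E" using SR conn[of ?D] conn[of ?E] by auto
    moreover have "C - {a, b} = ?D \<union> ?E" using SR(3) by blast
    ultimately show ?thesis by blast
  qed
  have "compact_space (subtopology T C)"
    using hom homeomorphic_compact_space compact_space_subtopology[of euclidean "sphere (0::complex) 1"] by auto
  then show "compactin T C" using C by (simp add: compactin_subspace)
qed

lemma connectedin_separation:
  assumes "connectedin T X" "openin T U" "openin T V" "X \<subseteq> U \<union> V" "U \<inter> V \<inter> X = {}" "U \<inter> X \<noteq> {}"
  shows "V \<inter> X = {}"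
  using assms unfolding connectedin by blast

text \<open>The arc with the higher endpoint passes, at a positive time, through the endpoint of the
  other one.\<close>

lemma arcs_meet:
  fixes \<gamma> \<delta> :: "real \<Rightarrow> real"
  assumes "continuous_on {0..h} \<gamma>" "continuous_on {0..h} \<delta>" "0 < h" "\<gamma> 0 = c" "\<delta> 0 = c" "c < \<gamma> h" "c < \<delta> h"
  shows "\<exists>s\<in>{0<..h}. \<exists>t\<in>{0<..h}. \<gamma> s = \<delta> t"
proof (cases "\<gamma> h \<le> \<delta> h")
  case True
  then obtain t where t: "0 \<le> t" "t \<le> h" "\<delta> t = \<gamma> h"
    using IVT'[of \<delta> 0 "\<gamma> h" h] assms by auto
  then have "t \<noteq> 0" using assms by auto
  then show ?thesis using t assms(3) by (intro bexI[of _ h] bexI[of _ t]) auto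
next
  case False
  then obtain t where t: "0 \<le> t" "t \<le> h" "\<gamma> t = \<delta> h"
    using IVT'[of \<gamma> 0 "\<delta> h" h] assms by auto
  then have "t \<noteq> 0" using assms by auto
  then show ?thesis using t assms(3) by (intro bexI[of _ t] bexI[of _ h]) auto
qed

text \<open>Two of the three arcs end on the same side of \<open>x\<close>, and these two must
  meet.\<close>

lemma no_real_triod:
  fixes \<gamma> :: "'i \<Rightarrow> real \<Rightarrow> real"
  assumes cont: "\<And>i. i \<in> {a, b, c} \<Longrightarrow> continuous_on {0..h} (\<gamma> i)" and h: "0 < h"
    and start: "\<And>i. i \<in> {a, b, c} \<Longrightarrow> \<gamma> i 0 = x" and end_ne: "\<And>i. i \<in> {a, b, c} \<Longrightarrow> \<gamma> i h \<noteq> x"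
    and disj: "\<And>i j s t. i \<in> {a, b, c} \<Longrightarrow> j \<in> {a, b, c} \<Longrightarrow> i \<noteq> j \<Longrightarrow> s \<in> {0<..h} \<Longrightarrow> t \<in> {0<..h} \<Longrightarrow> \<gamma> i s \<noteq> \<gamma> j t"
    and ne: "a \<noteq> b" "b \<noteq> c" "a \<noteq> c"
  shows False
proof -
  have up: "\<not> (x < \<gamma> i h \<and> x < \<gamma> j h)" if "i \<in> {a, b, c}" "j \<in> {a, b, c}" "i \<noteq> j" for i j
    using arcs_meet[OF cont[OF that(1)] cont[OF that(2)] h start[OF that(1)] start[OF that(2)]] disj[OF that] by blast
  have down: "\<not> (\<gamma> i h < x \<and> \<gamma> j h < x)" if "i \<in> {a, b, c}" "j \<in> {a, b, c}" "i \<noteq> j" for i j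
    using arcs_meet[of h "\<lambda>t. - \<gamma> i t" "\<lambda>t. - \<gamma> j t" "- x"] cont[OF that(1)] cont[OF that(2)] h
      start[OF that(1)] start[OF that(2)] disj[OF that] by (auto intro: continuous_intros)
  have "x < \<gamma> i h \<or> \<gamma> i h < x" if "i \<in> {a, b, c}" for i using end_ne[OF that] by linarith
  from this[of a] this[of b] this[of c] up[of a b] up[of b c] up[of a c] down[of a b] down[of b c] down[of a c] ne
  show False by auto
qed

section \<open>Lines in 2-regular graphs\<close>

lemma two_regular_walk:
  assumes reg0: "\<forall>v\<in>V. \<exists>a b. a \<noteq> b \<and> {w. E v w} = {a, b}" and V0: "\<forall>v w. E v w \<longrightarrow> w \<in> V"
    and sym0: "\<forall>v w. E v w \<longrightarrow> E w v" and xy: "E x y"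
  shows "\<exists>w. w 0 = x \<and> w (Suc 0) = y \<and> (\<forall>n. E (w n) (w (Suc n)) \<and> w n \<noteq> w (Suc (Suc n)))"
proof -
  note reg = reg0[rule_format] and V = V0[rule_format] and sym = sym0[rule_format]
  have ex: "\<exists>w. E v w \<and> w \<noteq> u" if uv: "E u v" for u v
  proof -
    obtain a b where "a \<noteq> b" "{w. E v w} = {a, b}" using reg[OF V[OF uv]] by blast
    then show ?thesis by (metis insertCI mem_Collect_eq)
  qed
  \<comment> \<open>The walk arriving at \<open>v\<close> from \<open>u\<close> continues to the
    neighbour of \<open>v\<close> different from \<open>u\<close>.\<close>
  define other where "other = (\<lambda>u v. SOME w. E v w \<and> w \<noteq> u)"
  have other: "E v (other u v)" "other u v \<noteq> u" if "E u v" for u v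
    using someI_ex[OF ex[OF that]] unfolding other_def by blast+
  define arc where "arc = (\<lambda>n. ((\<lambda>(u, v). (v, other u v)) ^^ n) (x, y))"
  have arc_Suc: "arc (Suc n) = (snd (arc n), other (fst (arc n)) (snd (arc n)))" for n
    by (simp add: arc_def split: prod.split)
  have E: "E (fst (arc n)) (snd (arc n))" for n
  proof (induction n)
    case 0 then show ?case using xy by (simp add: arc_def)
  next
    case (Suc n) then show ?case using other(1) by (simp add: arc_Suc)
  qed
  have "fst (arc n) \<noteq> fst (arc (Suc (Suc n)))" for n
    using other(2)[OF E[of n]] by (simp add: arc_Suc)
  then show ?thesis
    using E by (intro exI[of _ "\<lambda>n. fst (arc n)"]) (auto simp: arc_Suc, simp_all add: arc_def)
qed

text \<open>Two walks leaving \<open>x\<close> through its two neighbours are glued at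
  \<open>x\<close>; there is no backtracking at the joint because the neighbours differ.\<close>

lemma two_regular_line:
  assumes reg0: "\<forall>v\<in>V. \<exists>a b. a \<noteq> b \<and> {w. E v w} = {a, b}" and V0: "\<forall>v w. E v w \<longrightarrow> w \<in> V"
    and sym0: "\<forall>v w. E v w \<longrightarrow> E w v" and x: "x \<in> V"
  shows "\<exists>p :: int \<Rightarrow> 'a. p 0 = x \<and> (\<forall>i. E (p i) (p (i + 1)) \<and> p (i - 1) \<noteq> p (i + 1))"
proof -
  note reg = reg0[rule_format] and V = V0[rule_format] and sym = sym0[rule_format]
  obtain a b where ab: "a \<noteq> b" "{w. E x w} = {a, b}" using reg[OF x] by blast
  then have "E x a" "E x b" by auto
  obtain f where f: "f 0 = x" "f (Suc 0) = a" "\<And>n. E (f n) (f (Suc n))" "\<And>n. f n \<noteq> f (Suc (Suc n))"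
    using two_regular_walk[OF reg0 V0 sym0 \<open>E x a\<close>] by blast
  obtain g where g: "g 0 = x" "g (Suc 0) = b" "\<And>n. E (g n) (g (Suc n))" "\<And>n. g n \<noteq> g (Suc (Suc n))"
    using two_regular_walk[OF reg0 V0 sym0 \<open>E x b\<close>] by blast
  define p where "p = (\<lambda>i::int. if i \<ge> 0 then f (nat i) else g (nat (- i)))"
  have "E (p i) (p (i + 1)) \<and> p (i - 1) \<noteq> p (i + 1)" for i
  proof (cases "i" "0 :: int" rule: linorder_cases)
    case greater
    then obtain n where "i = 1 + int n" using zle_iff_zadd[of 1 i] by auto
    then have "nat i = Suc n" "nat (i - 1) = n" "nat (i + 1) = Suc (Suc n)" "i - 1 \<ge> 0" "i \<ge> 0" by auto
    then show ?thesis using f(3)[of "Suc n"] f(4)[of n] by (simp add: p_def)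
  next
    case equal
    then show ?thesis using f g ab \<open>E x a\<close> by (auto simp: p_def)
  next
    case less
    then obtain n where "- i = 1 + int n" using zle_iff_zadd[of 1 "- i"] by auto
    then have n: "nat (- i) = Suc n" "nat (- (i + 1)) = n" "nat (- (i - 1)) = Suc (Suc n)" by auto
    have "p (i + 1) = g n" using n(2) less f(1) g(1) by (cases "i = -1") (auto simp: p_def)
    moreover have "p i = g (Suc n)" "p (i - 1) = g (Suc (Suc n))" using n less by (simp_all add: p_def)
    ultimately show ?thesis using sym[OF g(3)[of n]] g(4)[of n] by metis
  qed
  then show ?thesis using f(1) by (intro exI[of _ p]) (simp add: p_def)
qed

lemma two_regular_line_neighbours:
  assumes reg0: "\<forall>v\<in>V. \<exists>a b. a \<noteq> b \<and> {w. E v w} = {a, b}" and V0: "\<forall>v w. E v w \<longrightarrow> w \<in> V"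
    and sym0: "\<forall>v w. E v w \<longrightarrow> E w v" and p: "\<forall>i. E (p i) (p (i + 1)) \<and> p (i - 1) \<noteq> p (i + 1)"
  shows "{w. E (p i) w} = {p (i - 1), p (i + 1 :: int)}"
proof -
  note reg = reg0[rule_format] and V = V0[rule_format] and sym = sym0[rule_format]
  have e: "E (p i) (p (i + 1))" "E (p i) (p (i - 1))" "p (i - 1) \<noteq> p (i + 1)"
    using p[rule_format, of i] sym[of "p (i - 1)" "p i"] p[rule_format, of "i - 1"] by auto
  moreover have "p i \<in> V" using V[OF sym[OF e(1)]] .
  ultimately obtain a b where ab: "{w. E (p i) w} = {a, b}" using reg by blast
  have "p (i + 1) \<in> {a, b}" "p (i - 1) \<in> {a, b}" unfolding ab[symmetric] using e by simp_all
  then show ?thesis unfolding ab using e(3) by auto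
qed

text \<open>If \<open>p i = p j\<close>, the neighbour sets at both places agree, so the walk
  continues there either in parallel or mirrored. In parallel it is periodic. Mirrored, the two
  branches meet halfway: in a backtrack if \<open>j - i\<close> is even, in a loop if it is
  odd.\<close>

lemma two_regular_line_cases:
  assumes nb: "\<And>i. {w. E (p i) w} = {p (i - 1), p (i + 1 :: int)}" and ne: "\<And>i. p (i - 1) \<noteq> p (i + 1)"
    and irr: "\<And>v. \<not> E v v"
  shows "inj p \<or> finite (range p)"
proof (rule disjCI)
  assume "infinite (range p)"
  show "inj p"
  proof (rule ccontr)
    assume "\<not> inj p"
    then obtain i j where ij: "i < j" "p i = p j" unfolding inj_def by (metis linorder_neqE)
    then have eq: "{p (i - 1), p (i + 1)} = {p (j - 1), p (j + 1)}" using nb by metis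
    show False
    proof (cases "p (i + 1) = p (j + 1)")
      case True
      define d where "d = j - i"
      have fwd: "p (i + int n) = p (i + int n + d) \<and> p (i + int n + 1) = p (i + int n + 1 + d)" for n
      proof (induction n)
        case 0 then show ?case using ij True by (simp add: d_def algebra_simps)
      next
        case (Suc n)
        let ?k = "i + int n + 1"
        have "{p (?k - 1), p (?k + 1)} = {p (?k + d - 1), p (?k + d + 1)}" using nb[of ?k] nb[of "?k + d"] Suc by metis
        moreover have "p (?k - 1) = p (?k + d - 1)" using Suc by (simp add: algebra_simps)
        ultimately have "p (?k + 1) = p (?k + d + 1)" using ne[of ?k] ne[of "?k + d"] by (metis doubleton_eq_iff)
        then show ?case using Suc by (simp add: algebra_simps)
      qed
      have bwd: "p (i - int n) = p (i - int n + d) \<and> p (i - int n + 1) = p (i - int n + 1 + d)" for n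
      proof (induction n)
        case 0 then show ?case using ij True by (simp add: d_def algebra_simps)
      next
        case (Suc n)
        let ?k = "i - int n"
        have "{p (?k - 1), p (?k + 1)} = {p (?k + d - 1), p (?k + d + 1)}" using nb[of ?k] nb[of "?k + d"] Suc by metis
        moreover have "p (?k + 1) = p (?k + d + 1)" using Suc by (simp add: algebra_simps)
        ultimately have "p (?k - 1) = p (?k + d - 1)" using ne[of ?k] ne[of "?k + d"] by (metis doubleton_eq_iff)
        then show ?case using Suc by (simp add: algebra_simps)
      qed
      have per: "p (k + d) = p k" for k
        using fwd[of "nat (k - i)"] bwd[of "nat (i - k)"] by (cases "k \<ge> i") auto
      have per': "p (k + d * m) = p k" for k m
      proof (induction m rule: int_induct[where k = 0])
        case (step1 m) then show ?case using per[of "k + d * m"] by (simp add: algebra_simps)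
      next
        case (step2 m) then show ?case using per[of "k + d * (m - 1)"] by (simp add: algebra_simps)
      qed simp
      have "p k \<in> p ` {0..<d}" for k
        using per'[of "k mod d" "k div d"] ij(1) by (intro image_eqI[of _ _ "k mod d"]) (auto simp: d_def)
      then have "range p \<subseteq> p ` {0..<d}" by blast
      then show False using \<open>infinite (range p)\<close> finite_subset by blast
    next
      case False
      then have "p (i + 1) = p (j - 1)" using eq by (metis doubleton_eq_iff)
      have refl: "p (i + int n) = p (j - int n) \<and> p (i + int n + 1) = p (j - int n - 1)" for n
      proof (induction n)
        case 0 then show ?case using ij \<open>p (i + 1) = p (j - 1)\<close> by simp
      next
        case (Suc n)
        let ?k = "i + int n + 1" and ?l = "j - int n - 1"
        have "{p (?k - 1), p (?k + 1)} = {p (?l - 1), p (?l + 1)}" using nb[of ?k] nb[of ?l] Suc by metis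
        moreover have "p (?k - 1) = p (?l + 1)" using Suc by (simp add: algebra_simps)
        ultimately have "p (?k + 1) = p (?l - 1)" using ne[of ?k] ne[of ?l] by (metis doubleton_eq_iff)
        then show ?case using Suc by (simp add: algebra_simps)
      qed
      show False
      proof (cases "even (j - i)")
        case True
        then obtain m where "j - i = 2 * m" by (rule evenE)
        then have m: "j = i + 2 * m" by simp
        define n where "n = nat (m - 1)"
        have "m = int n + 1" using m ij(1) by (simp add: n_def)
        then have "j - int n = i + int n + 1 + 1" using m by simp
        then have "p (i + int n + 1 - 1) = p (i + int n + 1 + 1)"
          using conjunct1[OF refl[of n]] by (simp add: ac_simps)
        then show False using ne by blast
      next
        case False
        then obtain m where "j - i = 2 * m + 1" by (rule oddE)
        then have m: "j = i + 2 * m + 1" by simp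
        define n where "n = nat m"
        have "int n = m" using m ij(1) by (simp add: n_def)
        then have "p (i + m) = p (i + m + 1)" using conjunct1[OF refl[of n]] m by (simp add: algebra_simps)
        then show False using nb[of "i + m"] irr[of "p (i + m)"] by blast
      qed
    qed
  qed
qed

context two_sided_graph
begin

text \<open>Induction over the generation of the topology. The basic sets at the end are directed:
  those for \<open>K\<close> and \<open>L\<close> contain the one for their union, since tails
  shrink when more vertices are deleted.\<close>

lemma end_nbhd_base:
  assumes "openin (freudenthal G) W" "End (end_of A) \<in> W"
  shows "\<exists>K\<in>finite_verts G. end_nbhd G K (end_of A) \<subseteq> W"
proof -
  have "generate_topology_on ({Pt ` U | U. openin (complex_topology G) U} \<union>
      {end_nbhd G K \<omega> | K \<omega>. finite K \<and> K \<subseteq> verts G \<and> \<omega> \<in> ends G}) W"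
    using assms(1) unfolding freudenthal_def openin_topology_generated_by_iff .
  then show ?thesis using assms(2)
  proof induction
    case Empty
    then show ?case by simp
  next
    case (Int a b)
    then obtain K L where K: "K \<in> finite_verts G" "end_nbhd G K (end_of A) \<subseteq> a"
      and L: "L \<in> finite_verts G" "end_nbhd G L (end_of A) \<subseteq> b" by blast
    have KL: "K \<union> L \<in> finite_verts G" using K(1) L(1) by (auto simp: finite_verts_def)
    have "end_nbhd G (K \<union> L) (end_of A) \<subseteq> end_nbhd G M (end_of A)" if M: "M \<in> finite_verts G" "M \<subseteq> K \<union> L" for M
    proof
      fix x assume x: "x \<in> end_nbhd G (K \<union> L) (end_of A)"
      have sub: "tail G A (K \<union> L) \<subseteq> tail G A M" by (rule tail_mono[OF M(1) KL M(2)])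
      show "x \<in> end_nbhd G M (end_of A)"
      proof (cases x)
        case (Pt p)
        then show ?thesis using x sub M(1) KL by (auto simp: Pt_in_end_nbhd)
      next
        case (End \<omega>)
        then have w: "\<omega> \<in> ends G" "\<omega> (K \<union> L) = tail G A (K \<union> L)"
          using x KL by (auto simp: End_in_end_nbhd)
        then have "\<omega> (K \<union> L) \<subseteq> \<omega> M" using KL M(2) unfolding ends_def finite_verts_def by blast
        then have "\<omega> M \<inter> tail G A M \<noteq> {}" using sub w(2) tail_nonempty[OF KL] by blast
        then have "\<omega> M = tail G A M"
          using components_disjoint[OF end_component[OF w(1) M(1)] tail_component[OF M(1)]] by blast
        then show ?thesis using End w(1) M(1) by (simp add: End_in_end_nbhd)
      qed
    qed
    from this[OF K(1)] this[OF L(1)] K(2) L(2) KL show ?case by blast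
  next
    case (UN \<K>)
    then show ?case by blast
  next
    case (Basis s)
    then obtain K \<omega> where K: "K \<in> finite_verts G" "s = end_nbhd G K \<omega>" by (auto simp: finite_verts_def)
    then have "end_nbhd G K (end_of A) = end_nbhd G K \<omega>"
      using Basis(2) by (auto simp: end_nbhd_def)
    then show ?case using K by blast
  qed
qed

end

section \<open>The 2-factor traced by a Hamiltonian circle\<close>

locale circle_in_graph = two_sided_graph +
  fixes C :: "'a fpoint set"
  assumes ham: "hamiltonian_circle G C"
begin

abbreviation T where "T \<equiv> freudenthal G"

lemma C_top: "C \<subseteq> topspace T"
  and C_homeo: "subtopology T C homeomorphic_space top_of_set (sphere (0::complex) 1)"
  and C_verts: "v \<in> verts G \<Longrightarrow> Pt (vertex_point v) \<in> C"
  using ham unfolding hamiltonian_circle_def by blast+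

lemmas C_facts = circle_space_facts[OF C_homeo C_top]

lemma closedin_C: "closedin T C"
  by (rule compactin_imp_closedin[OF Hausdorff_freudenthal C_facts(5)])

lemma Pt_in_C: "Pt p \<in> C \<Longrightarrow> p \<in> complex_points G"
  using C_top unfolding topspace_freudenthal[OF simple] by auto

lemma infinite_verts: "infinite (verts G)"
  using side(1,2) finite_subset by blast

lemma compactin_edge:
  assumes "{u, v} \<in> edges G" "0 \<le> a" "b \<le> 1"
  shows "compactin T (Pt ` edge_point u v ` {a..b})"
proof -
  have "continuous_map (top_of_set {0..1}) T (Pt \<circ> edge_point u v)"
    by (rule continuous_map_compose[OF continuous_map_edge_point[OF simple assms(1)] continuous_map_Pt[OF simple]])
  moreover have "compactin (top_of_set {0..1}) {a..b}"
    using assms(2,3) by (auto simp: compactin_subtopology)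
  ultimately have "compactin T ((Pt \<circ> edge_point u v) ` {a..b})"
    by (rule image_compactin[rotated])
  then show ?thesis by (simp add: image_comp)
qed

text \<open>If the point at \<open>s\<close> were missing, then in \<open>C\<close> punctured at
  \<open>v\<close> the part of the edge beyond \<open>s\<close> would be open and closed and
  nonempty, although \<open>u\<close> lies outside it.\<close>

lemma edge_in_C_upper:
  assumes e: "{u, v} \<in> edges G" and st: "0 < s" "s < t" "t < 1" and t: "Pt (edge_point u v t) \<in> C"
  shows "Pt (edge_point u v s) \<in> C"
proof (rule ccontr)
  assume s: "Pt (edge_point u v s) \<notin> C"
  note uv = edge_verts[OF simple e]
  define X where "X = C - {Pt (vertex_point v)}"
  \<comment> \<open>\<open>U\<close> is the open segment from \<open>s\<close> to \<open>v\<close>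
    and \<open>E\<close> is the closed one. Their difference consists of two points that are not in
    \<open>X\<close>, so \<open>U\<close> and the complement of \<open>E\<close> separate
    \<open>X\<close>.\<close>
  define U where "U = {p \<in> complex_points G. p u > 0} \<inter> {p \<in> complex_points G. p v > s}"
  define E where "E = Pt ` edge_point u v ` {s..1}"
  have "connectedin T X" unfolding X_def by (rule C_facts(1)[OF C_verts[OF uv(2)]])
  moreover have "openin T (Pt ` U)"
    unfolding U_def by (intro openin_Pt openin_Int openin_complex_gt[OF simple])
  moreover have "openin T (topspace T - E)"
    unfolding E_def using st(1)
    by (intro openin_diff openin_topspace compactin_imp_closedin[OF Hausdorff_freudenthal] compactin_edge[OF e]) auto
  moreover have "X \<subseteq> Pt ` U \<union> (topspace T - E)"
  proof
    fix x assume x: "x \<in> X"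
    show "x \<in> Pt ` U \<union> (topspace T - E)"
    proof (cases "x \<in> E")
      case True
      then obtain r where r: "x = Pt (edge_point u v r)" "s \<le> r" "r \<le> 1" by (auto simp: E_def)
      moreover have "r \<noteq> s" "r \<noteq> 1" using x s r(1) by (auto simp: X_def edge_point_simps)
      moreover have "edge_point u v r \<in> complex_points G" using x Pt_in_C r(1) by (simp add: X_def)
      ultimately have "edge_point u v r \<in> U" using uv by (simp add: U_def edge_point_simps)
      then show ?thesis using r(1) by simp
    next
      case False
      then show ?thesis using x C_top by (auto simp: X_def)
    qed
  qed
  moreover have "Pt ` U \<inter> (topspace T - E) \<inter> X = {}"
  proof -
    have "Pt p \<in> E" if p: "p \<in> U" for p
    proof -
      have pc: "p \<in> complex_points G" "p u > 0" "p v > s" using p by (auto simp: U_def)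
      then have "p = edge_point u v (p v)"
        using complex_point_support(2)[OF simple pc(1), of u v] st(1) uv(3) by simp
      moreover have "p v \<le> 1" using complex_points_le_1(2)[OF simple pc(1)] .
      ultimately show ?thesis using pc(3) unfolding E_def by (intro imageI image_eqI[of p _ "p v"]) auto
    qed
    then show ?thesis by blast
  qed
  moreover have "Pt ` U \<inter> X \<noteq> {}"
  proof -
    have "edge_point u v t \<in> U" using Pt_in_C[OF t] uv st by (simp add: U_def edge_point_simps)
    moreover have "edge_point u v t \<noteq> vertex_point v"
    proof
      assume "edge_point u v t = vertex_point v"
      then have "edge_point u v t v = 1" by (simp add: vertex_point_def)
      then show False using uv st by (simp add: edge_point_simps)
    qed
    ultimately show ?thesis using t by (auto simp: X_def)
  qed
  ultimately have "(topspace T - E) \<inter> X = {}" by (rule connectedin_separation)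
  moreover have "Pt (vertex_point u) \<in> X" using C_verts[OF uv(1)] uv(3) by (simp add: X_def)
  moreover have "Pt (vertex_point u) \<notin> E"
  proof
    assume "Pt (vertex_point u) \<in> E"
    then obtain r where "vertex_point u = edge_point u v r" "s \<le> r" by (auto simp: E_def)
    then have "1 = 1 - r" using edge_point_simps(3)[OF uv(3), of r] by (metis vertex_point_def)
    then show False using \<open>s \<le> r\<close> st by simp
  qed
  ultimately show False using C_top by (auto simp: X_def)
qed

lemma edge_in_C:
  assumes e: "{u, v} \<in> edges G" and t: "0 < t" "t < 1" "Pt (edge_point u v t) \<in> C" and s: "0 \<le> s" "s \<le> 1"
  shows "Pt (edge_point u v s) \<in> C"
proof -
  note uv = edge_verts[OF simple e]
  have e': "{v, u} \<in> edges G" using e by (simp add: insert_commute)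
  consider "s = 0" | "s = 1" | "s = t" | "0 < s" "s < t" | "t < s" "s < 1" using s by linarith
  then show ?thesis
  proof cases
    case 4
    then show ?thesis using edge_in_C_upper[OF e _ _ t(2,3)] by blast
  next
    case 5
    have "Pt (edge_point v u (1 - t)) \<in> C" using t(3) by (simp add: edge_point_swap[of v u])
    then have "Pt (edge_point v u (1 - s)) \<in> C" using edge_in_C_upper[OF e', of "1 - s" "1 - t"] 5 t by simp
    then show ?thesis by (simp add: edge_point_swap[of v u])
  qed (use C_verts uv t in \<open>auto simp: edge_point_simps\<close>)
qed

text \<open>The midpoint stands for the whole edge: by \<open>edge_in_C\<close>, one inner point in
  \<open>C\<close> brings in all the others.\<close>

definition circle_edge :: "'a \<Rightarrow> 'a \<Rightarrow> bool" where
  "circle_edge u v \<longleftrightarrow> {u, v} \<in> edges G \<and> Pt (edge_point u v (1 / 2)) \<in> C"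

lemma circle_edge_sym: "circle_edge u v \<Longrightarrow> circle_edge v u"
  unfolding circle_edge_def using edge_point_swap[of v u "1 / 2"] by (simp add: insert_commute)

lemma circle_edge_verts: "circle_edge u v \<Longrightarrow> u \<in> verts G" "circle_edge u v \<Longrightarrow> v \<in> verts G" "circle_edge u v \<Longrightarrow> u \<noteq> v"
  unfolding circle_edge_def using edge_verts[OF simple] by blast+

lemma circle_edge_points: "circle_edge u v \<Longrightarrow> 0 \<le> s \<Longrightarrow> s \<le> 1 \<Longrightarrow> Pt (edge_point u v s) \<in> C"
  unfolding circle_edge_def by (rule edge_in_C[of u v "1 / 2"]) auto

lemma circle_edgeI: "{u, v} \<in> edges G \<Longrightarrow> 0 < t \<Longrightarrow> t < 1 \<Longrightarrow> Pt (edge_point u v t) \<in> C \<Longrightarrow> circle_edge u v"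
  unfolding circle_edge_def by (auto intro: edge_in_C)

lemma C_point_cases:
  assumes "Pt r \<in> C" "r x \<noteq> 0"
  shows "r = vertex_point x \<or> (\<exists>y t. circle_edge x y \<and> 0 \<le> t \<and> t \<le> 1 \<and> r = edge_point x y t)"
  using simple Pt_in_C[OF assms(1)]
proof (cases rule: complex_points_cases)
  case (1 v)
  then show ?thesis using assms(2) by (auto simp: vertex_point_def split: if_splits)
next
  case (2 u v t)
  have ce: "circle_edge u v" using circle_edgeI[OF 2(1-3)] assms(1) 2(4) by simp
  have "x = u \<or> x = v" using assms(2) 2(4) edge_point_simps(5)[of x u v t] by blast
  then show ?thesis
  proof
    assume "x = u" then show ?thesis using ce 2 by (intro disjI2 exI[of _ v] exI[of _ t]) auto
  next
    assume "x = v"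
    moreover have "r = edge_point v u (1 - t)" using 2(4) by (simp add: edge_point_swap[of v u])
    ultimately show ?thesis using circle_edge_sym[OF ce] 2(2,3)
      by (intro disjI2 exI[of _ u] exI[of _ "1 - t"]) auto
  qed
qed

text \<open>With at most one circle edge at \<open>v\<close>, removing a single point would separate
  \<open>v\<close> from the rest of \<open>C\<close>.\<close>

lemma card_circle_neighbours_ge:
  assumes v: "v \<in> verts G"
  shows "\<not> {w. circle_edge v w} \<subseteq> {w0}"
proof
  assume N: "{w. circle_edge v w} \<subseteq> {w0}"
  \<comment> \<open>\<open>a\<close> is the midpoint of the only circle edge at \<open>v\<close>. If
    there is none, no point of \<open>C\<close> has coordinate \<open>1 / 2\<close> at
    \<open>v\<close>, and any other vertex point serves.\<close>
  obtain a where a: "a \<in> C" "a \<noteq> Pt (vertex_point v)" "\<And>p. Pt p \<in> C \<Longrightarrow> p v = 1 / 2 \<Longrightarrow> Pt p = a"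
  proof (cases "circle_edge v w0")
    case True
    show thesis
    proof (rule that[of "Pt (edge_point v w0 (1 / 2))"])
      show "Pt (edge_point v w0 (1 / 2)) \<in> C" using True by (simp add: circle_edge_def)
      have half: "edge_point v w0 (1 / 2) v = 1 / 2"
        using circle_edge_verts(3)[OF True] by (simp add: edge_point_simps)
      show "Pt (edge_point v w0 (1 / 2)) \<noteq> Pt (vertex_point v)"
        using half by (auto simp: vertex_point_def dest: fun_cong[of _ _ v])
      fix p assume p: "Pt p \<in> C" "p v = 1 / 2"
      then have "p \<noteq> vertex_point v" by (auto simp: vertex_point_def)
      then obtain y t where yt: "circle_edge v y" "p = edge_point v y t" using C_point_cases[OF p(1), of v] p(2) by auto
      then have y: "y = w0" and "1 - t = 1 / 2"
        using N p(2) edge_point_simps(3)[of v y t] circle_edge_verts(3)[OF yt(1)] by auto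
      from this(2) have "t = 1 / 2" by linarith
      then show "Pt p = Pt (edge_point v w0 (1 / 2))" using yt(2) y by (simp only:)
    qed
  next
    case False
    obtain w where w: "w \<in> verts G" "w \<noteq> v" using infinite_verts by (metis finite.simps finite_subset insertI1 insert_iff subsetI)
    show thesis
    proof (rule that[of "Pt (vertex_point w)"])
      fix p assume p: "Pt p \<in> C" "p v = 1 / 2"
      then have "p \<noteq> vertex_point v" by (auto simp: vertex_point_def)
      then have "\<exists>y. circle_edge v y" using C_point_cases[OF p(1), of v] p(2) by auto
      then show "Pt p = Pt (vertex_point w)" using N False by blast
    qed (use w C_verts in auto)
  qed
  define X where "X = C - {a}"
  define U where "U = Pt ` {p \<in> complex_points G. p v > 1 / 2}"
  \<comment> \<open>Deleting \<open>v\<close> with its neighbours keeps the neighbourhoods of the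
    ends disjoint from the star of \<open>v\<close>.\<close>
  define K where "K = insert v {u. {v, u} \<in> edges G}"
  define W where "W = Pt ` {p \<in> complex_points G. p v < 1 / 2} \<union> (\<Union>\<omega>\<in>ends G. end_nbhd G K \<omega>)"
  have K: "K \<in> finite_verts G"
    using neighbours_finite_verts[of "{v}"] v by (auto simp: K_def finite_verts_def)
  have "connectedin T X" unfolding X_def by (rule C_facts(1)[OF a(1)])
  moreover have "openin T U" unfolding U_def by (intro openin_Pt openin_complex_gt[OF simple])
  moreover have "openin T W"
    unfolding W_def using openin_end_nbhd[OF K]
    by (intro openin_Un openin_Pt openin_complex_lt[OF simple] openin_Union) auto
  moreover have "X \<subseteq> U \<union> W"
  proof
    fix x assume x: "x \<in> X"
    then have xt: "x \<in> topspace T" using C_top by (auto simp: X_def)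
    show "x \<in> U \<union> W"
    proof (cases x)
      case (Pt p)
      then have "p v \<noteq> 1 / 2" using x a(3) by (auto simp: X_def)
      then show ?thesis using Pt Pt_in_C x by (auto simp: U_def W_def X_def)
    next
      case (End \<omega>)
      then have "\<omega> \<in> ends G" using xt by (auto simp: topspace_freudenthal[OF simple])
      then show ?thesis using End by (auto simp: W_def End_in_end_nbhd)
    qed
  qed
  moreover have "U \<inter> W \<inter> X = {}"
  proof -
    have False if p: "p \<in> complex_points G" "p v > 1 / 2" "\<omega> \<in> ends G" "x \<in> \<omega> K" "p x \<noteq> 0" for p \<omega> x
    proof -
      have "x \<notin> K"
        using end_component[OF p(3) K] p(4) component_of_verts[OF simple_graph_delete[OF simple], of _ K]
        by (auto simp: components_def)
      then have "x \<noteq> v" "{v, x} \<notin> edges G" by (auto simp: K_def)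
      then show False using complex_point_support(1)[OF simple p(1), of v x] p(2,5) by auto
    qed
    then show ?thesis by (auto simp: U_def W_def end_nbhd_def)
  qed
  moreover have "U \<inter> X \<noteq> {}"
  proof -
    have "Pt (vertex_point v) \<in> U" using vertex_point_in[OF v] by (simp add: U_def vertex_point_def)
    then show ?thesis using C_verts[OF v] a(2) by (auto simp: X_def)
  qed
  ultimately have empty: "W \<inter> X = {}" by (rule connectedin_separation)
  \<comment> \<open>Since nothing is left on the side \<open>W\<close>, all vertices other than
    \<open>v\<close> would have to coincide with the removed point.\<close>
  have "w = v \<or> Pt (vertex_point w) = a" if "w \<in> verts G" for w
  proof (rule ccontr)
    assume w: "\<not> ?thesis"
    then have "Pt (vertex_point w) \<in> X" using C_verts[OF that] by (simp add: X_def)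
    moreover have "Pt (vertex_point w) \<in> W"
      using w vertex_point_in[OF that] unfolding W_def by (auto simp: vertex_point_def)
    ultimately show False using empty by blast
  qed
  then have sub: "verts G - {v} \<subseteq> (\<lambda>w. Pt (vertex_point w)) -` {a}" by auto
  have "finite ((\<lambda>w. Pt (vertex_point w)) -` {a})"
    by (rule finite_vimageI) (auto simp: inj_def)
  then show False using infinite_verts finite_subset[OF sub] by simp
qed

text \<open>Punctured at \<open>w1\<close>, the circle injects continuously into the real line; the
  three half edges at \<open>v\<close> avoid the puncture and would form a triod there.\<close>

lemma card_circle_neighbours_le:
  assumes ce: "circle_edge v w1" "circle_edge v w2" "circle_edge v w3"
    and ne: "w1 \<noteq> w2" "w2 \<noteq> w3" "w1 \<noteq> w3"
  shows False
proof -
  define a where "a = Pt (vertex_point w1)"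
  have "a \<in> C" unfolding a_def by (rule C_verts[OF circle_edge_verts(2)[OF ce(1)]])
  then obtain \<phi> where \<phi>: "continuous_map (subtopology T (C - {a})) euclideanreal \<phi>" "inj_on \<phi> (C - {a})"
    using C_facts(2) by blast
  define \<gamma> where "\<gamma> = (\<lambda>w t. \<phi> (Pt (edge_point v w t)))"
  have ce': "circle_edge v w" if "w \<in> {w1, w2, w3}" for w using ce that by blast
  have inX: "Pt (edge_point v w t) \<in> C - {a}" if w: "w \<in> {w1, w2, w3}" "0 \<le> t" "t \<le> 1 / 2" for w t
  proof -
    have "Pt (edge_point v w t) \<in> C" using circle_edge_points[OF ce'[OF w(1)]] w by simp
    moreover have "edge_point v w t \<noteq> vertex_point w1"
    proof
      assume "edge_point v w t = vertex_point w1"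
      then have "edge_point v w t w1 = 1" by (simp add: vertex_point_def)
      moreover have "edge_point v w t w1 \<le> 1 / 2"
        using w circle_edge_verts(3)[OF ce'[OF w(1)]] circle_edge_verts(3)[OF ce(1)]
        by (auto simp: edge_point_def vertex_point_def)
      ultimately show False by simp
    qed
    ultimately show ?thesis by (simp add: a_def)
  qed
  show False
  proof (rule no_real_triod[of w1 w2 w3 "1 / 2" \<gamma> "\<phi> (Pt (vertex_point v))"])
    fix w assume w: "w \<in> {w1, w2, w3}"
    have e: "{v, w} \<in> edges G" "v \<noteq> w" using ce'[OF w] circle_edge_verts(3)[OF ce'[OF w]] by (auto simp: circle_edge_def)
    have "continuous_map (top_of_set {0..1}) T (Pt \<circ> edge_point v w)"
      by (rule continuous_map_compose[OF continuous_map_edge_point[OF simple e(1)] continuous_map_Pt[OF simple]])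
    then have "continuous_map (subtopology (top_of_set {0..1}) {0..1 / 2}) T (Pt \<circ> edge_point v w)"
      by (rule continuous_map_from_subtopology)
    then have "continuous_map (top_of_set {0..1 / 2}) T (Pt \<circ> edge_point v w)"
      by (simp add: subtopology_subtopology)
    then have "continuous_map (top_of_set {0..1 / 2}) (subtopology T (C - {a})) (Pt \<circ> edge_point v w)"
      using inX[OF w] by (auto simp: continuous_map_in_subtopology)
    from continuous_map_compose[OF this \<phi>(1)]
    show "continuous_on {0..1 / 2} (\<gamma> w)" by (simp add: \<gamma>_def o_def)
    show "\<gamma> w 0 = \<phi> (Pt (vertex_point v))" by (simp add: \<gamma>_def edge_point_simps)
    show "\<gamma> w (1 / 2) \<noteq> \<phi> (Pt (vertex_point v))"
    proof
      assume "\<gamma> w (1 / 2) = \<phi> (Pt (vertex_point v))"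
      then have "\<phi> (Pt (edge_point v w (1 / 2))) = \<phi> (Pt (edge_point v w 0))"
        by (simp add: \<gamma>_def edge_point_simps)
      then have "edge_point v w (1 / 2) = edge_point v w 0"
        using inj_onD[OF \<phi>(2), of "Pt (edge_point v w (1 / 2))" "Pt (edge_point v w 0)"]
          inX[OF w, of "1 / 2"] inX[OF w, of 0] by simp
      then have "edge_point v w (1 / 2) w = edge_point v w 0 w" by simp
      then show False using e(2) by (simp add: edge_point_def vertex_point_def)
    qed
  next
    fix x y and s t :: real
    assume xy: "x \<in> {w1, w2, w3}" "y \<in> {w1, w2, w3}" "x \<noteq> y" and st: "s \<in> {0<..1 / 2}" "t \<in> {0<..1 / 2}"
    show "\<gamma> x s \<noteq> \<gamma> y t"
    proof
      assume "\<gamma> x s = \<gamma> y t"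
      then have "Pt (edge_point v x s) = Pt (edge_point v y t)"
        using inj_onD[OF \<phi>(2), of "Pt (edge_point v x s)" "Pt (edge_point v y t)"]
          inX[OF xy(1), of s] inX[OF xy(2), of t] st by (simp add: \<gamma>_def)
      then have "edge_point v x s x = edge_point v y t x" by simp
      then show False using xy(3) st circle_edge_verts(3)[OF ce'[OF xy(1)]]
        by (auto simp: edge_point_def vertex_point_def)
    qed
  qed (use ne in auto)
qed

lemma circle_two_regular: "\<forall>v\<in>verts G. \<exists>a b. a \<noteq> b \<and> {w. circle_edge v w} = {a, b}"
proof
  fix v assume v: "v \<in> verts G"
  obtain a where a: "circle_edge v a" using card_circle_neighbours_ge[OF v] by blast
  obtain b where b: "circle_edge v b" "b \<noteq> a" using card_circle_neighbours_ge[OF v, of a] by blast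
  have "w = a \<or> w = b" if "circle_edge v w" for w
    using card_circle_neighbours_le[OF a b(1) that] b(2) by metis
  then have "{w. circle_edge v w} = {a, b}" using a b(1) by auto
  then show "\<exists>a b. a \<noteq> b \<and> {w. circle_edge v w} = {a, b}" using b(2) by metis
qed

section \<open>The lines of the 2-factor\<close>

definition circle_line :: "(int \<Rightarrow> 'a) \<Rightarrow> bool" where
  "circle_line p \<longleftrightarrow> (\<forall>i. circle_edge (p i) (p (i + 1)) \<and> p (i - 1) \<noteq> p (i + 1))"

lemma circle_line_exists:
  assumes "v \<in> verts G"
  obtains p where "p 0 = v" "circle_line p"
proof -
  have "\<forall>v w. circle_edge v w \<longrightarrow> w \<in> verts G" "\<forall>v w. circle_edge v w \<longrightarrow> circle_edge w v"
    using circle_edge_verts circle_edge_sym by blast+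
  from two_regular_line[OF circle_two_regular this assms] that show thesis
    unfolding circle_line_def by blast
qed

lemma circle_line_neighbours:
  assumes "circle_line p"
  shows "{w. circle_edge (p i) w} = {p (i - 1), p (i + 1)}"
proof -
  have "\<forall>v w. circle_edge v w \<longrightarrow> w \<in> verts G" "\<forall>v w. circle_edge v w \<longrightarrow> circle_edge w v"
    using circle_edge_verts circle_edge_sym by blast+
  from two_regular_line_neighbours[OF circle_two_regular this] assms show ?thesis
    unfolding circle_line_def by blast
qed

lemma circle_line_cases: "circle_line p \<Longrightarrow> inj p \<or> finite (range p)"
  using two_regular_line_cases[of circle_edge p] circle_line_neighbours circle_edge_verts(3)
  unfolding circle_line_def by blast

lemma circle_line_edges: "circle_line p \<Longrightarrow> \<forall>i. {p i, p (i + 1)} \<in> edges G"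
  unfolding circle_line_def circle_edge_def by blast

lemma circle_line_verts: "circle_line p \<Longrightarrow> range p \<subseteq> verts G"
  unfolding circle_line_def using circle_edge_verts(1) by blast

text \<open>At a common vertex both lines have the same two neighbours, so membership in
  \<open>range p\<close> spreads along \<open>q\<close> in both directions.\<close>

lemma circle_line_subset:
  assumes p: "circle_line p" and q: "circle_line q" and "p i = q j"
  shows "range q \<subseteq> range p"
proof -
  have step: "q (k + 1) \<in> range p \<and> q (k - 1) \<in> range p" if k: "q k \<in> range p" for k
  proof -
    obtain l where "q k = p l" using k by blast
    then have "{q (k - 1), q (k + 1)} = {p (l - 1), p (l + 1)}"
      using circle_line_neighbours[OF q, of k] circle_line_neighbours[OF p, of l] by simp
    then have "q (k + 1) \<in> {p (l - 1), p (l + 1)}" "q (k - 1) \<in> {p (l - 1), p (l + 1)}" by blast+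
    then show ?thesis by auto
  qed
  have "q k \<in> range p" for k
  proof (induction k rule: int_induct[where k = j])
    case base
    then show ?case using assms(3) by (metis rangeI)
  qed (use step in blast)+
  then show ?thesis by blast
qed

definition line_set :: "(int \<Rightarrow> 'a) \<Rightarrow> 'a fpoint set" where
  "line_set p = Pt ` range (line_point p)"

text \<open>The open star of the vertices of \<open>p\<close>. It cuts out of \<open>C\<close> just
  the line, which shows that lines are relatively open in \<open>C\<close>.\<close>

definition line_nbhd :: "(int \<Rightarrow> 'a) \<Rightarrow> 'a fpoint set" where
  "line_nbhd p = Pt ` {r \<in> complex_points G. \<exists>x\<in>range p. r x \<noteq> 0}"

lemma openin_line_nbhd: "openin T (line_nbhd p)"
  unfolding line_nbhd_def by (intro openin_Pt openin_complex_meets[OF simple])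

lemma connectedin_line_set:
  assumes "circle_line p" shows "connectedin T (line_set p)"
proof -
  have "continuous_map euclideanreal T (Pt \<circ> line_point p)"
    by (rule continuous_map_compose[OF continuous_map_line_point[OF simple circle_line_edges[OF assms]] continuous_map_Pt[OF simple]])
  moreover have "connectedin euclideanreal UNIV" by (simp add: connectedin_iff_connected)
  ultimately have "connectedin T ((Pt \<circ> line_point p) ` UNIV)" by (rule connectedin_continuous_map_image)
  then show ?thesis by (simp add: line_set_def image_comp)
qed

lemma line_point_nonzero: "circle_line p \<Longrightarrow> line_point p t (p \<lfloor>t\<rfloor>) \<noteq> 0"
proof -
  assume "circle_line p"
  then have "p \<lfloor>t\<rfloor> \<noteq> p (\<lfloor>t\<rfloor> + 1)" unfolding circle_line_def using circle_edge_verts(3) by blast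
  then show ?thesis unfolding line_point_def using frac_lt_1[of t] by (simp add: edge_point_simps)
qed

text \<open>The only circle edges at a vertex of \<open>p\<close> are the two edges of the line, so
  \<open>C\<close> has no other points in the star of that vertex.\<close>

lemma C_line_nbhd:
  assumes p: "circle_line p"
  shows "C \<inter> line_nbhd p = line_set p"
proof (intro equalityI subsetI)
  fix x assume "x \<in> C \<inter> line_nbhd p"
  then obtain r i where r: "x = Pt r" "Pt r \<in> C" "r (p i) \<noteq> 0" by (auto simp: line_nbhd_def)
  have "r \<in> range (line_point p)"
    using C_point_cases[OF r(2,3)]
  proof (elim disjE exE conjE)
    assume "r = vertex_point (p i)"
    then show ?thesis using line_point_of_int[of p i] by (metis rangeI)
  next
    fix y t assume y: "circle_edge (p i) y" and t: "0 \<le> t" "t \<le> 1" "r = edge_point (p i) y t"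
    from y have "y \<in> {p (i - 1), p (i + 1)}" using circle_line_neighbours[OF p, of i] by blast
    then consider "y = p (i + 1)" | "y = p (i - 1)" by blast
    then show ?thesis
    proof cases
      case 1
      then have "r = line_point p (of_int i + t)"
        using t line_point_on_interval[of i "of_int i + t" p] by simp
      then show ?thesis by blast
    next
      case 2
      then have "r = edge_point (p (i - 1)) (p i) (1 - t)" using t(3) edge_point_swap[of "p i" "p (i - 1)" t] by simp
      then have "r = line_point p (of_int (i - 1) + (1 - t))"
        using t line_point_on_interval[of "i - 1" "of_int (i - 1) + (1 - t)" p] by simp
      then show ?thesis by blast
    qed
  qed
  then show "x \<in> line_set p" using r(1) by (simp add: line_set_def)
next
  fix x assume "x \<in> line_set p"
  then obtain t where t: "x = Pt (line_point p t)" by (auto simp: line_set_def)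
  have "circle_edge (p \<lfloor>t\<rfloor>) (p (\<lfloor>t\<rfloor> + 1))" using p unfolding circle_line_def by blast
  then have "x \<in> C"
    unfolding t line_point_def using frac_ge_0[of t] frac_lt_1[of t] by (intro circle_edge_points) auto
  moreover have "line_point p t \<in> complex_points G" by (rule line_point_in[OF simple circle_line_edges[OF p]])
  ultimately show "x \<in> C \<inter> line_nbhd p"
    using t line_point_nonzero[OF p, of t] by (auto simp: line_nbhd_def)
qed

lemma line_sets_disjoint:
  assumes p: "circle_line p" and q: "circle_line q" and "range p \<inter> range q = {}"
  shows "line_set p \<inter> line_nbhd q = {}"
proof -
  have False if "line_point p t x \<noteq> 0" "x \<in> range q" for t x
  proof -
    have "x \<in> range p" using line_point_support[OF that(1)] by blast
    then show False using that(2) assms(3) by blast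
  qed
  then show ?thesis unfolding line_set_def line_nbhd_def by blast
qed

lemma lines_disjoint:
  assumes "circle_line p" "circle_line q" "q 0 \<notin> range p"
  shows "range p \<inter> range q = {}"
proof (rule ccontr)
  assume "\<not> ?thesis"
  then obtain i j where "p i = q j" by auto
  then have "range q \<subseteq> range p" by (rule circle_line_subset[OF assms(1,2)])
  then show False using assms(3) by blast
qed

text \<open>\<open>C\<close> is compact and therefore closed, and every neighbourhood of the end
  contains vertices, all of which lie in \<open>C\<close>.\<close>

lemma end_in_C: "End (end_of A) \<in> C"
proof (rule ccontr)
  assume "End (end_of A) \<notin> C"
  then have "End (end_of A) \<in> topspace T - C"
    using end_of_in_ends by (simp add: topspace_freudenthal[OF simple])
  moreover have "openin T (topspace T - C)" using closedin_C by (simp add: openin_diff)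
  ultimately obtain K where K: "K \<in> finite_verts G" "end_nbhd G K (end_of A) \<subseteq> topspace T - C"
    using end_nbhd_base by blast
  obtain x where x: "x \<in> tail G A K" using tail_nonempty[OF K(1)] by blast
  then have "x \<in> verts G" using tail_verts by blast
  then have "Pt (vertex_point x) \<in> end_nbhd G K (end_of A)"
    using x K(1) vertex_point_in by (auto simp: Pt_in_end_nbhd vertex_point_def intro!: bexI[of _ x])
  then show False using K(2) C_verts[OF \<open>x \<in> verts G\<close>] by blast
qed

lemma complement_circle: "circle_in_graph G (verts G - A) C"
  using complement ham by (simp add: circle_in_graph_def circle_in_graph_axioms_def)

lemma other_end_in_C: "End (end_of (verts G - A)) \<in> C"
  by (rule circle_in_graph.end_in_C[OF complement_circle])

text \<open>Otherwise the line has finitely many edges, so it is compact and hence both open and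
  closed in the connected set \<open>C\<close>; but it does not contain the end.\<close>

lemma inj_circle_line:
  assumes p: "circle_line p"
  shows "inj p"
proof (rule ccontr)
  assume "\<not> inj p"
  then have fin: "finite (range p)" using circle_line_cases[OF p] by blast
  define P where "P = range (\<lambda>i. (p i, p (i + 1)))"
  have "P \<subseteq> range p \<times> range p" by (auto simp: P_def)
  then have finP: "finite P" using fin finite_subset by blast
  have "line_set p = (\<Union>(u, v)\<in>P. Pt ` edge_point u v ` {0..1})"
  proof (intro equalityI subsetI)
    fix x assume "x \<in> line_set p"
    then obtain t where "x = Pt (edge_point (p \<lfloor>t\<rfloor>) (p (\<lfloor>t\<rfloor> + 1)) (frac t))"
      by (auto simp: line_set_def line_point_def)
    moreover have "frac t \<in> {0..1}" using frac_ge_0[of t] frac_lt_1[of t] by simp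
    ultimately show "x \<in> (\<Union>(u, v)\<in>P. Pt ` edge_point u v ` {0..1})" unfolding P_def by blast
  next
    fix x assume "x \<in> (\<Union>(u, v)\<in>P. Pt ` edge_point u v ` {0..1})"
    then obtain i t where "x = Pt (edge_point (p i) (p (i + 1)) t)" "0 \<le> t" "t \<le> 1" by (auto simp: P_def)
    then have "x = Pt (line_point p (of_int i + t))"
      using line_point_on_interval[of i "of_int i + t" p] by simp
    then show "x \<in> line_set p" by (simp add: line_set_def)
  qed
  moreover have "compactin T (\<Union>(u, v)\<in>P. Pt ` edge_point u v ` {0..1})"
    using finP circle_line_edges[OF p] by (intro compactin_Union) (auto simp: P_def intro!: compactin_edge)
  ultimately have "closedin T (line_set p)" using compactin_imp_closedin[OF Hausdorff_freudenthal] by simp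
  then have "openin T (topspace T - line_set p)" by (simp add: openin_diff)
  moreover have "C \<subseteq> line_nbhd p \<union> (topspace T - line_set p)"
    using C_top C_line_nbhd[OF p] by blast
  moreover have "line_nbhd p \<inter> (topspace T - line_set p) \<inter> C = {}" using C_line_nbhd[OF p] by blast
  moreover have "line_nbhd p \<inter> C \<noteq> {}" using C_line_nbhd[OF p] by (auto simp: line_set_def)
  ultimately have "(topspace T - line_set p) \<inter> C = {}"
    by (rule connectedin_separation[OF C_facts(6) openin_line_nbhd])
  moreover have "End (end_of A) \<notin> line_set p" by (auto simp: line_set_def)
  ultimately show False using end_in_C C_top by blast
qed

lemma C_minus_ends: "C - {End (end_of A), End (end_of (verts G - A))} = {x \<in> C. \<exists>r. x = Pt r}"
proof -
  have "x = End (end_of A) \<or> x = End (end_of (verts G - A)) \<or> (\<exists>r. x = Pt r)" if "x \<in> C" for x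
    using that C_top by (auto simp: topspace_freudenthal[OF simple] ends_eq)
  then show ?thesis by blast
qed

lemma C_point_in_line:
  assumes "Pt r \<in> C"
  obtains v where "v \<in> verts G" "\<And>p. v \<in> range p \<Longrightarrow> circle_line p \<Longrightarrow> Pt r \<in> line_set p"
proof -
  have rc: "r \<in> complex_points G" by (rule Pt_in_C[OF assms])
  have "\<exists>v. r v \<noteq> 0"
    using simple rc
  proof (cases rule: complex_points_cases)
    case (1 v)
    then show ?thesis by (intro exI[of _ v]) (simp add: vertex_point_def)
  next
    case (2 u v t)
    then show ?thesis
      using edge_verts(3)[OF simple 2(1)] by (intro exI[of _ v]) (simp add: edge_point_simps)
  qed
  then obtain v where v: "r v \<noteq> 0" ..
  have "Pt r \<in> line_set p" if "v \<in> range p" "circle_line p" for p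
    using C_line_nbhd[OF that(2)] assms rc v that(1) by (auto simp: line_nbhd_def)
  then show thesis using that complex_points_verts[OF simple rc v] by blast
qed

text \<open>Without its two ends, \<open>C\<close> is a disjoint union of relatively open lines. It
  is disconnected, so there is more than one line, and it is covered by two connected sets, so there
  are no three.\<close>

lemma two_lines:
  obtains p q where "circle_line p" "circle_line q" "range p \<inter> range q = {}" "range p \<union> range q = verts G"
proof -
  let ?X = "C - {End (end_of A), End (end_of (verts G - A))}"
  have ends_ne: "End (end_of A) \<noteq> End (end_of (verts G - A))" using end_of_ne by simp
  obtain v0 where v0: "v0 \<in> verts G" using infinite_verts by (metis ex_in_conv finite.emptyI)
  obtain p where p: "p 0 = v0" "circle_line p" using circle_line_exists[OF v0] .
  have sub: "line_set p \<subseteq> ?X" if "circle_line p" for p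
    using C_line_nbhd[OF that] unfolding C_minus_ends by (auto simp: line_set_def)
  have "\<not> verts G \<subseteq> range p"
  proof
    assume all: "verts G \<subseteq> range p"
    have "?X \<subseteq> line_set p"
    proof
      fix x assume "x \<in> ?X"
      then obtain s where s: "x = Pt s" "Pt s \<in> C" unfolding C_minus_ends by blast
      obtain v where v: "v \<in> verts G" "\<And>p. v \<in> range p \<Longrightarrow> circle_line p \<Longrightarrow> Pt s \<in> line_set p"
        using C_point_in_line[OF s(2)] by blast
      show "x \<in> line_set p" unfolding s(1) by (rule v(2)[OF subsetD[OF all v(1)] p(2)])
    qed
    then have "?X = line_set p" using sub[OF p(2)] by blast
    then show False using C_facts(3)[OF end_in_C other_end_in_C ends_ne] connectedin_line_set[OF p(2)] by simp
  qed
  then obtain v1 where v1: "v1 \<in> verts G" "v1 \<notin> range p" by blast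
  obtain q where q: "q 0 = v1" "circle_line q" using circle_line_exists[OF v1(1)] .
  have pq: "range p \<inter> range q = {}" using lines_disjoint[OF p(2) q(2)] q(1) v1(2) by simp
  have "verts G \<subseteq> range p \<union> range q"
  proof
    fix v2 assume v2: "v2 \<in> verts G"
    show "v2 \<in> range p \<union> range q"
    proof (rule ccontr)
      assume n: "v2 \<notin> range p \<union> range q"
      obtain r where r: "r 0 = v2" "circle_line r" using circle_line_exists[OF v2] .
      have pr: "range p \<inter> range r = {}" and qr: "range q \<inter> range r = {}"
        using lines_disjoint[OF p(2) r(2)] lines_disjoint[OF q(2) r(2)] r(1) n by simp_all
      obtain D E where DE: "connectedin T D" "connectedin T E" "?X = D \<union> E"
        using C_facts(4)[OF end_in_C other_end_in_C ends_ne] by blast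
      \<comment> \<open>A connected part that meets the line \<open>l\<close> stays in it, because
        the lines disjoint from \<open>l\<close> are together covered by the open set
        \<open>W\<close>.\<close>
      have whole: "D' \<subseteq> line_set l" if D': "connectedin T D'" "D' \<subseteq> ?X" and l: "circle_line l" and "D' \<inter> line_set l \<noteq> {}" for D' l
      proof -
        define W where "W = (\<Union>l'\<in>{l'. circle_line l' \<and> range l \<inter> range l' = {}}. line_nbhd l')"
        have "openin T W" unfolding W_def by (intro openin_Union) (auto intro: openin_line_nbhd)
        moreover have "D' \<subseteq> line_nbhd l \<union> W"
        proof
          fix x assume x: "x \<in> D'"
          then obtain s where s: "x = Pt s" "Pt s \<in> C" using D'(2) unfolding C_minus_ends by blast
          obtain v where v: "v \<in> verts G" "\<And>p. v \<in> range p \<Longrightarrow> circle_line p \<Longrightarrow> Pt s \<in> line_set p"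
            using C_point_in_line[OF s(2)] by blast
          obtain l' where l': "l' 0 = v" "circle_line l'" using circle_line_exists[OF v(1)] .
          have "x \<in> line_set l'" using v(2)[of l'] l' s(1) by (metis rangeI)
          then have xl': "x \<in> line_nbhd l'" using C_line_nbhd[OF l'(2)] by blast
          show "x \<in> line_nbhd l \<union> W"
          proof (cases "v \<in> range l")
            case True
            then show ?thesis using v(2)[OF True l] C_line_nbhd[OF l] s(1) by blast
          next
            case False
            then have "range l \<inter> range l' = {}" using lines_disjoint[OF l l'(2)] l'(1) by simp
            then show ?thesis using xl' l'(2) unfolding W_def by blast
          qed
        qed
        moreover have "line_nbhd l \<inter> W \<inter> D' = {}"
        proof -
          have "line_set l \<inter> W = {}" using line_sets_disjoint[OF l] unfolding W_def by blast
          then show ?thesis using C_line_nbhd[OF l] D'(2) by blast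
        qed
        moreover have "line_nbhd l \<inter> D' \<noteq> {}" using that(4) C_line_nbhd[OF l] by blast
        ultimately have "W \<inter> D' = {}" by (rule connectedin_separation[OF D'(1) openin_line_nbhd])
        with \<open>D' \<subseteq> line_nbhd l \<union> W\<close> show ?thesis using C_line_nbhd[OF l] D'(2) by blast
      qed
      have disj: "line_set p \<inter> line_set q = {}" "line_set p \<inter> line_set r = {}" "line_set q \<inter> line_set r = {}"
        using line_sets_disjoint[OF p(2) q(2) pq] line_sets_disjoint[OF p(2) r(2) pr] line_sets_disjoint[OF q(2) r(2) qr]
          C_line_nbhd[OF q(2)] C_line_nbhd[OF r(2)] by blast+
      have ne: "line_set l \<noteq> {}" for l by (simp add: line_set_def)
      have in_DE: "D \<inter> line_set l \<noteq> {} \<or> E \<inter> line_set l \<noteq> {}" if "circle_line l" for l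
        using sub[OF that] ne[of l] DE(3) by blast
      have Dw: "D \<inter> line_set l = {} \<or> D \<subseteq> line_set l" "E \<inter> line_set l = {} \<or> E \<subseteq> line_set l" if "circle_line l" for l
        using whole[OF DE(1) _ that] whole[OF DE(2) _ that] DE(3) by blast+
      have hit: "D \<noteq> {} \<and> D \<subseteq> line_set l \<or> E \<noteq> {} \<and> E \<subseteq> line_set l" if "circle_line l" for l
        using in_DE[OF that] Dw[OF that] by auto
      have excl: "\<not> (S \<noteq> {} \<and> S \<subseteq> line_set l \<and> S \<subseteq> line_set l')" if "line_set l \<inter> line_set l' = {}" for S l l'
        using that by blast
      show False
        using hit[OF p(2)] hit[OF q(2)] hit[OF r(2)] excl[OF disj(1)] excl[OF disj(2)] excl[OF disj(3)] by metis
    qed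
  qed
  then have "range p \<union> range q = verts G" using circle_line_verts[OF p(2)] circle_line_verts[OF q(2)] by blast
  then show thesis using that p(2) q(2) pq by blast
qed

text \<open>If \<open>p\<close> avoided the tail, then \<open>C\<close> punctured at the opposite
  end would split into \<open>p\<close> on one side and, on the other, \<open>q\<close> with a
  neighbourhood of the end.\<close>

lemma line_visits_tail:
  assumes p: "circle_line p" and q: "circle_line q" and pq: "range p \<inter> range q = {}" "range p \<union> range q = verts G"
    and K: "K \<in> finite_verts G"
  shows "range p \<inter> tail G A K \<noteq> {}"
proof
  assume empty: "range p \<inter> tail G A K = {}"
  let ?X = "C - {End (end_of (verts G - A))}"
  define W where "W = line_nbhd q \<union> end_nbhd G K (end_of A)"
  have "openin T W" unfolding W_def using openin_line_nbhd openin_end_nbhd[OF K end_of_in_ends] by blast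
  moreover have "?X \<subseteq> line_nbhd p \<union> W"
  proof
    fix x assume x: "x \<in> ?X"
    show "x \<in> line_nbhd p \<union> W"
    proof (cases "x = End (end_of A)")
      case True
      then show ?thesis using end_of_in_ends by (simp add: W_def End_in_end_nbhd)
    next
      case False
      then have "x \<in> {x \<in> C. \<exists>r. x = Pt r}" unfolding C_minus_ends[symmetric] using x by simp
      then obtain s where s: "x = Pt s" "Pt s \<in> C" by blast
      obtain v where v: "v \<in> verts G" "\<And>p. v \<in> range p \<Longrightarrow> circle_line p \<Longrightarrow> Pt s \<in> line_set p"
        using C_point_in_line[OF s(2)] by blast
      then have "Pt s \<in> line_set p \<or> Pt s \<in> line_set q" using pq(2) p q by blast
      then show ?thesis using C_line_nbhd[OF p] C_line_nbhd[OF q] s(1) unfolding W_def by blast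
    qed
  qed
  moreover have "line_nbhd p \<inter> W \<inter> ?X = {}"
  proof -
    have "line_set p \<inter> end_nbhd G K (end_of A) = {}"
    proof -
      have False if "line_point p t x \<noteq> 0" "x \<in> tail G A K" for t x
        using line_point_support[OF that(1)] that(2) empty by blast
      then show ?thesis using K by (auto simp: line_set_def Pt_in_end_nbhd)
    qed
    then show ?thesis
      using line_sets_disjoint[OF p q pq(1)] C_line_nbhd[OF p] unfolding W_def by blast
  qed
  moreover have "line_nbhd p \<inter> ?X \<noteq> {}"
  proof -
    have "Pt (line_point p 0) \<in> C \<inter> line_nbhd p" unfolding C_line_nbhd[OF p] by (simp add: line_set_def)
    then show ?thesis by blast
  qed
  ultimately have "W \<inter> ?X = {}"
    by (rule connectedin_separation[OF C_facts(1)[OF other_end_in_C] openin_line_nbhd])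
  moreover have "End (end_of A) \<in> W" using end_of_in_ends by (simp add: W_def End_in_end_nbhd)
  moreover have "End (end_of A) \<in> ?X" using end_in_C end_of_ne by simp
  ultimately show False by blast
qed

text \<open>Otherwise, deleting the boundary and the finitely many vertices of \<open>p\<close> in
  \<open>A\<close> would leave a tail inside \<open>A\<close> without any vertex of
  \<open>p\<close>.\<close>

lemma infinite_line_side:
  assumes p: "circle_line p" and q: "circle_line q" and pq: "range p \<inter> range q = {}" "range p \<union> range q = verts G"
  shows "infinite {i. p i \<in> A}"
proof
  assume fin: "finite {i. p i \<in> A}"
  define K where "K = boundary G A \<union> p ` {i. p i \<in> A}"
  have K: "K \<in> finite_verts G"
    using boundary_finite_verts fin circle_line_verts[OF p] by (auto simp: K_def finite_verts_def)
  obtain i where i: "p i \<in> tail G A K" using line_visits_tail[OF p q pq K] by blast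
  then have "p i \<in> A" using tail_side[OF K] by (auto simp: K_def)
  then have "p i \<in> K" by (auto simp: K_def)
  then show False using i tail_verts by blast
qed

text \<open>As \<open>p\<close> is injective and the boundary finite, \<open>p\<close> changes sides
  only finitely often and so settles on a side in each direction. Both sides contain infinitely many
  of its vertices, so the two limits differ.\<close>

lemma line_leads:
  assumes p: "circle_line p" and q: "circle_line q" and pq: "range p \<inter> range q = {}" "range p \<union> range q = verts G"
  shows "leads p \<or> leads (p \<circ> uminus)"
proof -
  note inf = infinite_line_side[OF p q pq]
  have infB: "infinite {i. p i \<notin> A}"
  proof -
    interpret c: circle_in_graph G "verts G - A" C by (rule complement_circle)
    have "c.circle_edge = circle_edge" unfolding c.circle_edge_def circle_edge_def by simp
    then have l: "c.circle_line p" "c.circle_line q"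
      using p q unfolding c.circle_line_def circle_line_def by simp_all
    have "infinite {i. p i \<in> verts G - A}" by (rule c.infinite_line_side[OF l pq])
    then show ?thesis by (rule contrapos_nn) (erule rev_finite_subset, auto)
  qed
  define X where "X = {i. (p i \<in> A) \<noteq> (p (i + 1) \<in> A)}"
  have "X \<subseteq> p -` boundary G A"
  proof
    fix i assume "i \<in> X"
    moreover have "{p (i + 1), p i} \<in> edges G" using circle_line_edges[OF p] by (simp add: insert_commute)
    ultimately show "i \<in> p -` boundary G A"
      using circle_line_verts[OF p] unfolding X_def boundary_def by blast
  qed
  then have "finite X" using finite_vimageI[OF side(4) inj_circle_line[OF p]] finite_subset by blast
  then obtain N where N: "\<bar>i\<bar> < N" if "i \<in> X" for i
  proof -
    have "\<bar>i\<bar> < Max (insert 0 (abs ` X)) + 1" if "i \<in> X" for i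
      using \<open>finite X\<close> that by (simp add: le_imp_less_Suc add1_zle_eq[symmetric])
    then show thesis using that by blast
  qed
  have up: "p i \<in> A \<longleftrightarrow> p N \<in> A" if "i \<ge> N" for i
    using that
  proof (induction i rule: int_ge_induct)
    case (step i)
    then have "i \<notin> X" using N[of i] by fastforce
    then show ?case using step by (simp add: X_def)
  qed simp
  have down: "p i \<in> A \<longleftrightarrow> p (- N) \<in> A" if "i \<le> - N" for i
    using that
  proof (induction i rule: int_le_induct)
    case (step i)
    then have "i - 1 \<notin> X" using N[of "i - 1"] by fastforce
    then show ?case using step by (simp add: X_def)
  qed simp
  have sides: "p N \<in> A \<longleftrightarrow> p (- N) \<notin> A"
  proof (rule ccontr)
    assume "\<not> ?thesis"
    then have "{i. p i \<notin> A} \<subseteq> {- N..N} \<or> {i. p i \<in> A} \<subseteq> {- N..N}"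
      using up down by (smt (verit) atLeastAtMost_iff mem_Collect_eq subsetI)
    then show False using inf infB finite_subset by blast
  qed
  show ?thesis
  proof (cases "p N \<in> A")
    case True
    then have "leads p" unfolding leads_def using up down sides by blast
    then show ?thesis ..
  next
    case False
    have "(p \<circ> uminus) i \<in> A" if "i \<ge> N" for i
      using down[of "- i"] that False sides by simp
    moreover have "(p \<circ> uminus) i \<notin> A" if "i \<le> - N" for i
      using up[of "- i"] that False by simp
    ultimately have "leads (p \<circ> uminus)" unfolding leads_def by blast
    then show ?thesis ..
  qed
qed

lemma circle_line_reverse: "circle_line p \<Longrightarrow> circle_line (p \<circ> uminus)"
proof -
  assume p: "circle_line p"
  have "circle_edge (p (- i)) (p (- i - 1)) \<and> p (- i + 1) \<noteq> p (- i - 1)" for i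
    using p[unfolded circle_line_def, rule_format, of "- i - 1"] p[unfolded circle_line_def, rule_format, of "- i"]
      circle_edge_sym by fastforce
  then show ?thesis unfolding circle_line_def by (simp add: algebra_simps)
qed

text \<open>A line that runs from \<open>A\<close> to the complement is reversed, which does not
  affect its range.\<close>

theorem circle_is_ray_pair:
  obtains p q where "ray_pair p q" "C = circle_of G p q"
proof -
  obtain p0 q0 where pq0: "circle_line p0" "circle_line q0" "range p0 \<inter> range q0 = {}" "range p0 \<union> range q0 = verts G"
    by (rule two_lines)
  have rng: "range (r \<circ> uminus) = range r" for r :: "int \<Rightarrow> 'a"
    by (metis fun.set_map surj_uminus image_comp)
  obtain p where p: "circle_line p" "range p = range p0" "leads p"
    using line_leads[OF pq0] circle_line_reverse[OF pq0(1)] pq0(1) rng by metis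
  have "range q0 \<inter> range p0 = {}" "range q0 \<union> range p0 = verts G" using pq0 by blast+
  then obtain q where q: "circle_line q" "range q = range q0" "leads q"
    using line_leads[OF pq0(2,1)] circle_line_reverse[OF pq0(2)] pq0(2) rng by metis
  have "ray_pair p q"
    unfolding ray_pair_def using p q pq0 inj_circle_line circle_line_edges by simp
  moreover have "C = circle_of G p q"
  proof (intro equalityI subsetI)
    fix x assume x: "x \<in> C"
    show "x \<in> circle_of G p q"
    proof (cases "\<exists>s. x = Pt s")
      case True
      then obtain s where s: "x = Pt s" "Pt s \<in> C" using x by blast
      obtain v where v: "v \<in> verts G" "\<And>p. v \<in> range p \<Longrightarrow> circle_line p \<Longrightarrow> Pt s \<in> line_set p"
        using C_point_in_line[OF s(2)] by blast
      then have "Pt s \<in> line_set p \<or> Pt s \<in> line_set q" using pq0(4) p q by blast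
      then show ?thesis using s(1) by (auto simp: line_set_def circle_of_def)
    next
      case False
      then show ?thesis using x C_top by (auto simp: topspace_freudenthal[OF simple] circle_of_def)
    qed
  next
    fix x assume "x \<in> circle_of G p q"
    then have "x \<in> line_set p \<or> x \<in> line_set q \<or> x \<in> End ` ends G" by (auto simp: circle_of_def line_set_def)
    then show "x \<in> C"
      using C_line_nbhd[OF p(1)] C_line_nbhd[OF q(1)] end_in_C other_end_in_C unfolding ends_eq by blast
  qed
  ultimately show thesis by (rule that)
qed

end

section \<open>The square of the path and the ladder\<close>

definition line_edges :: "(int \<Rightarrow> 'a) \<Rightarrow> 'a set set" where
  "line_edges p = range (\<lambda>i. {p i, p (i + 1)})"

lemma line_edges_reverse: "line_edges (p \<circ> uminus) = line_edges p"
proof -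
  have sub: "line_edges (p \<circ> uminus) \<subseteq> line_edges p" for p :: "int \<Rightarrow> 'a"
  proof
    fix e assume "e \<in> line_edges (p \<circ> uminus)"
    then obtain i where "e = {p (- i), p (- (i + 1))}" by (auto simp: line_edges_def)
    then have "e = {p (- (i + 1)), p (- (i + 1) + 1)}" by (simp add: insert_commute)
    then show "e \<in> line_edges p" unfolding line_edges_def by blast
  qed
  have "(p \<circ> uminus) \<circ> uminus = p" by (simp add: fun_eq_iff)
  then show ?thesis using sub[of p] sub[of "p \<circ> uminus"] by simp
qed

lemma range_line_point:
  "x \<in> range (line_point p) \<longleftrightarrow> (\<exists>u v s. {u, v} \<in> line_edges p \<and> 0 \<le> s \<and> s \<le> 1 \<and> x = edge_point u v s)"
proof
  assume "x \<in> range (line_point p)"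
  then obtain t where "x = edge_point (p \<lfloor>t\<rfloor>) (p (\<lfloor>t\<rfloor> + 1)) (frac t)" by (auto simp: line_point_def)
  moreover have "{p \<lfloor>t\<rfloor>, p (\<lfloor>t\<rfloor> + 1)} \<in> line_edges p" by (simp add: line_edges_def)
  moreover have "0 \<le> frac t" "frac t \<le> 1" using frac_ge_0[of t] frac_lt_1[of t] by simp_all
  ultimately show "\<exists>u v s. {u, v} \<in> line_edges p \<and> 0 \<le> s \<and> s \<le> 1 \<and> x = edge_point u v s" by blast
next
  assume "\<exists>u v s. {u, v} \<in> line_edges p \<and> 0 \<le> s \<and> s \<le> 1 \<and> x = edge_point u v s"
  then obtain u v s i where s: "0 \<le> s" "s \<le> 1" "x = edge_point u v s" and i: "{u, v} = {p i, p (i + 1)}"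
    by (auto simp: line_edges_def)
  from i consider "u = p i" "v = p (i + 1)" | "u = p (i + 1)" "v = p i" by (auto simp: doubleton_eq_iff)
  then show "x \<in> range (line_point p)"
  proof cases
    case 1
    then have "x = line_point p (of_int i + s)" using s line_point_on_interval[of i "of_int i + s" p] by simp
    then show ?thesis by blast
  next
    case 2
    then have "x = edge_point (p i) (p (i + 1)) (1 - s)" using s(3) edge_point_swap[of "p (i + 1)" "p i" s] by simp
    then have "x = line_point p (of_int i + (1 - s))"
      using s line_point_on_interval[of i "of_int i + (1 - s)" p] by simp
    then show ?thesis by blast
  qed
qed

lemma circle_of_points:
  "Pt x \<in> circle_of G p q \<longleftrightarrow>
    (\<exists>u v s. {u, v} \<in> line_edges p \<union> line_edges q \<and> 0 \<le> s \<and> s \<le> 1 \<and> x = edge_point u v s)"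
proof -
  have "Pt x \<in> circle_of G p q \<longleftrightarrow> x \<in> range (line_point p) \<or> x \<in> range (line_point q)"
    by (auto simp: circle_of_def)
  then show ?thesis unfolding range_line_point by blast
qed

context two_sided_graph
begin

lemma ray_pair_edges: "ray_pair p q \<Longrightarrow> line_edges p \<union> line_edges q \<subseteq> edges G"
  unfolding ray_pair_def line_edges_def by blast

text \<open>The two nonzero coordinates of a midpoint reveal its edge, so the point set and the edge
  set of a circle determine each other.\<close>

lemma circle_of_eq_iff:
  assumes "ray_pair p q" "ray_pair p' q'"
  shows "circle_of G p q = circle_of G p' q' \<longleftrightarrow> line_edges p \<union> line_edges q = line_edges p' \<union> line_edges q'"
proof
  assume eq: "line_edges p \<union> line_edges q = line_edges p' \<union> line_edges q'"
  have "x \<in> circle_of G p q \<longleftrightarrow> x \<in> circle_of G p' q'" for x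
  proof (cases x)
    case (Pt r)
    then show ?thesis using eq by (simp add: circle_of_points)
  next
    case (End \<omega>)
    then show ?thesis by (auto simp: circle_of_def)
  qed
  then show "circle_of G p q = circle_of G p' q'" by blast
next
  assume eq: "circle_of G p q = circle_of G p' q'"
  have sub: "line_edges p \<union> line_edges q \<subseteq> line_edges p' \<union> line_edges q'"
    if rp: "ray_pair p q" "ray_pair p' q'" and eq: "circle_of G p q = circle_of G p' q'" for p q p' q'
  proof
    fix e assume e: "e \<in> line_edges p \<union> line_edges q"
    then obtain u v where uv: "e = {u, v}" unfolding line_edges_def by blast
    then have ne: "u \<noteq> v" using e ray_pair_edges[OF rp(1)] edge_verts[OF simple] by blast
    have "Pt (edge_point u v (1 / 2)) \<in> circle_of G p q"
      unfolding circle_of_points using e uv by (intro exI[of _ u] exI[of _ v] exI[of _ "1 / 2"]) simp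
    then obtain u' v' s where s: "{u', v'} \<in> line_edges p' \<union> line_edges q'" "edge_point u v (1 / 2) = edge_point u' v' s"
      unfolding eq circle_of_points by blast
    have "edge_point u' v' s u \<noteq> 0" "edge_point u' v' s v \<noteq> 0"
      unfolding s(2)[symmetric] using ne by (simp_all add: edge_point_simps)
    then have "u \<in> {u', v'}" "v \<in> {u', v'}" using edge_point_simps(5) by (metis insertCI)+
    then have "{u, v} = {u', v'}" using ne by auto
    then show "e \<in> line_edges p' \<union> line_edges q'" using s(1) uv by simp
  qed
  show "line_edges p \<union> line_edges q = line_edges p' \<union> line_edges q'"
    using sub[OF assms eq] sub[OF assms(2,1) eq[symmetric]] by blast
qed

lemma hamiltonian_circle_ray_pair:
  assumes "hamiltonian_circle G C"
  obtains p q where "ray_pair p q" "C = circle_of G p q"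
proof -
  interpret circle_in_graph G A C by unfold_locales (rule assms)
  show thesis using circle_is_ray_pair that by blast
qed

lemma unique_circle_edges:
  assumes "\<exists>!C. hamiltonian_circle G C" "ray_pair p q" "ray_pair p' q'"
  shows "line_edges p \<union> line_edges q = line_edges p' \<union> line_edges q'"
  using assms(1) hamiltonian_circle_of[OF assms(2)] hamiltonian_circle_of[OF assms(3)]
    circle_of_eq_iff[OF assms(2,3)] by metis

lemma unique_circleI:
  assumes rp: "ray_pair p q"
    and uniq: "\<And>p' q'. ray_pair p' q' \<Longrightarrow> line_edges p' \<union> line_edges q' = line_edges p \<union> line_edges q"
  shows "\<exists>!C. hamiltonian_circle G C"
proof (rule ex1I[where a = "circle_of G p q"])
  show "hamiltonian_circle G (circle_of G p q)" by (rule hamiltonian_circle_of[OF rp])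
  fix C assume "hamiltonian_circle G C"
  then obtain p' q' where p': "ray_pair p' q'" "C = circle_of G p' q'" by (rule hamiltonian_circle_ray_pair)
  then show "C = circle_of G p q" using circle_of_eq_iff[OF p'(1) rp] uniq[OF p'(1)] by simp
qed

lemma ray_pair_neighbours:
  assumes rp: "ray_pair p q" and e: "{p i, x} \<in> line_edges p \<union> line_edges q"
  shows "x = p (i - 1) \<or> x = p (i + 1)"
proof -
  note D = ray_pairD[OF rp]
  have "{p i, x} \<notin> line_edges q"
  proof
    assume "{p i, x} \<in> line_edges q"
    then obtain j where "{p i, x} = {q j, q (j + 1)}" unfolding line_edges_def by blast
    then have "p i \<in> {q j, q (j + 1)}" by blast
    then show False using D(3) by auto
  qed
  then obtain j where "{p i, x} = {p j, p (j + 1)}" using e unfolding line_edges_def by blast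
  then have "p i = p j \<and> x = p (j + 1) \<or> p i = p (j + 1) \<and> x = p j" by (auto simp: doubleton_eq_iff)
  then have "i = j \<and> x = p (j + 1) \<or> i = j + 1 \<and> x = p j" using injD[OF D(1)] by blast
  then show ?thesis by auto
qed

end

text \<open>Both model graphs become graphs on the integers in which \<open>k\<close> is adjacent to \<open>k + 2\<close>: the two
  rails of the ladder are the even and the odd integers, with the rungs joining \<open>2k\<close> to \<open>2k + 1\<close>.\<close>

definition stride_adj :: "bool \<Rightarrow> int \<Rightarrow> int \<Rightarrow> bool" where
  "stride_adj S i j \<longleftrightarrow> \<bar>i - j\<bar> = 2 \<or> \<bar>i - j\<bar> = 1 \<and> (S \<or> even (min i j))"

definition stride_labelling :: "bool \<Rightarrow> 'a ugraph \<Rightarrow> (int \<Rightarrow> 'a) \<Rightarrow> bool" where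
  "stride_labelling S G l \<longleftrightarrow> bij_betw l UNIV (verts G) \<and> (\<forall>i j. {l i, l j} \<in> edges G \<longleftrightarrow> stride_adj S i j)"

text \<open>A reflection exchanges the lower and the upper end of a rung; for the new lower end to
  be even again, \<open>c\<close> must be odd.\<close>

lemma stride_adj_reflect: "odd c \<Longrightarrow> stride_adj S (c - i) (c - j) = stride_adj S i j"
  unfolding stride_adj_def by (auto simp: min_def abs_if split: if_splits; presburger)

lemma stride_adj_shift: "even c \<Longrightarrow> stride_adj S (c + i) (c + j) = stride_adj S i j"
  unfolding stride_adj_def by (auto simp: min_def)

lemma stride_labelling_isomorphic:
  assumes H: "verts H = UNIV" and e: "bij e" "\<And>i j. {e i, e j} \<in> edges H \<longleftrightarrow> stride_adj S i j"
  shows "isomorphic G H \<longleftrightarrow> (\<exists>l. stride_labelling S G l)"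
proof
  assume "isomorphic G H"
  then obtain f where f: "bij_betw f (verts G) UNIV"
    "\<And>u v. u \<in> verts G \<Longrightarrow> v \<in> verts G \<Longrightarrow> {u, v} \<in> edges G \<longleftrightarrow> {f u, f v} \<in> edges H"
    unfolding isomorphic_def graph_iso_def H by blast
  define l where "l = (\<lambda>i. inv_into (verts G) f (e i))"
  have g: "bij_betw (inv_into (verts G) f) UNIV (verts G)" by (rule bij_betw_inv_into[OF f(1)])
  have "bij_betw l UNIV (verts G)"
    unfolding l_def using bij_betw_trans[OF e(1) g] by (simp add: o_def)
  moreover from this have lv: "l i \<in> verts G" for i by (auto simp: bij_betw_def)
  moreover have "f (l i) = e i" for i unfolding l_def using f(1) by (simp add: bij_betw_inv_into_right)
  ultimately have "stride_labelling S G l" unfolding stride_labelling_def using f(2) e(2) by simp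
  then show "\<exists>l. stride_labelling S G l" by blast
next
  assume "\<exists>l. stride_labelling S G l"
  then obtain l where l: "bij_betw l UNIV (verts G)" "\<And>i j. {l i, l j} \<in> edges G \<longleftrightarrow> stride_adj S i j"
    unfolding stride_labelling_def by blast
  define f where "f = e \<circ> inv_into UNIV l"
  have "bij_betw (inv_into UNIV l) (verts G) UNIV" by (rule bij_betw_inv_into[OF l(1)])
  then have "bij_betw f (verts G) UNIV" unfolding f_def using bij_betw_trans e(1) by blast
  moreover have "{u, v} \<in> edges G \<longleftrightarrow> {f u, f v} \<in> edges H" if "u \<in> verts G" "v \<in> verts G" for u v
  proof -
    have "l (inv_into UNIV l u) = u" "l (inv_into UNIV l v) = v"
      using l(1) that by (simp_all add: bij_betw_inv_into_right)
    then show ?thesis using l(2)[of "inv_into UNIV l u" "inv_into UNIV l v"] e(2) by (simp add: f_def)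
  qed
  ultimately show "isomorphic G H" unfolding isomorphic_def graph_iso_def H by blast
qed

lemma isomorphic_path_square: "isomorphic G path_square \<longleftrightarrow> (\<exists>l. stride_labelling True G l)"
proof (rule stride_labelling_isomorphic[where e = id])
  fix i j :: int
  have "{i, j} \<in> edges path_square \<longleftrightarrow> (\<exists>a b. {i, j} = {a, b} \<and> \<bar>a - b\<bar> \<in> {1, 2})"
    unfolding path_square_def by auto
  also have "\<dots> \<longleftrightarrow> \<bar>i - j\<bar> \<in> {1, 2}" by (auto simp: doubleton_eq_iff abs_minus_commute)
  finally show "{id i, id j} \<in> edges path_square \<longleftrightarrow> stride_adj True i j" by (auto simp: stride_adj_def)
qed (simp_all add: path_square_def)

lemma isomorphic_ladder: "isomorphic G ladder \<longleftrightarrow> (\<exists>l. stride_labelling False G l)"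
proof (rule stride_labelling_isomorphic[where e = "\<lambda>k. if even k then Inl (k div 2) else Inr (k div 2)"])
  show "bij (\<lambda>k::int. if even k then Inl (k div 2) else Inr (k div 2))"
    by (rule o_bij[where g = "\<lambda>x. case x of Inl i \<Rightarrow> 2 * i | Inr i \<Rightarrow> 2 * i + 1"])
      (auto simp: fun_eq_iff split: sum.split)
  fix i j :: int
  have L: "{Inl a, Inl b} \<in> edges ladder \<longleftrightarrow> \<bar>a - b\<bar> = 1" "{Inr a, Inr b} \<in> edges ladder \<longleftrightarrow> \<bar>a - b\<bar> = 1"
    "{Inl a, Inr b} \<in> edges ladder \<longleftrightarrow> a = b" "{Inr b, Inl a} \<in> edges ladder \<longleftrightarrow> a = b" for a b :: int
  proof -
    have abs: "\<bar>a - b\<bar> = 1 \<longleftrightarrow> b = a + 1 \<or> a = b + 1" by linarith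
    show "{Inl a, Inl b} \<in> edges ladder \<longleftrightarrow> \<bar>a - b\<bar> = 1" "{Inr a, Inr b} \<in> edges ladder \<longleftrightarrow> \<bar>a - b\<bar> = 1"
      "{Inl a, Inr b} \<in> edges ladder \<longleftrightarrow> a = b" "{Inr b, Inl a} \<in> edges ladder \<longleftrightarrow> a = b"
      unfolding ladder_def abs by (auto simp: doubleton_eq_iff image_iff)
  qed
  show "{if even i then Inl (i div 2) else Inr (i div 2), if even j then Inl (j div 2) else Inr (j div 2)} \<in> edges ladder
      \<longleftrightarrow> stride_adj False i j"
  proof (cases "even i"; cases "even j")
    assume "even i" "even j"
    then obtain a b where "i = 2 * a" "j = 2 * b" by (auto elim!: evenE)
    then show ?thesis by (simp add: L stride_adj_def) presburger
  next
    assume "even i" "odd j"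
    then obtain a b where "i = 2 * a" "j = 2 * b + 1" by (auto elim!: evenE oddE)
    then show ?thesis by (simp add: L stride_adj_def min_def) presburger
  next
    assume "odd i" "even j"
    then obtain a b where "i = 2 * a + 1" "j = 2 * b" by (auto elim!: evenE oddE)
    then show ?thesis by (simp add: L stride_adj_def min_def) presburger
  next
    assume "odd i" "odd j"
    then obtain a b where "i = 2 * a + 1" "j = 2 * b + 1" by (auto elim!: oddE)
    then show ?thesis by (simp add: L stride_adj_def) presburger
  qed
qed (simp add: ladder_def)

section \<open>Transitivity and two-endedness of the models\<close>

lemma stride_labelling_reflect:
  assumes "stride_labelling S G l" shows "stride_labelling S G (\<lambda>i. l (1 - i))"
proof -
  have "bij (\<lambda>i::int. 1 - i)" by (rule o_bij[where g = "\<lambda>i. 1 - i"]) (auto simp: fun_eq_iff)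
  from bij_betw_trans[OF this, of l "verts G"] assms show ?thesis
    unfolding stride_labelling_def using stride_adj_reflect[of 1] by (simp add: o_def)
qed

text \<open>Even translations connect positions of equal parity, odd reflections those of different
  parity.\<close>

lemma stride_labelling_transitive:
  assumes l: "stride_labelling S G l" shows "vertex_transitive G"
  unfolding vertex_transitive_def
proof (intro ballI)
  fix u v assume uv: "u \<in> verts G" "v \<in> verts G"
  have bij: "bij_betw l UNIV (verts G)" and adj: "\<And>i j. {l i, l j} \<in> edges G \<longleftrightarrow> stride_adj S i j"
    using l unfolding stride_labelling_def by blast+
  have inv: "bij_betw (inv_into UNIV l) (verts G) UNIV" by (rule bij_betw_inv_into[OF bij])
  obtain i j where ij: "u = l i" "v = l j" using uv bij unfolding bij_betw_def by blast
  obtain g where g: "bij g" "g i = j" "\<And>a b. stride_adj S (g a) (g b) = stride_adj S a b"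
  proof (cases "even (j - i)")
    case True
    show thesis
    proof (rule that[of "\<lambda>k. j - i + k"])
      show "bij (\<lambda>k. j - i + k)" by (rule o_bij[where g = "\<lambda>k. k - (j - i)"]) (auto simp: fun_eq_iff)
    qed (use stride_adj_shift[OF True] in auto)
  next
    case False
    then have odd: "odd (i + j)" by simp
    show thesis
    proof (rule that[of "\<lambda>k. i + j - k"])
      show "bij (\<lambda>k. i + j - k)" by (rule o_bij[where g = "\<lambda>k. i + j - k"]) (auto simp: fun_eq_iff)
    qed (use stride_adj_reflect[OF odd] in auto)
  qed
  define f where "f = l \<circ> (g \<circ> inv_into UNIV l)"
  have "bij_betw f (verts G) (verts G)"
    unfolding f_def by (rule bij_betw_trans[OF bij_betw_trans[OF inv g(1)] bij])
  moreover have "inv_into UNIV l (l k) = k" for k using bij by (simp add: bij_betw_inv_into_left)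
  then have fl: "f (l k) = l (g k)" for k by (simp add: f_def)
  moreover have "{x, y} \<in> edges G \<longleftrightarrow> {f x, f y} \<in> edges G" if xy: "x \<in> verts G" "y \<in> verts G" for x y
  proof -
    obtain a b where "x = l a" "y = l b" using xy bij unfolding bij_betw_def by blast
    then show ?thesis using fl adj g(3) by simp
  qed
  ultimately show "\<exists>f. graph_iso f G G \<and> f u = v"
    using g(2) ij unfolding graph_iso_def by (intro exI[of _ f]) simp
qed

text \<open>Strides of length two connect each parity class from \<open>m\<close> on, and the rung
  at the even position \<open>m\<close>, present in both models, joins the two classes. At most
  \<open>n + 1\<close> lies below \<open>m\<close>, and it is attached by a stride.\<close>

lemma stride_labelling_component:
  assumes l: "stride_labelling S G l" and K: "\<And>i. i > n \<Longrightarrow> l i \<notin> K" and ij: "i > n" "j > n"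
  shows "l j \<in> component_of (delete_verts G K) (l i)"
proof -
  have adj: "{l i, l j} \<in> edges (delete_verts G K)" if "stride_adj S i j" "i > n" "j > n" for i j
    using l that K unfolding stride_labelling_def by simp
  define m where "m = (if even (n + 1) then n + 1 else n + 2)"
  have m: "even m" "m > n" "m \<le> n + 2" by (auto simp: m_def)
  let ?C = "component_of (delete_verts G K) (l m)"
  have up: "l (m + 2 * int k) \<in> ?C \<and> l (m + 1 + 2 * int k) \<in> ?C" for k
  proof (induction k)
    case 0
    have "l (m + 1) \<in> ?C"
      by (rule component_of_step[OF component_of_refl adj]) (use m in \<open>auto simp: stride_adj_def\<close>)
    then show ?case by simp
  next
    case (Suc k)
    have "l (m + 2 * int k + 2) \<in> ?C"
      by (rule component_of_step[OF conjunct1[OF Suc] adj]) (use m in \<open>simp_all add: stride_adj_def\<close>)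
    moreover have "l (m + 1 + 2 * int k + 2) \<in> ?C"
      by (rule component_of_step[OF conjunct2[OF Suc] adj]) (use m in \<open>simp_all add: stride_adj_def\<close>)
    ultimately show ?case by (simp add: algebra_simps)
  qed
  have low: "l (n + 1) \<in> ?C"
  proof (cases "m = n + 1")
    case False
    then have mn: "m = n + 2" using m by auto
    have "l (m + 1) \<in> ?C" using up[of 0] by simp
    then show ?thesis
      by (rule component_of_step[OF _ adj]) (use mn in \<open>auto simp: stride_adj_def\<close>)
  qed simp
  have all: "l k \<in> ?C" if kn: "k > n" for k
  proof -
    consider "k = n + 1" | "k \<ge> m" using kn m by linarith
    then show ?thesis
    proof cases
      case 2
      then have "k = m + 2 * int (nat ((k - m) div 2)) \<or> k = m + 1 + 2 * int (nat ((k - m) div 2))"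
        by simp presburger
      then show ?thesis using up[of "nat ((k - m) div 2)"] by metis
    qed (use low in simp)
  qed
  have "component_of (delete_verts G K) (l i) = ?C"
    by (rule component_of_eq[OF all[OF ij(1)]])
  then show ?thesis using all[OF ij(2)] by simp
qed

lemma stride_labelling_locally_finite:
  assumes l: "stride_labelling S G l" and G: "simple_graph G"
  shows "locally_finite G"
  unfolding locally_finite_def
proof
  fix v assume "v \<in> verts G"
  then obtain i where i: "v = l i" using l unfolding stride_labelling_def bij_betw_def by blast
  have "{u. {v, u} \<in> edges G} \<subseteq> l ` {i - 2..i + 2}"
  proof
    fix u assume u: "u \<in> {u. {v, u} \<in> edges G}"
    then have "u \<in> verts G" using edge_verts[OF G] by blast
    then obtain j where j: "u = l j" using l unfolding stride_labelling_def bij_betw_def by blast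
    then have "stride_adj S i j" using u i l unfolding stride_labelling_def by simp
    then have "j \<in> {i - 2..i + 2}" by (auto simp: stride_adj_def)
    then show "u \<in> l ` {i - 2..i + 2}" using j by blast
  qed
  then show "finite {u. {v, u} \<in> edges G}" using finite_subset by blast
qed

lemma stride_labelling_tail:
  assumes l: "stride_labelling S G l" and K: "finite K" "K \<subseteq> verts G"
  shows "\<exists>C\<in>components (delete_verts G K). finite (l ` {0<..} - C)"
proof -
  have bij: "bij_betw l UNIV (verts G)" using l unfolding stride_labelling_def by blast
  have "finite (l -` K)" by (rule finite_vimageI[OF K(1)]) (use bij in \<open>auto simp: bij_betw_def\<close>)
  then obtain n where n: "\<And>i. l i \<in> K \<Longrightarrow> i \<le> n" using bdd_above_finite[of "l -` K"] unfolding bdd_above_def by blast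
  let ?C = "component_of (delete_verts G K) (l (n + 1))"
  have "l (n + 1) \<notin> K" using n by fastforce
  moreover have "l (n + 1) \<in> verts G" using bij by (auto simp: bij_betw_def)
  ultimately have "?C \<in> components (delete_verts G K)" by (auto simp: components_def)
  moreover have "l ` {0<..} - ?C \<subseteq> l ` {0<..n}"
  proof
    fix x assume "x \<in> l ` {0<..} - ?C"
    then obtain i where i: "x = l i" "i > 0" "l i \<notin> ?C" by auto
    have "\<not> i > n"
    proof
      assume "i > n"
      have "l k \<notin> K" if "k > n" for k using n[of k] that by linarith
      then have "l i \<in> ?C" by (rule stride_labelling_component[OF l]) (use \<open>i > n\<close> in auto)
      then show False using i(3) by simp
    qed
    then show "x \<in> l ` {0<..n}" using i by auto
  qed
  then have "finite (l ` {0<..} - ?C)" using finite_subset by blast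
  ultimately show ?thesis by blast
qed

lemma stride_labelling_two_sided:
  assumes l: "stride_labelling S G l" and G: "simple_graph G"
  shows "two_sided_graph G (l ` {0<..})" "connected_graph G"
proof -
  have bij: "bij_betw l UNIV (verts G)" and adj: "\<And>i j. {l i, l j} \<in> edges G \<longleftrightarrow> stride_adj S i j"
    using l unfolding stride_labelling_def by blast+
  have inj: "inj l" and im: "range l = verts G" using bij by (auto simp: bij_betw_def)
  have compl: "verts G - l ` {0<..} = l ` {..0}"
  proof -
    have "UNIV - {0<..} = {..0::int}" by auto
    then show ?thesis using image_set_diff[OF inj, of UNIV "{0<..}"] im by simp
  qed
  show "two_sided_graph G (l ` {0<..})"
  proof
    show "simple_graph G" by (rule G)
    show "locally_finite G" by (rule stride_labelling_locally_finite[OF l G])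
    show "l ` {0<..} \<subseteq> verts G" using im by blast
    show "infinite (l ` {0<..})" "infinite (verts G - l ` {0<..})"
      unfolding compl using inj infinite_Ioi[of "0::int"] infinite_Iic[of "0::int"]
      by (auto dest!: finite_imageD intro: inj_on_subset)
    show "finite (boundary G (l ` {0<..}))"
    proof (rule finite_subset)
      show "boundary G (l ` {0<..}) \<subseteq> l ` {-2..2}"
      proof
        fix v assume "v \<in> boundary G (l ` {0<..})"
        then obtain u where u: "v \<in> verts G" "{u, v} \<in> edges G" "(u \<in> l ` {0<..}) \<noteq> (v \<in> l ` {0<..})"
          by (auto simp: boundary_def)
        then obtain i j where ij: "v = l i" "u = l j" using im edge_verts[OF G u(2)] by blast
        then have "stride_adj S j i" "(j > 0) \<noteq> (i > 0)" using u adj inj by (auto simp: inj_image_mem_iff)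
        then show "v \<in> l ` {-2..2}" using ij by (auto simp: stride_adj_def)
      qed
    qed simp
    fix K assume K: "finite K" "K \<subseteq> verts G"
    show "\<exists>C\<in>components (delete_verts G K). finite (l ` {0<..} - C)"
      by (rule stride_labelling_tail[OF l K])
    \<comment> \<open>The other side consists of the positive positions of the reflected labelling,
      so the same tail lemma applies to it.\<close>
    have "(\<lambda>i. l (1 - i)) ` {0<..} = l ` {..0}"
    proof -
      have "(\<lambda>i::int. 1 - i) ` {0<..} = {..0}"
        by (auto simp: image_iff intro!: bexI[of _ "1 - _"])
      then show ?thesis by (metis image_image)
    qed
    then show "\<exists>C\<in>components (delete_verts G K). finite (verts G - l ` {0<..} - C)"
      using stride_labelling_tail[OF stride_labelling_reflect[OF l] K] by (simp add: compl)
  qed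
  have del: "delete_verts G {} = G" by (simp add: delete_verts_def)
  have "l j \<in> component_of G (l i)" for i j
    using stride_labelling_component[OF l, of "min i j - 1" "{}" i j] by (simp add: del)
  then have "component_of G (l i) = component_of G (l 0)" for i by (rule component_of_eq)
  then have "component_of G ` verts G = (\<lambda>_. component_of G (l 0)) ` verts G"
    unfolding im[symmetric] by (intro image_cong) auto
  moreover have "l 0 \<in> verts G" using im by blast
  ultimately have "components G = {component_of G (l 0)}"
    unfolding components_def using image_constant by metis
  then show "connected_graph G" unfolding connected_graph_def by blast
qed

lemma int_crossing:
  fixes P :: "int \<Rightarrow> bool"
  assumes "P a" "\<And>i. i \<ge> b \<Longrightarrow> \<not> P i"
  shows "\<exists>i. P i \<and> \<not> P (i + 1)"
proof (rule ccontr)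
  assume "\<not> ?thesis"
  then have step: "P i \<Longrightarrow> P (i + 1)" for i by blast
  have "P i" if "i \<ge> a" for i
    using that by (induction i rule: int_ge_induct) (use assms(1) step in auto)
  then show False using assms(2)[of "max a b"] by simp
qed

text \<open>A cut between \<open>n\<close> and \<open>n + 1\<close> has at most three edges, and the only two of them without a
  common vertex are those of length 2. Each of the two rays crosses the cut.\<close>

lemma stride_labelling_ray_pair_edges:
  assumes l: "stride_labelling S G l" and G: "simple_graph G"
    and rp: "two_sided_graph.ray_pair G (l ` {0<..}) p q"
  shows "{l n, l (n + 2)} \<in> line_edges p \<union> line_edges q"
proof -
  interpret two_sided_graph G "l ` {0<..}" by (rule stride_labelling_two_sided(1)[OF l G])
  have bij: "bij_betw l UNIV (verts G)" and adj: "\<And>i j. {l i, l j} \<in> edges G \<longleftrightarrow> stride_adj S i j"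
    using l unfolding stride_labelling_def by blast+
  have inj: "inj l" and im: "range l = verts G" using bij by (auto simp: bij_betw_def)
  have cross: "\<exists>i a b. a \<le> m \<and> m < b \<and> r i = l a \<and> r (i + 1) = l b \<and> stride_adj S a b"
    if r: "inj r" "leads r" "range r \<subseteq> verts G" "\<forall>i. {r i, r (i + 1)} \<in> edges G" for r m
  proof -
    define f where "f = (\<lambda>i. inv l (r i))"
    have lf: "l (f i) = r i" for i
    proof -
      have "r i \<in> range l" using r(3) im by blast
      then show ?thesis unfolding f_def by (rule f_inv_into_f)
    qed
    have injf: "inj f" using lf r(1) unfolding inj_def by metis
    obtain N M where N: "\<forall>i\<ge>N. r i \<in> l ` {0<..}" and M: "\<forall>i\<le>M. r i \<notin> l ` {0<..}"
      using r(2) unfolding leads_def by blast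
    have pos: "f i > 0" if i: "i \<ge> N" for i
    proof -
      have "r i \<in> l ` {0<..}" using N i by blast
      then obtain k where "k > 0" "r i = l k" by auto
      then show ?thesis using lf[of i] inj by (auto simp: inj_eq)
    qed
    have neg: "f i \<le> 0" if "i \<le> M" for i
      using M[rule_format, OF that] unfolding lf[of i, symmetric] by (auto simp: not_less)
    \<comment> \<open>Positions are injective, so far out on the ray they leave the interval of
      radius \<open>\<bar>m\<bar>\<close>; then their sign decides on which side of \<open>m\<close>
      they lie.\<close>
    have fin: "finite (f -` {- \<bar>m\<bar>..\<bar>m\<bar>})" by (rule finite_vimageI[OF _ injf]) simp
    obtain B where B: "\<And>i. i \<in> f -` {- \<bar>m\<bar>..\<bar>m\<bar>} \<Longrightarrow> i \<le> B"
      using bdd_above_finite[OF fin] unfolding bdd_above_def by blast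
    obtain B' where B': "\<And>i. i \<in> f -` {- \<bar>m\<bar>..\<bar>m\<bar>} \<Longrightarrow> B' \<le> i"
      using bdd_below_finite[OF fin] unfolding bdd_below_def by blast
    have "f (min M (B' - 1)) \<notin> {- \<bar>m\<bar>..\<bar>m\<bar>}" using B'[of "min M (B' - 1)"] by fastforce
    then have low: "f (min M (B' - 1)) \<le> m" using neg[of "min M (B' - 1)"] by auto
    have high: "\<not> f i \<le> m" if "i \<ge> max N (B + 1)" for i
    proof -
      have "f i \<notin> {- \<bar>m\<bar>..\<bar>m\<bar>}" using B[of i] that by fastforce
      then show ?thesis using pos[of i] that by auto
    qed
    obtain i where i: "f i \<le> m" "\<not> f (i + 1) \<le> m"
      using int_crossing[of "\<lambda>i. f i \<le> m", OF low high] by blast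
    have "stride_adj S (f i) (f (i + 1))" using r(4) adj[of "f i" "f (i + 1)"] by (simp add: lf)
    then show ?thesis using i lf by (intro exI[of _ i] exI[of _ "f i"] exI[of _ "f (i + 1)"]) auto
  qed
  note D = ray_pairD[OF rp]
  \<comment> \<open>The cut lies between \<open>n + 1\<close> and \<open>n + 2\<close>. It is
    crossed by at most the edges from \<open>n\<close> to \<open>n + 2\<close>, from
    \<open>n + 1\<close> to \<open>n + 2\<close> and from \<open>n + 1\<close> to
    \<open>n + 3\<close>, and two disjoint ones among them include the first.\<close>
  obtain i a b where p: "a \<le> n + 1" "n + 1 < b" "p i = l a" "p (i + 1) = l b" "stride_adj S a b"
    using cross[OF D(1,9,5,7)] by blast
  obtain j c d where q: "c \<le> n + 1" "n + 1 < d" "q j = l c" "q (j + 1) = l d" "stride_adj S c d"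
    using cross[OF D(2,10,6,8)] by blast
  have "p i \<noteq> q j" "p (i + 1) \<noteq> q (j + 1)" using D(3) by (metis disjoint_iff rangeI)+
  then have "a \<noteq> c" "b \<noteq> d" using p q by auto
  then have "a = n \<and> b = n + 2 \<or> c = n \<and> d = n + 2"
    using p(1,2,5) q(1,2,5) unfolding stride_adj_def by auto
  then show ?thesis
  proof
    assume "a = n \<and> b = n + 2"
    then have "{l n, l (n + 2)} = {p i, p (i + 1)}" using p by simp
    then show ?thesis unfolding line_edges_def by blast
  next
    assume "c = n \<and> d = n + 2"
    then have "{l n, l (n + 2)} = {q j, q (j + 1)}" using q by simp
    then show ?thesis unfolding line_edges_def by blast
  qed
qed

text \<open>Every ray pair contains all edges of length two. They already provide each vertex with
  two neighbours on its ray, so no edge of length one can occur.\<close>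

lemma stride_labelling_unique_circle:
  assumes l: "stride_labelling S G l" and G: "simple_graph G"
  shows "\<exists>!C. hamiltonian_circle G C"
proof -
  interpret two_sided_graph G "l ` {0<..}" by (rule stride_labelling_two_sided(1)[OF l G])
  have bij: "bij_betw l UNIV (verts G)" and adj: "\<And>i j. {l i, l j} \<in> edges G \<longleftrightarrow> stride_adj S i j"
    using l unfolding stride_labelling_def by blast+
  have inj: "inj l" and im: "range l = verts G" using bij by (auto simp: bij_betw_def)
  define p q where "p = (\<lambda>i. l (2 * i))" and "q = (\<lambda>i. l (2 * i + 1))"
  have "ray_pair p q"
    unfolding ray_pair_def
  proof (intro conjI)
    show "inj p" "inj q" unfolding p_def q_def by (auto intro!: injI dest!: injD[OF inj])
    have "2 * i \<noteq> 2 * j + 1" for i j :: int by presburger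
    then show "range p \<inter> range q = {}" unfolding p_def q_def using inj by (auto simp: inj_eq)
    have "l k \<in> range p \<union> range q" for k
    proof (cases "even k")
      case True
      then have "l k = p (k div 2)" by (simp add: p_def)
      then show ?thesis by blast
    next
      case False
      then have "l k = q (k div 2)" by (simp add: q_def)
      then show ?thesis by blast
    qed
    then have "range l \<subseteq> range p \<union> range q" by (rule image_subsetI)
    moreover have "range p \<union> range q \<subseteq> range l" unfolding p_def q_def by blast
    ultimately show "range p \<union> range q = verts G" unfolding im by blast
    show "\<forall>i. {p i, p (i + 1)} \<in> edges G" "\<forall>i. {q i, q (i + 1)} \<in> edges G"
      unfolding p_def q_def adj by (simp_all add: stride_adj_def)
    have p1: "\<forall>i\<ge>1. p i \<in> l ` {0<..}" "\<forall>i\<le>-1. p i \<notin> l ` {0<..}"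
      "\<forall>i\<ge>1. q i \<in> l ` {0<..}" "\<forall>i\<le>-1. q i \<notin> l ` {0<..}"
      unfolding p_def q_def using inj by (auto simp: inj_image_mem_iff)
    then show "leads p" "leads q" unfolding leads_def by blast+
  qed
  moreover have "line_edges p' \<union> line_edges q' = line_edges p \<union> line_edges q" if rp: "ray_pair p' q'" for p' q'
  proof
    have e: "{l n, l (n + 2)} \<in> line_edges p' \<union> line_edges q'" for n
      by (rule stride_labelling_ray_pair_edges[OF l G rp])
    show "line_edges p \<union> line_edges q \<subseteq> line_edges p' \<union> line_edges q'"
    proof
      fix x assume "x \<in> line_edges p \<union> line_edges q"
      then obtain i where "x = {p i, p (i + 1)} \<or> x = {q i, q (i + 1)}"
        unfolding line_edges_def by blast
      then have "x = {l (2 * i), l (2 * i + 2)} \<or> x = {l (2 * i + 1), l (2 * i + 1 + 2)}"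
        by (simp add: p_def q_def add.commute)
      then show "x \<in> line_edges p' \<union> line_edges q'" using e by blast
    qed
    have e': "{l n, l (n + 2)} \<in> line_edges p \<union> line_edges q" for n
    proof (cases "even n")
      case True
      then obtain m where "n = 2 * m" by (rule evenE)
      then have "{l n, l (n + 2)} = {p m, p (m + 1)}" by (simp add: p_def algebra_simps)
      then show ?thesis unfolding line_edges_def by blast
    next
      case False
      then obtain m where "n = 2 * m + 1" by (rule oddE)
      then have "{l n, l (n + 2)} = {q m, q (m + 1)}" by (simp add: q_def algebra_simps)
      then show ?thesis unfolding line_edges_def by blast
    qed
    have sub: "line_edges r \<subseteq> line_edges p \<union> line_edges q"
      if rs: "ray_pair r s" "\<And>n. {l n, l (n + 2)} \<in> line_edges r \<union> line_edges s" for r s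
    proof
      fix x assume "x \<in> line_edges r"
      then obtain i where x: "x = {r i, r (i + 1)}" unfolding line_edges_def by blast
      have "r i \<in> range l" using ray_pairD(5)[OF rs(1)] im by blast
      then obtain k where k: "r i = l k" by blast
      have "l (k + 2) = r (i - 1) \<or> l (k + 2) = r (i + 1)"
        using ray_pair_neighbours[OF rs(1), of i "l (k + 2)"] rs(2)[of k] k by simp
      moreover have "l (k - 2) = r (i - 1) \<or> l (k - 2) = r (i + 1)"
        using ray_pair_neighbours[OF rs(1), of i "l (k - 2)"] rs(2)[of "k - 2"] k by (simp add: insert_commute)
      moreover have "l (k + 2) \<noteq> l (k - 2)" using inj by (simp add: inj_eq)
      ultimately have "r (i + 1) = l (k + 2) \<or> r (i + 1) = l (k - 2)" by metis
      then show "x \<in> line_edges p \<union> line_edges q"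
        using e'[of k] e'[of "k - 2"] unfolding x k by (auto simp: insert_commute)
    qed
    show "line_edges p' \<union> line_edges q' \<subseteq> line_edges p \<union> line_edges q"
      using sub[OF rp e] sub[OF ray_pair_swap[OF rp]] e by blast
  qed
  ultimately show ?thesis by (rule unique_circleI)
qed

text \<open>An injective walk on a line of integers cannot turn back, so all its steps equal the
  first one.\<close>

lemma standard_walk:
  assumes inj: "inj w" and step: "\<And>i. standard_edge (w i) (w (i + 1))"
  shows "\<exists>z \<epsilon> c. \<epsilon> \<in> {1, -1 :: int} \<and> (\<forall>i. w i = (z, \<epsilon> * i + c))"
proof -
  define z where "z = fst (w 0)"
  have z: "fst (w i) = z" for i
  proof (induction i rule: int_induct[where k = 0])
    case (step1 i)
    then show ?case using step[of i] by (simp add: standard_edge_def)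
  next
    case (step2 i)
    then show ?case using step[of "i - 1"] by (simp add: standard_edge_def)
  qed (simp add: z_def)
  define f where "f = (\<lambda>i. snd (w i))"
  have w: "w i = (z, f i)" for i using z[of i] by (simp add: f_def prod_eq_iff)
  have d: "\<bar>f (i + 1) - f i\<bar> = 1" for i using step[of i] by (simp add: f_def standard_edge_def abs_minus_commute)
  have ne: "f (i + 1) \<noteq> f (i - 1)" for i
  proof
    assume "f (i + 1) = f (i - 1)"
    then have "w (i + 1) = w (i - 1)" using w[of "i + 1"] w[of "i - 1"] by simp
    then show False using injD[OF inj, of "i + 1" "i - 1"] by simp
  qed
  have const: "f (i + 1) - f i = f i - f (i - 1)" for i
  proof -
    have "\<bar>f i - f (i - 1)\<bar> = 1" using d[of "i - 1"] by simp
    then show ?thesis using d[of i] ne[of i] by linarith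
  qed
  define \<epsilon> where "\<epsilon> = f 1 - f 0"
  have diff: "f (i + 1) - f i = \<epsilon>" for i
  proof (induction i rule: int_induct[where k = 0])
    case (step1 i)
    then show ?case using const[of "i + 1"] by simp
  next
    case (step2 i)
    then show ?case using const[of i] by simp
  qed (simp add: \<epsilon>_def)
  have lin: "f i = \<epsilon> * i + f 0" for i
  proof (induction i rule: int_induct[where k = 0])
    case (step1 i)
    then show ?case using diff[of i] by (simp add: algebra_simps)
  next
    case (step2 i)
    then show ?case using diff[of "i - 1"] by (simp add: algebra_simps)
  qed simp
  have "w i = (z, \<epsilon> * i + f 0)" for i by (simp only: w[of i] lin[of i, symmetric])
  moreover have "\<epsilon> \<in> {1, -1}" using d[of 0] by (auto simp: \<epsilon>_def abs_if split: if_splits)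
  ultimately show ?thesis by (intro exI[of _ z] exI[of _ \<epsilon>] exI[of _ "f 0"]) simp
qed

section \<open>The classification\<close>

context two_sided_graph
begin

text \<open>The preimage \<open>B\<close> of \<open>A\<close> has a finite boundary as well, and
  once this is deleted each tail lies inside or outside \<open>B\<close>. Since \<open>B\<close> and
  its complement are infinite, exactly one tail lies inside. In the first alternative
  \<open>f\<close> fixes the ends, in the second it exchanges them.\<close>

lemma automorphism_sides:
  assumes f: "graph_iso f G G"
  defines "B \<equiv> {v \<in> verts G. f v \<in> A}"
  shows "finite (A - B) \<and> finite (B - A) \<or> finite (A \<inter> B) \<and> finite (verts G - A - B)"
proof -
  have bij: "bij_betw f (verts G) (verts G)"
    and adj: "\<And>u v. u \<in> verts G \<Longrightarrow> v \<in> verts G \<Longrightarrow> {u, v} \<in> edges G \<longleftrightarrow> {f u, f v} \<in> edges G"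
    using f unfolding graph_iso_def by blast+
  have inj: "inj_on f (verts G)" and im: "f ` verts G = verts G" using bij by (auto simp: bij_betw_def)
  have Bv: "B \<subseteq> verts G" by (auto simp: B_def)
  have pre: "\<exists>v\<in>verts G. x = f v" if "x \<in> verts G" for x
  proof -
    have "x \<in> f ` verts G" using that by (simp only: im)
    then show ?thesis by blast
  qed
  have fB: "f ` B = A"
  proof (intro equalityI subsetI)
    fix x assume "x \<in> A"
    moreover from this obtain v where "v \<in> verts G" "x = f v" using pre side(1) by blast
    ultimately show "x \<in> f ` B" unfolding B_def by blast
  qed (auto simp: B_def)
  have fB': "f ` (verts G - B) = verts G - A"
  proof (intro equalityI subsetI)
    fix x assume "x \<in> verts G - A"
    moreover from this obtain v where "v \<in> verts G" "x = f v" using pre by blast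
    ultimately show "x \<in> f ` (verts G - B)" unfolding B_def by blast
  next
    fix x assume "x \<in> f ` (verts G - B)"
    then obtain v where "v \<in> verts G" "f v \<notin> A" "x = f v" unfolding B_def by blast
    then show "x \<in> verts G - A" using bij_betw_apply[OF bij] by blast
  qed
  have inf: "infinite B" "infinite (verts G - B)"
    using side(2,3) fB fB' finite_imageI by metis+
  define K where "K = boundary G B"
  have "f ` K \<subseteq> boundary G A"
  proof
    fix x assume "x \<in> f ` K"
    then obtain v u where v: "x = f v" "v \<in> verts G" "{u, v} \<in> edges G" "(u \<in> B) \<noteq> (v \<in> B)"
      by (auto simp: K_def boundary_def)
    have u: "u \<in> verts G" using edge_verts[OF simple v(3)] by blast
    then have "{f u, f v} \<in> edges G" "f v \<in> verts G" "(f u \<in> A) \<noteq> (f v \<in> A)"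
      using adj[OF u v(2)] v im by (auto simp: B_def)
    then show "x \<in> boundary G A" unfolding boundary_def v(1) by blast
  qed
  then have "finite (f ` K)" using side(4) finite_subset by blast
  moreover have Kv: "K \<subseteq> verts G" by (auto simp: K_def boundary_def)
  ultimately have "finite K" using finite_imageD inj_on_subset[OF inj Kv] by blast
  with Kv have K: "K \<in> finite_verts G" by (simp add: finite_verts_def)
  have one: "C \<subseteq> B \<or> C \<inter> B = {}" if C: "C \<in> components (delete_verts G K)" for C
  proof -
    obtain v where v: "v \<in> verts G - K" "C = component_of (delete_verts G K) v" using C by (auto simp: components_def)
    have "C \<subseteq> (if v \<in> B then B else verts G - B)"
      unfolding v(2) by (rule boundary_component[OF simple _ v(1)]) (simp add: K_def)
    then show ?thesis by (cases "v \<in> B") auto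
  qed
  note finA = tail_finite[OF K] and finB = tails_complement(2)[OF K]
  let ?C = "tail G A K" and ?D = "tail G (verts G - A) K"
  have cov: "X \<subseteq> (A - ?C) \<union> (verts G - A - ?D)" if "X \<subseteq> verts G" "X \<inter> ?C = {}" "X \<inter> ?D = {}" for X
    using that by blast
  have fin: "finite X" if "X \<subseteq> (A - ?C) \<union> (verts G - A - ?D)" for X
    using that finA finB by (meson finite_UnI finite_subset)
  consider "?C \<subseteq> B" "?D \<subseteq> B" | "?C \<inter> B = {}" "?D \<inter> B = {}" | "?C \<subseteq> B" "?D \<inter> B = {}" | "?C \<inter> B = {}" "?D \<subseteq> B"
    using one[OF tail_component[OF K]] one[OF tails_complement(1)[OF K]] by blast
  then show ?thesis
  proof cases
    case 1
    then have "finite (verts G - B)" by (intro fin cov) auto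
    then show ?thesis using inf by simp
  next
    case 2
    then have "finite B" using Bv by (intro fin cov) auto
    then show ?thesis using inf by simp
  next
    case 3
    then have "finite (A - B)" "finite (B - A)" using Bv by (intro fin; blast)+
    then show ?thesis by simp
  next
    case 4
    then have "finite (A \<inter> B)" "finite (verts G - A - B)" using Bv by (intro fin; blast)+
    then show ?thesis by simp
  qed
qed

lemma eventually_not_in_finite:
  fixes p :: "int \<Rightarrow> 'a"
  assumes "inj p" "finite X"
  obtains N where "N > 0" "\<And>i. \<bar>i\<bar> \<ge> N \<Longrightarrow> p i \<notin> X"
proof -
  have fin: "finite (p -` X)" by (rule finite_vimageI[OF assms(2,1)])
  have "\<bar>i\<bar> < Max (insert 0 (abs ` (p -` X))) + 1" if "p i \<in> X" for i
  proof -
    have "\<bar>i\<bar> \<le> Max (insert 0 (abs ` (p -` X)))" using fin that by (intro Max_ge) auto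
    then show ?thesis by simp
  qed
  moreover have "Max (insert 0 (abs ` (p -` X))) + 1 > 0" using fin by (simp add: add_pos_nonneg add.commute add_nonneg_pos)
  ultimately show thesis using that[of "Max (insert 0 (abs ` (p -` X))) + 1"] by (meson not_less)
qed

text \<open>An automorphism exchanging the ends reverses both rays at once, which accounts for the
  second alternative.\<close>

lemma ray_pair_automorphism:
  assumes f: "graph_iso f G G" and rp: "ray_pair p q"
  shows "ray_pair (f \<circ> p) (f \<circ> q) \<or> ray_pair (f \<circ> p \<circ> uminus) (f \<circ> q \<circ> uminus)"
proof -
  note D = ray_pairD[OF rp]
  have bij: "bij_betw f (verts G) (verts G)"
    and adj: "\<And>u v. u \<in> verts G \<Longrightarrow> v \<in> verts G \<Longrightarrow> {u, v} \<in> edges G \<longleftrightarrow> {f u, f v} \<in> edges G"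
    using f unfolding graph_iso_def by blast+
  have inj: "inj_on f (verts G)" and im: "f ` verts G = verts G" using bij by (auto simp: bij_betw_def)
  have pv: "p i \<in> verts G" "q i \<in> verts G" for i using D(5,6) by blast+
  have 1: "inj (f \<circ> p)" "inj (f \<circ> q)"
    using comp_inj_on[OF D(1)] comp_inj_on[OF D(2)] inj_on_subset[OF inj] D(5,6) by blast+
  have 2: "range (f \<circ> p) \<inter> range (f \<circ> q) = {}"
  proof -
    have "f (p i) \<noteq> f (q j)" for i j using inj_onD[OF inj _ pv(1) pv(2)] D(3) by (metis disjoint_iff rangeI)
    then show ?thesis by auto
  qed
  have 3: "range (f \<circ> p) \<union> range (f \<circ> q) = verts G"
    using im unfolding D(4)[symmetric] image_Un by (simp add: image_comp)
  have 4: "\<forall>i. {(f \<circ> p) i, (f \<circ> p) (i + 1)} \<in> edges G" "\<forall>i. {(f \<circ> q) i, (f \<circ> q) (i + 1)} \<in> edges G"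
    using D(7,8) adj pv by simp_all
  have inj_rev: "inj (g \<circ> uminus)" if "inj g" for g :: "int \<Rightarrow> 'a"
    using that by (intro inj_compose) (auto simp: inj_def)
  have rng_rev: "range (g \<circ> uminus) = range g" for g :: "int \<Rightarrow> 'a"
    by (metis image_comp surj_uminus)
  have 5: "\<forall>i. {(g \<circ> uminus) i, (g \<circ> uminus) (i + 1)} \<in> edges G" if g: "\<forall>i. {g i, g (i + 1)} \<in> edges G"
    for g :: "int \<Rightarrow> 'a"
  proof
    fix i show "{(g \<circ> uminus) i, (g \<circ> uminus) (i + 1)} \<in> edges G"
      using g[rule_format, of "- (i + 1)"] by (simp add: insert_commute)
  qed
  let ?B = "{v \<in> verts G. f v \<in> A}"
  have same: "leads (f \<circ> r)" if r: "inj r" "leads r" "range r \<subseteq> verts G" and fin: "finite (A - ?B)" "finite (?B - A)" for r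
  proof -
    obtain N where N: "N > 0" "\<And>i. \<bar>i\<bar> \<ge> N \<Longrightarrow> r i \<notin> (A - ?B) \<union> (?B - A)"
      by (rule eventually_not_in_finite[OF r(1) finite_UnI[OF fin]]) blast
    have iff: "f (r i) \<in> A \<longleftrightarrow> r i \<in> A" if "\<bar>i\<bar> \<ge> N" for i
      using N(2)[OF that] r(3) by blast
    obtain M M' where "\<forall>i\<ge>M. r i \<in> A" "\<forall>i\<le>M'. r i \<notin> A" using r(2) unfolding leads_def by blast
    then have "\<forall>i\<ge>max M N. (f \<circ> r) i \<in> A" "\<forall>i\<le>min M' (- N). (f \<circ> r) i \<notin> A" using iff N(1) by auto
    then show ?thesis unfolding leads_def by blast
  qed
  have swap: "leads (f \<circ> r \<circ> uminus)"
    if r: "inj r" "leads r" "range r \<subseteq> verts G" and fin: "finite (A \<inter> ?B)" "finite (verts G - A - ?B)" for r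
  proof -
    obtain N where N: "N > 0" "\<And>i. \<bar>i\<bar> \<ge> N \<Longrightarrow> r i \<notin> (A \<inter> ?B) \<union> (verts G - A - ?B)"
      by (rule eventually_not_in_finite[OF r(1) finite_UnI[OF fin]]) blast
    have iff: "f (r i) \<in> A \<longleftrightarrow> r i \<notin> A" if "\<bar>i\<bar> \<ge> N" for i
      using N(2)[OF that] r(3) by blast
    obtain M M' where "\<forall>i\<ge>M. r i \<in> A" "\<forall>i\<le>M'. r i \<notin> A" using r(2) unfolding leads_def by blast
    then have "\<forall>i\<ge>max (- M') N. (f \<circ> r \<circ> uminus) i \<in> A" "\<forall>i\<le>min (- M) (- N). (f \<circ> r \<circ> uminus) i \<notin> A"
      using iff N(1) by auto
    then show ?thesis unfolding leads_def by blast
  qed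
  from automorphism_sides[OF f] show ?thesis
  proof (elim disjE conjE)
    assume "finite (A - ?B)" "finite (?B - A)"
    then have "leads (f \<circ> p)" "leads (f \<circ> q)" using same D by blast+
    then show ?thesis unfolding ray_pair_def using 1 2 3 4 by blast
  next
    assume "finite (A \<inter> ?B)" "finite (verts G - A - ?B)"
    then have "leads (f \<circ> p \<circ> uminus)" "leads (f \<circ> q \<circ> uminus)" using swap D by blast+
    then show ?thesis
      unfolding ray_pair_def rng_rev using inj_rev[OF 1(1)] inj_rev[OF 1(2)] 2 3 5[OF 4(1)] 5[OF 4(2)] by blast
  qed
qed

end

section \<open>The labelled rays as a rigid relation\<close>

locale unique_circle = two_sided_graph +
  fixes p q :: "int \<Rightarrow> 'a"
  assumes rp: "ray_pair p q" and unique: "\<exists>!C. hamiltonian_circle G C"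
    and conn: "connected_graph G" and vt: "vertex_transitive G"
begin

definition lab :: "bool \<times> int \<Rightarrow> 'a" where
  "lab v = (if fst v then q (snd v) else p (snd v))"

definition H :: "bool \<times> int \<Rightarrow> bool \<times> int \<Rightarrow> bool" where
  "H u v \<longleftrightarrow> {lab u, lab v} \<in> edges G"

lemma lab_simps [simp]: "lab (False, i) = p i" "lab (True, i) = q i"
  by (simp_all add: lab_def)

lemmas rays = ray_pairD[OF rp]

lemma inj_lab: "inj lab"
proof (rule injI)
  fix u v assume "lab u = lab v"
  moreover have "p i \<noteq> q j" for i j using rays(3) by (metis disjoint_iff rangeI)
  ultimately show "u = v"
    using rays(1,2) by (cases u; cases v) (auto simp: lab_def inj_eq split: if_splits; metis)
qed

lemma range_lab: "range lab = verts G"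
proof -
  have "range lab = range p \<union> range q"
  proof (intro equalityI subsetI)
    fix x assume "x \<in> range p \<union> range q"
    then obtain i where "x = lab (False, i) \<or> x = lab (True, i)" by auto
    then show "x \<in> range lab" by blast
  qed (auto simp: lab_def)
  then show ?thesis using rays(4) by simp
qed

lemma lab_edges: "{lab u, lab v} \<in> line_edges p \<union> line_edges q \<Longrightarrow> standard_edge u v"
proof -
  assume "{lab u, lab v} \<in> line_edges p \<union> line_edges q"
  then obtain i where "{lab u, lab v} = {lab (False, i), lab (False, i + 1)} \<or>
      {lab u, lab v} = {lab (True, i), lab (True, i + 1)}"
    unfolding line_edges_def by auto
  then obtain z where "{lab u, lab v} = {lab (z, i), lab (z, i + 1)}" by blast
  then have "u = (z, i) \<and> v = (z, i + 1) \<or> u = (z, i + 1) \<and> v = (z, i)"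
    using inj_lab by (auto simp: doubleton_eq_iff inj_eq)
  then show ?thesis by (auto simp: standard_edge_def)
qed

lemma sides: obtains N where "N > 0" "\<And>z i. i \<ge> N \<Longrightarrow> lab (z, i) \<in> A" "\<And>z i. i \<le> - N \<Longrightarrow> lab (z, i) \<notin> A"
proof -
  obtain M1 M2 where p: "\<forall>i\<ge>M1. p i \<in> A" "\<forall>i\<le>M2. p i \<notin> A" using rays(9) unfolding leads_def by blast
  obtain N1 N2 where q: "\<forall>i\<ge>N1. q i \<in> A" "\<forall>i\<le>N2. q i \<notin> A" using rays(10) unfolding leads_def by blast
  show thesis
    by (rule that[of "\<bar>M1\<bar> + \<bar>M2\<bar> + \<bar>N1\<bar> + \<bar>N2\<bar> + 1"]) (use p q in \<open>auto simp: lab_def\<close>)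
qed

text \<open>Bounded displacement of the positions is what makes the new rays lead from the
  complement to \<open>A\<close>.\<close>

lemma two_rays_ray_pair:
  assumes "bij \<Phi>" "\<And>s i. H (\<Phi> (s, i)) (\<Phi> (s, i + 1))" "\<And>s i. \<bar>snd (\<Phi> (s, i)) - i\<bar> \<le> B"
  shows "ray_pair (\<lambda>i. lab (\<Phi> (False, i))) (\<lambda>i. lab (\<Phi> (True, i)))"
  unfolding ray_pair_def
proof (intro conjI)
  have inj: "inj (\<lambda>v. lab (\<Phi> v))" using inj_compose[OF inj_lab bij_is_inj[OF assms(1)]] by (simp add: comp_def)
  show "inj (\<lambda>i. lab (\<Phi> (False, i)))" "inj (\<lambda>i. lab (\<Phi> (True, i)))"
    by (auto intro!: injI dest!: injD[OF inj])
  show "range (\<lambda>i. lab (\<Phi> (False, i))) \<inter> range (\<lambda>i. lab (\<Phi> (True, i))) = {}"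
    by (auto dest!: injD[OF inj])
  show "range (\<lambda>i. lab (\<Phi> (False, i))) \<union> range (\<lambda>i. lab (\<Phi> (True, i))) = verts G"
  proof (intro equalityI subsetI)
    fix x assume "x \<in> verts G"
    then obtain u where "x = lab u" using range_lab by blast
    moreover obtain s i where "u = \<Phi> (s, i)" using bij_is_surj[OF assms(1)] by (metis surjD surj_pair)
    ultimately show "x \<in> range (\<lambda>i. lab (\<Phi> (False, i))) \<union> range (\<lambda>i. lab (\<Phi> (True, i)))"
      by (cases s) auto
  qed (use range_lab in blast)
  show "\<forall>i. {lab (\<Phi> (False, i)), lab (\<Phi> (False, i + 1))} \<in> edges G"
    "\<forall>i. {lab (\<Phi> (True, i)), lab (\<Phi> (True, i + 1))} \<in> edges G"
    using assms(2) by (simp_all add: H_def)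
  obtain N where N: "N > 0" "\<And>z i. i \<ge> N \<Longrightarrow> lab (z, i) \<in> A" "\<And>z i. i \<le> - N \<Longrightarrow> lab (z, i) \<notin> A"
    by (rule sides) blast
  have leads: "leads (\<lambda>i. lab (\<Phi> (s, i)))" for s
  proof -
    have "lab (\<Phi> (s, i)) \<in> A" if "i \<ge> N + B" for i
      using N(2)[of "snd (\<Phi> (s, i))" "fst (\<Phi> (s, i))"] assms(3)[of s i] that by simp
    moreover have "lab (\<Phi> (s, i)) \<notin> A" if "i \<le> - N - B" for i
      using N(3)[of "snd (\<Phi> (s, i))" "fst (\<Phi> (s, i))"] assms(3)[of s i] that by simp
    ultimately show ?thesis unfolding leads_def by blast
  qed
  show "leads (\<lambda>i. lab (\<Phi> (False, i)))" "leads (\<lambda>i. lab (\<Phi> (True, i)))" by (rule leads)+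
qed

text \<open>A pair with \<open>\<sigma> = -1\<close> is first reversed to \<open>\<Psi>\<close>,
  which then forms a ray pair; uniqueness of the circle forces its edges to be those of
  \<open>p\<close> and \<open>q\<close>.\<close>

lemma rigid_H: "rigid H"
  unfolding rigid_def
proof (intro conjI allI impI)
  fix u v assume "H u v" then show "H v u" by (simp add: H_def insert_commute)
next
  fix s and i :: int
  show "H (s, i) (s, i + 1)" using rays(7,8) by (cases s) (simp_all add: H_def)
next
  fix \<Phi> s i assume "two_rays H \<Phi>"
  then obtain \<sigma> B where \<Phi>: "bij \<Phi>" "\<And>s i. H (\<Phi> (s, i)) (\<Phi> (s, i + 1))" "\<sigma> = 1 \<or> \<sigma> = -1"
    "\<And>s i. \<bar>snd (\<Phi> (s, i)) - \<sigma> * i\<bar> \<le> B" unfolding two_rays_def by blast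
  define \<Psi> where "\<Psi> = (\<lambda>(s, i). \<Phi> (s, \<sigma> * i))"
  have "bij (\<lambda>(s::bool, i). (s, \<sigma> * i))"
    by (rule o_bij[where g = "\<lambda>(s, i). (s, \<sigma> * i)"]) (use \<Phi>(3) in \<open>auto simp: fun_eq_iff\<close>)
  then have "bij (\<Phi> \<circ> (\<lambda>(s, i). (s, \<sigma> * i)))" by (rule bij_comp[OF _ \<Phi>(1)])
  moreover have "\<Phi> \<circ> (\<lambda>(s, i). (s, \<sigma> * i)) = \<Psi>" by (auto simp: \<Psi>_def fun_eq_iff)
  ultimately have "bij \<Psi>" by simp
  moreover have "H (\<Psi> (s, i)) (\<Psi> (s, i + 1))" for s i
    using \<Phi>(3)
  proof
    assume "\<sigma> = 1" then show ?thesis using \<Phi>(2) by (simp add: \<Psi>_def)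
  next
    assume "\<sigma> = -1"
    then show ?thesis using \<Phi>(2)[of s "- i - 1"] by (simp add: \<Psi>_def H_def insert_commute)
  qed
  moreover have "\<bar>snd (\<Psi> (s, i)) - i\<bar> \<le> B" for s i
    using \<Phi>(3) \<Phi>(4)[of s "\<sigma> * i"] by (auto simp: \<Psi>_def)
  ultimately have rp': "ray_pair (\<lambda>i. lab (\<Psi> (False, i))) (\<lambda>i. lab (\<Psi> (True, i)))"
    by (rule two_rays_ray_pair)
  have \<Psi>: "{lab (\<Psi> (s, j)), lab (\<Psi> (s, j + 1))} \<in> line_edges p \<union> line_edges q" for j
  proof -
    have "{lab (\<Psi> (s, j)), lab (\<Psi> (s, j + 1))} \<in>
        line_edges (\<lambda>i. lab (\<Psi> (False, i))) \<union> line_edges (\<lambda>i. lab (\<Psi> (True, i)))"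
      unfolding line_edges_def by (cases s) auto
    then show ?thesis using unique_circle_edges[OF unique rp rp'] by simp
  qed
  show "standard_edge (\<Phi> (s, i)) (\<Phi> (s, i + 1))"
    using \<Phi>(3)
  proof
    assume "\<sigma> = 1" then show ?thesis using lab_edges[OF \<Psi>[of i]] by (simp add: \<Psi>_def)
  next
    assume "\<sigma> = -1"
    then show ?thesis using lab_edges[OF \<Psi>[of "- i - 1"]]
      by (simp add: \<Psi>_def standard_edge_def abs_minus_commute add.commute)
  qed
qed

lemma finite_H: "finite {v. H u v}"
proof -
  have "lab u \<in> verts G" using range_lab by blast
  then have "finite {w. {lab u, w} \<in> edges G}" using locfin unfolding locally_finite_def by blast
  then have "finite (lab -` {w. {lab u, w} \<in> edges G})" by (rule finite_vimageI[OF _ inj_lab])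
  then show ?thesis by (simp add: H_def vimage_def)
qed

text \<open>If neither end of such an edge has a position in \<open>{- N..N}\<close>, the edge joins
  the complement to \<open>A\<close>, and then its upper end lies in the boundary. So every such
  edge has an end in the finite set \<open>F\<close>.\<close>

lemma finite_H_crossing: "finite {(u, v). H u v \<and> snd u \<le> 0 \<and> 0 < snd v}"
proof -
  obtain N where N: "N > 0" "\<And>z i. i \<ge> N \<Longrightarrow> lab (z, i) \<in> A" "\<And>z i. i \<le> - N \<Longrightarrow> lab (z, i) \<notin> A"
    by (rule sides) blast
  define F where "F = UNIV \<times> {- N..N} \<union> lab -` boundary G A"
  have "finite F" unfolding F_def using finite_vimageI[OF side(4) inj_lab] by simp
  then have "finite (Sigma F (\<lambda>u. {v. H u v}))" using finite_H by blast
  then have fin: "finite (Sigma F (\<lambda>u. {v. H u v}) \<union> prod.swap ` Sigma F (\<lambda>u. {v. H u v}))" by blast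
  have "(u, v) \<in> Sigma F (\<lambda>u. {v. H u v}) \<union> prod.swap ` Sigma F (\<lambda>u. {v. H u v})"
    if uv: "H u v" "snd u \<le> 0" "0 < snd v" for u v
  proof (cases "u \<in> F")
    case True
    then show ?thesis using uv(1) by simp
  next
    case False
    have "v \<in> F"
    proof (cases "snd v \<le> N")
      case True
      then show ?thesis using uv(3) N(1) by (cases v) (simp add: F_def)
    next
      case v: False
      have "snd u < - N" using False uv(2) N(1) by (cases u) (auto simp: F_def)
      then have "lab u \<notin> A" "lab v \<in> A"
        using N(3)[of "snd u" "fst u"] N(2)[of "snd v" "fst v"] v by auto
      moreover have "lab v \<in> verts G" using range_lab by blast
      ultimately have "lab v \<in> boundary G A" using uv(1) unfolding H_def boundary_def by blast
      then show ?thesis by (simp add: F_def)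
    qed
    moreover have "H v u" using uv(1) by (simp add: H_def insert_commute)
    ultimately have "(v, u) \<in> Sigma F (\<lambda>u. {v. H u v})" by simp
    then have "prod.swap (v, u) \<in> prod.swap ` Sigma F (\<lambda>u. {v. H u v})" by (rule imageI)
    then show ?thesis by simp
  qed
  then have "{(u, v). H u v \<and> snd u \<le> 0 \<and> 0 < snd v} \<subseteq> Sigma F (\<lambda>u. {v. H u v}) \<union> prod.swap ` Sigma F (\<lambda>u. {v. H u v})"
    by blast
  then show ?thesis using fin by (rule finite_subset)
qed

text \<open>Otherwise \<open>range p\<close> would be closed under adjacency, contrary to
  connectedness.\<close>

lemma H_cross: "\<exists>a b. H (False, a) (True, b)"
proof (rule ccontr)
  assume no: "\<not> ?thesis"
  have "component_of G (p 0) \<subseteq> range p"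
  proof (rule component_of_subset)
    fix x y assume "x \<in> range p" "{x, y} \<in> edges G"
    then obtain i where i: "{p i, y} \<in> edges G" by blast
    then have "y \<in> range p \<union> range q" using edge_verts[OF simple i] rays(4) by simp
    moreover have "y \<noteq> q j" for j using no i by (auto simp: H_def)
    ultimately show "y \<in> range p" by blast
  qed simp
  moreover have "q 0 \<in> component_of G (p 0)"
    by (rule connected_graph_component[OF conn]) (use rays(5,6) in auto)
  ultimately show False using rays(3) by blast
qed

text \<open>By uniqueness an automorphism permutes the edges of the given rays. In terms of labels
  it therefore maps each ray to an injective walk on standard edges, and such a walk is
  affine.\<close>

lemma H_transitive: "\<exists>\<epsilon> \<delta> b. affine_automorphism H z \<epsilon> i \<delta> b"
proof -
  have lv: "lab v \<in> verts G" for v using range_lab by blast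
  obtain f where f: "graph_iso f G G" "f (lab (False, 0)) = lab (z, i)"
    using vt lv unfolding vertex_transitive_def by blast
  have bij: "bij_betw f (verts G) (verts G)"
    and adj: "\<And>u v. u \<in> verts G \<Longrightarrow> v \<in> verts G \<Longrightarrow> {u, v} \<in> edges G \<longleftrightarrow> {f u, f v} \<in> edges G"
    using f(1) unfolding graph_iso_def by blast+
  have edges: "line_edges (f \<circ> p) \<union> line_edges (f \<circ> q) = line_edges p \<union> line_edges q"
    using ray_pair_automorphism[OF f(1) rp]
  proof
    assume "ray_pair (f \<circ> p \<circ> uminus) (f \<circ> q \<circ> uminus)"
    from unique_circle_edges[OF unique this rp] show ?thesis by (simp add: line_edges_reverse)
  qed (rule unique_circle_edges[OF unique _ rp])
  define \<alpha> where "\<alpha> = (\<lambda>v. inv lab (f (lab v)))"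
  have la: "lab (\<alpha> v) = f (lab v)" for v
  proof -
    have "f (lab v) \<in> range lab" unfolding range_lab by (rule bij_betw_apply[OF bij lv])
    then show ?thesis unfolding \<alpha>_def by (rule f_inv_into_f)
  qed
  have inj\<alpha>: "inj \<alpha>"
  proof (rule injI)
    fix u v assume "\<alpha> u = \<alpha> v"
    then have "f (lab u) = f (lab v)" using la by metis
    then have "lab u = lab v" using inj_onD[OF bij_betw_imp_inj_on[OF bij] _ lv lv] by blast
    then show "u = v" by (rule injD[OF inj_lab])
  qed
  have H\<alpha>: "H (\<alpha> u) (\<alpha> v) = H u v" for u v
    unfolding H_def la using adj[OF lv lv] by simp
  have walk: "\<exists>z \<epsilon> c. \<epsilon> \<in> {1, -1 :: int} \<and> (\<forall>i. \<alpha> (s, i) = (z, \<epsilon> * i + c))" for s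
  proof (rule standard_walk)
    show "inj (\<lambda>i. \<alpha> (s, i))" by (auto intro!: injI dest!: injD[OF inj\<alpha>])
    fix i
    have "{lab (\<alpha> (s, i)), lab (\<alpha> (s, i + 1))} \<in> line_edges p \<union> line_edges q"
    proof -
      have "{lab (\<alpha> (s, i)), lab (\<alpha> (s, i + 1))} \<in> line_edges (f \<circ> p) \<union> line_edges (f \<circ> q)"
        unfolding la line_edges_def by (cases s) auto
      then show ?thesis by (simp only: edges)
    qed
    then show "standard_edge (\<alpha> (s, i)) (\<alpha> (s, i + 1))" by (rule lab_edges)
  qed
  obtain z0 \<epsilon> a where F: "\<epsilon> \<in> {1, -1}" "\<And>i. \<alpha> (False, i) = (z0, \<epsilon> * i + a)" using walk[of False] by blast
  obtain z1 \<delta> b where T: "\<delta> \<in> {1, -1}" "\<And>i. \<alpha> (True, i) = (z1, \<delta> * i + b)" using walk[of True] by blast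
  have "\<alpha> (False, 0) = (z, i)" unfolding \<alpha>_def f(2) using inj_lab by simp
  then have z: "z0 = z" "a = i" using F(2)[of 0] by simp_all
  have "z1 \<noteq> z0"
  proof
    assume "z1 = z0"
    then have "\<alpha> (False, \<epsilon> * (b - a)) = \<alpha> (True, 0)" using F T by auto
    then show False using injD[OF inj\<alpha>] by fastforce
  qed
  then have "z1 = (\<not> z)" using z by auto
  then show ?thesis
    unfolding affine_automorphism_def using F T z H\<alpha> by blast
qed

lemma stride_labelling_exists: "\<exists>S l. stride_labelling S G l"
proof -
  obtain a b where ab: "H (False, a) (True, b)" using H_cross by blast
  interpret two_line_graph H a b
  proof
    show "\<not> H v v" for v using edge_verts(3)[OF simple, of "lab v" "lab v"] by (auto simp: H_def)
  qed (use rigid_H finite_H finite_H_crossing ab H_transitive in auto)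
  \<comment> \<open>Even integers enumerate \<open>p\<close> and odd ones enumerate
    \<open>q\<close>, displaced by \<open>c\<close>. A rung of offset \<open>c\<close> then joins
    \<open>2 * i\<close> to \<open>2 * i + 1\<close>, and one of offset \<open>c - 1\<close>,
    present only in the square, joins \<open>2 * i\<close> to \<open>2 * i - 1\<close>.\<close>
  have label: "stride_labelling S G (\<lambda>k. if even k then p (k div 2) else q (k div 2 + c))"
    if cr: "\<And>i j. H (False, i) (True, j) \<longleftrightarrow> j = i + c \<or> S \<and> j = i + c - 1" for S c
  proof -
    define e :: "int \<Rightarrow> bool \<times> int" where "e = (\<lambda>k. if even k then (False, k div 2) else (True, k div 2 + c))"
    have "bij e"
      by (rule o_bij[where g = "\<lambda>(s, i). if s then 2 * (i - c) + 1 else 2 * i"])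
        (auto simp: e_def fun_eq_iff)
    then have b1: "bij_betw (lab \<circ> e) UNIV (verts G)"
      using inj_lab range_lab by (metis bij_betw_def bij_betw_trans bij_def)
    have b2: "{lab (e i), lab (e j)} \<in> edges G \<longleftrightarrow> stride_adj S i j" for i j
    proof -
      have cr': "H (True, j) (False, i) \<longleftrightarrow> j = i + c \<or> S \<and> j = i + c - 1" for i j
        using cr sym by blast
      have even_diff: "\<bar>2 * x - 2 * y\<bar> \<noteq> 1" "\<bar>2 * x - 2 * y\<bar> = 2 \<longleftrightarrow> \<bar>x - y\<bar> = 1" for x y :: int
        by presburger+
      have "H (e i) (e j) \<longleftrightarrow> stride_adj S i j"
      proof (cases "even i"; cases "even j")
        assume "even i" "even j"
        then obtain x y where "i = 2 * x" "j = 2 * y" by (auto elim!: evenE)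
        then show ?thesis by (simp add: e_def ladder_or_square(2) stride_adj_def even_diff)
      next
        assume "even i" "odd j"
        then obtain x y where "i = 2 * x" "j = 2 * y + 1" by (auto elim!: evenE oddE)
        then show ?thesis by (auto simp add: e_def cr stride_adj_def min_def; presburger)
      next
        assume "odd i" "even j"
        then obtain x y where "i = 2 * x + 1" "j = 2 * y" by (auto elim!: evenE oddE)
        then show ?thesis by (auto simp add: e_def cr' stride_adj_def min_def; presburger)
      next
        assume "odd i" "odd j"
        then obtain x y where "i = 2 * x + 1" "j = 2 * y + 1" by (auto elim!: oddE)
        then show ?thesis by (simp add: e_def ladder_or_square(2) stride_adj_def even_diff)
      qed
      then show ?thesis by (simp add: H_def)
    qed
    have eq: "(\<lambda>k. if even k then p (k div 2) else q (k div 2 + c)) = lab \<circ> e"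
      by (auto simp: e_def fun_eq_iff)
    show ?thesis unfolding stride_labelling_def eq using b1 b2 by simp
  qed
  obtain d where "(\<forall>i j. H (False, i) (True, j) \<longleftrightarrow> j = i + d) \<or>
      (\<forall>i j. H (False, i) (True, j) \<longleftrightarrow> j = i + d \<or> j = i + d + 1)"
    using ladder_or_square(1) by blast
  then show ?thesis
  proof
    assume h: "\<forall>i j. H (False, i) (True, j) \<longleftrightarrow> j = i + d"
    have "stride_labelling False G (\<lambda>k. if even k then p (k div 2) else q (k div 2 + d))"
      by (rule label) (simp add: h)
    then show ?thesis by blast
  next
    assume h: "\<forall>i j. H (False, i) (True, j) \<longleftrightarrow> j = i + d \<or> j = i + d + 1"
    \<comment> \<open>The larger of the two offsets takes the role of \<open>c\<close>.\<close>
    have "stride_labelling True G (\<lambda>k. if even k then p (k div 2) else q (k div 2 + (d + 1)))"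
      by (rule label) (auto simp: h)
    then show ?thesis by blast
  qed
qed

end

theorem theorem1p9:
  fixes X :: "'a ugraph"
  assumes "simple_graph X"
  shows "(connected_graph X \<and> locally_finite X \<and> vertex_transitive X \<and>
          number_of_ends X = 2 \<and> (\<exists>!C. hamiltonian_circle X C)) \<longleftrightarrow>
         isomorphic X path_square \<or> isomorphic X ladder"
proof
  assume X: "connected_graph X \<and> locally_finite X \<and> vertex_transitive X \<and>
    number_of_ends X = 2 \<and> (\<exists>!C. hamiltonian_circle X C)"
  then obtain A where "two_sided_graph X A" using two_ended_two_sided[OF assms] by blast
  then interpret two_sided_graph X A .
  obtain C where "hamiltonian_circle X C" using X by blast
  then obtain p q where "ray_pair p q" by (rule hamiltonian_circle_ray_pair)
  then interpret unique_circle X A p q by unfold_locales (use X in auto)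
  obtain S l where "stride_labelling S X l" using stride_labelling_exists by blast
  then show "isomorphic X path_square \<or> isomorphic X ladder"
    unfolding isomorphic_path_square isomorphic_ladder by (cases S) auto
next
  assume "isomorphic X path_square \<or> isomorphic X ladder"
  then obtain S l where l: "stride_labelling S X l"
    unfolding isomorphic_path_square isomorphic_ladder by blast
  interpret two_sided_graph X "l ` {0<..}" by (rule stride_labelling_two_sided(1)[OF l assms])
  show "connected_graph X \<and> locally_finite X \<and> vertex_transitive X \<and>
    number_of_ends X = 2 \<and> (\<exists>!C. hamiltonian_circle X C)"
    using stride_labelling_two_sided(2)[OF l assms] locfin stride_labelling_transitive[OF l]
      number_of_ends_2 stride_labelling_unique_circle[OF l assms] by blast
qed

end
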